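(* Let $a\in C^1(\mathbf{R})$ and assume there exists $\beta\ge1$ such that for each $M>0$ there exists $\alpha_M>0$ with $$a'(v)-a'(w)\ge\alpha_M(v-w)^\beta\qquad\text{whenever } -M\le w<v\le M.$$ Let $\gamma\in\mathbf{N}$ and let $m$ be a signed Radon measure on $\mathbf{R}_+\times\mathbf{R}\times\mathbf{R}$. Assume $f\in L^\infty(\mathbf{R}_+\times\mathbf{R}\times\mathbf{R})$, $f\equiv f(t,x,v)$, satisfies in the sense of distributions $$(\partial_t+a'(v)\partial_x)f=\partial_v^\gamma m,$$ and that for each $y\in\mathbf{R}$ and each $s\ge0$, $$\big(f(t+s,x+y,v)-f(t,x,v)\big)\big(f(t+s,x+y,w)-f(t,x,w)\big)\ge0\quad\text{for a.e. }(t,x,v,w)\in\mathbf{R}_+\times\mathbf{R}\times\mathbf{R}\times\mathbf{R}.$$ Then for each $\psi\in C^\infty_c(\mathbf{R})$, $$\int_{\mathbf{R}}f(t,x,v)\psi(v)\,dv\in B^{s,2}_{\infty,loc}((0,\infty)\times\mathbf{R})\quad\text{with } s=\frac1{4+2\beta}.$$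
   Context: For an open set $\Omega\subset\mathbf{R}^2$, $0<s<1$ and $1\le p<\infty$, a function $g\in L^p_{loc}(\Omega)$ belongs to the local Besov space $B^{s,p}_{\infty,loc}(\Omega)$ if for every compact $K\subset\Omega$ there exist $C,h_0>0$ such that $\int_K|g(z+h)-g(z)|^p\,dz\le C|h|^{sp}$ for all $h\in\mathbf{R}^2$ with $|h|\le h_0$. *)

theory Defs
  imports "HOL-Analysis.Analysis"
begin

text \<open>Points of R x R x R are written (t, x, v). Coordinate directions 0,1,2 = t,x,v.\<close>

definition unitv3 :: "nat \<Rightarrow> real \<times> real \<times> real" where
  "unitv3 i = (if i = 0 then (1,0,0) else if i = 1 then (0,1,0) else (0,0,1))"

definition pdiff3 :: "nat \<Rightarrow> (real \<times> real \<times> real \<Rightarrow> real) \<Rightarrow> real \<times> real \<times> real \<Rightarrow> real" where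
  "pdiff3 i \<phi> p = deriv (\<lambda>h. \<phi> (p + h *\<^sub>R unitv3 i)) 0"

fun iter_pdiff3 :: "nat list \<Rightarrow> (real \<times> real \<times> real \<Rightarrow> real) \<Rightarrow> real \<times> real \<times> real \<Rightarrow> real" where
  "iter_pdiff3 [] \<phi> = \<phi>"
| "iter_pdiff3 (i # is) \<phi> = pdiff3 i (iter_pdiff3 is \<phi>)"

definition smooth3 :: "(real \<times> real \<times> real \<Rightarrow> real) \<Rightarrow> bool" where
  "smooth3 \<phi> \<longleftrightarrow> (\<forall>is. set is \<subseteq> {0,1,2} \<longrightarrow>
      continuous_on UNIV (iter_pdiff3 is \<phi>) \<and>
      (\<forall>i\<in>{0,1,2}. \<forall>p. (\<lambda>h. iter_pdiff3 is \<phi> (p + h *\<^sub>R unitv3 i)) differentiable (at 0)))"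

definition test_fun3 :: "(real \<times> real \<times> real) set \<Rightarrow> (real \<times> real \<times> real \<Rightarrow> real) \<Rightarrow> bool" where
  "test_fun3 U \<phi> \<longleftrightarrow> smooth3 \<phi> \<and> compact (closure {p. \<phi> p \<noteq> 0}) \<and> closure {p. \<phi> p \<noteq> 0} \<subseteq> U"

definition test_fun1 :: "(real \<Rightarrow> real) \<Rightarrow> bool" where
  "test_fun1 \<psi> \<longleftrightarrow> (\<forall>k. \<forall>x. ((deriv ^^ k) \<psi>) differentiable (at x)) \<and> compact (closure {x. \<psi> x \<noteq> 0})"

definition Dom3 :: "(real \<times> real \<times> real) set" where
  "Dom3 = {0<..} \<times> UNIV"

definition besov_loc :: "real \<Rightarrow> real \<Rightarrow> (real \<times> real) set \<Rightarrow> (real \<times> real \<Rightarrow> real) \<Rightarrow> bool" where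
  "besov_loc s p \<Omega> g \<longleftrightarrow>
     g \<in> borel_measurable (lebesgue_on \<Omega>) \<and>
     (\<forall>K. compact K \<and> K \<subseteq> \<Omega> \<longrightarrow> (\<integral>\<^sup>+ z \<in> K. ennreal (\<bar>g z\<bar> powr p) \<partial>lebesgue) < \<infinity>) \<and>
     (\<forall>K. compact K \<and> K \<subseteq> \<Omega> \<longrightarrow>
        (\<exists>C h0. C > 0 \<and> h0 > 0 \<and>
          (\<forall>h. norm h \<le> h0 \<longrightarrow>
             (\<integral>\<^sup>+ z \<in> K. ennreal (\<bar>g (z + h) - g z\<bar> powr p) \<partial>lebesgue)
               \<le> ennreal (C * norm h powr (s * p)))))"

definition radon_on_Dom3 :: "(real \<times> real \<times> real) measure \<Rightarrow> bool" where
  "radon_on_Dom3 \<mu> \<longleftrightarrow> sets \<mu> = sets (restrict_space borel Dom3) \<and>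
     (\<forall>K. compact K \<and> K \<subseteq> Dom3 \<longrightarrow> emeasure \<mu> K < \<infinity>)"

end

theory Submission
  imports Defs
begin

text \<open>Testing the kinetic equation against \<open>\<Psi> v\<close> and \<open>v * \<Psi> v\<close>, for a smooth compactly supported
  \<open>\<Psi> \<ge> \<bar>\<psi>\<bar>\<close>, removes the derivatives \<open>\<partial>\<^sub>v\<^sup>\<gamma>\<close>: the moments \<open>u i\<close>, \<open>b i\<close> of \<open>f\<close> and \<open>a' f\<close>
  (\<open>i = 0, 1\<close>) are bounded and \<open>\<partial>\<^sub>t (u i) + \<partial>\<^sub>x (b i)\<close> is a locally finite measure. For a shift of length
  \<open>\<eta>\<close> along a coordinate axis, with increments \<open>D\<close>, a div-curl argument bounds the local integral of
  \<open>W = D (u 0) * D (b 1) - D (u 1) * D (b 0)\<close> by \<open>C * \<eta>\<close>. On the other hand \<open>2 W\<close> is the double integral of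
  \<open>(v - w) (a' v - a' w) \<Psi> v \<Psi> w D f v D f w\<close>, where \<open>D f v D f w \<ge> 0\<close>, hence it controls \<open>\<bar>v - w\<bar> powr (\<beta> + 1)\<close>
  against the same weight. Cutting at \<open>\<bar>v - w\<bar> = \<delta>\<close> gives
  \<open>\<integral> (D (\<integral> f \<psi>))\<^sup>2 \<le> C (\<delta> + \<delta> powr (- \<beta> - 1) * \<eta>)\<close>, and \<open>\<delta> = \<eta> powr (1 / (2 + \<beta>))\<close> is the optimal choice.\<close>

section \<open>A div-curl estimate for smooth functions\<close>

text \<open>The source is only a measure, so the moments have no classical derivatives to integrate
  by parts. The div-curl bound is therefore proved for smooth functions, with a constant that
  depends only on sup bounds of the moments, on the cutoff and on the local L^1 norm of the source.
  Mollification keeps all of these under control, and W passes to the limit because it is bilinear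
  in bounded functions that converge in L^1. The weights 1 and v make W a determinant, and its
  antisymmetry is what produces the factor v - w next to a' v - a' w. The majorant \<Psi> enters
  because the double integral has a sign only if its weight has one, and \<psi> may change sign.
  Once W is nonnegative almost everywhere, the bound on its signed integral is a bound on its mass,
  which can then be restricted to a smaller set. Both \<Psi> and the mollifiers are made from \<psi>
  itself by squaring and rescaling, so \<psi> = 0 is treated apart.\<close>

lemma continuous_antiderivative:
  fixes g :: "real \<Rightarrow> real"
  assumes "continuous_on UNIV g"
  obtains G where "\<And>x. (G has_real_derivative g x) (at x)"
proof -
  have "\<exists>F. \<forall>x. - \<infinity> < ereal x \<longrightarrow> ereal x < \<infinity> \<longrightarrow> (F has_vector_derivative g x) (at x)"
    using assms by (intro einterval_antiderivative) (auto simp: continuous_on_eq_continuous_at)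
  then show ?thesis using that by (auto simp: has_real_derivative_iff_has_vector_derivative)
qed

lemma has_real_derivative_shift:
  assumes "\<And>x. (G has_real_derivative g x) (at x)"
  shows "((\<lambda>h. G (x + h)) has_real_derivative g (x + h)) (at h within A)"
proof -
  have "((\<lambda>h. x + h) has_real_derivative 1) (at h within A)" by (auto intro!: derivative_eq_intros)
  then show ?thesis using DERIV_chain2[OF assms] by fastforce
qed

lemma continuous_slice:
  fixes F :: "real \<Rightarrow> real \<Rightarrow> real"
  assumes "continuous_on UNIV (\<lambda>(t,x). F t x)"
  shows "continuous_on A (F t)" "continuous_on B (\<lambda>t. F t x)"
proof -
  have "continuous_on A ((\<lambda>(t,x). F t x) \<circ> (\<lambda>x. (t,x)))"
    by (intro continuous_on_compose continuous_intros continuous_on_subset[OF assms]) auto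
  then show "continuous_on A (F t)" by (simp add: o_def)
  have "continuous_on B ((\<lambda>(t,x). F t x) \<circ> (\<lambda>t. (t,x)))"
    by (intro continuous_on_compose continuous_intros continuous_on_subset[OF assms]) auto
  then show "continuous_on B (\<lambda>t. F t x)" by (simp add: o_def)
qed

lemma continuous_compose2:
  fixes F :: "real \<Rightarrow> real \<Rightarrow> real"
  assumes "continuous_on UNIV (\<lambda>(t,x). F t x)"
    and "continuous_on A f" "continuous_on A g"
  shows "continuous_on A (\<lambda>z. F (f z) (g z))"
proof -
  have "continuous_on A ((\<lambda>(t,x). F t x) \<circ> (\<lambda>z. (f z, g z)))"
    by (intro continuous_on_compose continuous_intros continuous_on_subset[OF assms(1)] assms) auto
  then show ?thesis by (simp add: o_def)
qed

lemma iterated_integral_swap: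
  fixes F :: "real \<Rightarrow> real \<Rightarrow> real"
  assumes "continuous_on UNIV (\<lambda>(t,x). F t x)"
  shows "integral {a..b} (\<lambda>t. integral {c..d} (F t)) = integral {c..d} (\<lambda>x. integral {a..b} (\<lambda>t. F t x))"
  using integral_swap_continuous[of a c b d F] continuous_on_subset[OF assms] by auto

lemma iterated_integral_cbox:
  fixes F :: "real \<Rightarrow> real \<Rightarrow> real"
  assumes "continuous_on UNIV (\<lambda>(t,x). F t x)"
  shows "integral {a..b} (\<lambda>t. integral {c..d} (F t)) = integral (cbox (a,c) (b,d)) (\<lambda>(t,x). F t x)"
  using integral_prod_continuous[of a c b d "\<lambda>(t,x). F t x"] continuous_on_subset[OF assms] by auto

text \<open>The moving averages \<open>w i\<close> are potentials of the increments: \<open>\<partial>\<^sub>x (w i) = D (u i)\<close> and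
  \<open>\<partial>\<^sub>t (w i) = m i - D (b i)\<close> with \<open>m i\<close> the moving average of the source. Hence the
  quadratic expression is, up to the small source terms, the Jacobian of \<open>(w 0, w 1)\<close>, which is a divergence,
  and \<open>w 0\<close> is itself of size \<open>y\<close>.\<close>

lemma compensated_increment_bound:
  fixes u b ut bx :: "nat \<Rightarrow> real \<Rightarrow> real \<Rightarrow> real" and p p' q q' :: "real \<Rightarrow> real"
  assumes cu: "\<And>i. continuous_on UNIV (\<lambda>(t,x). u i t x)"
    and cb: "\<And>i. continuous_on UNIV (\<lambda>(t,x). b i t x)"
    and cut: "\<And>i. continuous_on UNIV (\<lambda>(t,x). ut i t x)"
    and cbx: "\<And>i. continuous_on UNIV (\<lambda>(t,x). bx i t x)"
    and dut: "\<And>i t x. ((\<lambda>t. u i t x) has_real_derivative ut i t x) (at t)"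
    and dbx: "\<And>i t x. (b i t has_real_derivative bx i t x) (at x)"
    and bu: "\<And>i t x. \<bar>u i t x\<bar> \<le> U" and bb: "\<And>i t x. \<bar>b i t x\<bar> \<le> U"
    and t12: "t1 \<le> t2" and x12: "x1 \<le> x2" and y: "0 \<le> y" "y \<le> 1"
    and dp: "\<And>t. (p has_real_derivative p' t) (at t)" and dq: "\<And>x. (q has_real_derivative q' x) (at x)"
    and cp': "continuous_on UNIV p'" and cq': "continuous_on UNIV q'"
    and p0: "p t1 = 0" "p t2 = 0" and q0: "q x1 = 0" "q x2 = 0"
    and X: "\<And>t x. t \<in> {t1..t2} \<Longrightarrow> x \<in> {x1..x2} \<Longrightarrow>
              \<bar>p t * q x\<bar> \<le> X \<and> \<bar>p' t * q x\<bar> \<le> X \<and> \<bar>p t * q' x\<bar> \<le> X"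
    and N: "\<And>i. integral {t1..t2} (\<lambda>t. integral {x1..x2+1} (\<lambda>x. \<bar>ut i t x + bx i t x\<bar>)) \<le> N"
  shows "\<bar>integral {t1..t2} (\<lambda>t. integral {x1..x2} (\<lambda>x. p t * q x *
            ((u 0 t (x+y) - u 0 t x) * (b 1 t (x+y) - b 1 t x)
             - (u 1 t (x+y) - u 1 t x) * (b 0 t (x+y) - b 0 t x))))\<bar>
          \<le> y * (5 * X * U * N + 4 * X * U\<^sup>2 * ((t2-t1)*(x2-x1)))"
proof -
  define Sh where "Sh F t x = integral {0..y} (\<lambda>\<theta>. F t (x+\<theta>))" for F :: "real \<Rightarrow> real \<Rightarrow> real" and t x
  define D where "D F t x = F t (x+y) - F t x" for F :: "real \<Rightarrow> real \<Rightarrow> real" and t x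
  define m where "m i t x = ut i t x + bx i t x" for i t x
  have cm: "continuous_on UNIV (\<lambda>(t,x). m i t x)" for i
    using continuous_on_add[OF cut[of i] cbx[of i]] by (simp add: m_def split_def)
  have cD: "continuous_on UNIV (\<lambda>(t,x). D F t x)" if "continuous_on UNIV (\<lambda>(t,x). F t x)" for F unfolding D_def split_def
    by (intro continuous_intros continuous_compose2[OF that])
  have cSh: "continuous_on UNIV (\<lambda>(t,x). Sh F t x)" if "continuous_on UNIV (\<lambda>(t,x). F t x)" for F
  proof -
    have "continuous_on UNIV (\<lambda>z. integral (cbox 0 y) ((\<lambda>z \<theta>. F (fst z) (snd z + \<theta>)) z))"
      by (rule integral_continuous_on_param)
         (auto simp: split_def intro!: continuous_intros continuous_compose2[OF that])
    then show ?thesis by (simp add: Sh_def split_def)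
  qed
  have Shb: "\<bar>Sh F t x\<bar> \<le> y * B" if "continuous_on UNIV (\<lambda>(t,x). F t x)" "\<And>x. \<bar>F t x\<bar> \<le> B" for F t x B
  proof -
    have "norm (integral {0..y} (\<lambda>\<theta>. F t (x+\<theta>))) \<le> integral {0..y} (\<lambda>\<theta>. B)" using that y
      by (intro integral_norm_bound_integral integrable_continuous_real continuous_compose2[OF that(1)] continuous_intros) auto
    then show ?thesis using y by (simp add: Sh_def)
  qed
  have dSh: "(Sh F t has_real_derivative D F t x) (at x)" if c: "continuous_on UNIV (\<lambda>(t,x). F t x)" for F t x
  proof -
    obtain G where G: "\<And>x. (G has_real_derivative F t x) (at x)"
      using continuous_antiderivative[OF continuous_slice(1)[OF c]] by blast
    have "Sh F t = (\<lambda>x. G (x+y) - G x)"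
    proof
      fix x
      have "((\<lambda>\<theta>. F t (x+\<theta>)) has_integral G (x+y) - G (x+0)) {0..y}"
        using y(1) by (intro fundamental_theorem_of_calculus)
          (auto simp flip: has_real_derivative_iff_has_vector_derivative intro!: has_real_derivative_shift[OF G])
      then show "Sh F t x = G (x+y) - G x" by (simp add: Sh_def integral_unique)
    qed
    then show ?thesis unfolding D_def by (auto intro!: derivative_eq_intros DERIV_chain2[OF G])
  qed
  have dSht: "((\<lambda>t. Sh F t x) has_real_derivative Sh F' t x) (at t)"
    if c: "continuous_on UNIV (\<lambda>(t,x). F t x)" "continuous_on UNIV (\<lambda>(t,x). F' t x)"
      and d: "\<And>t x. ((\<lambda>t. F t x) has_real_derivative F' t x) (at t)" for F F' t x
  proof -
    have "((\<lambda>t. integral (cbox 0 y) ((\<lambda>t \<theta>. F t (x+\<theta>)) t)) has_real_derivative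
             integral (cbox 0 y) ((\<lambda>t \<theta>. F' t (x+\<theta>)) t)) (at t within UNIV)"
      by (rule leibniz_rule_field_derivative)
         (auto simp: split_def intro!: d continuous_intros integrable_continuous_real continuous_compose2[OF c(1)] continuous_compose2[OF c(2)])
    then show ?thesis by (simp add: Sh_def)
  qed
  have Shbx: "Sh (bx i) t x = D (b i) t x" for i t x
  proof -
    have "((\<lambda>\<theta>. bx i t (x+\<theta>)) has_integral b i t (x+y) - b i t (x+0)) {0..y}"
      using y(1) by (intro fundamental_theorem_of_calculus)
        (auto simp flip: has_real_derivative_iff_has_vector_derivative intro!: has_real_derivative_shift[OF dbx])
    then show ?thesis by (simp add: Sh_def D_def integral_unique)
  qed
  have Shm: "Sh (m i) t x = Sh (ut i) t x + D (b i) t x" for i t x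
  proof -
    have "Sh (m i) t x = Sh (ut i) t x + Sh (bx i) t x" unfolding Sh_def m_def
      by (intro Henstock_Kurzweil_Integration.integral_add integrable_continuous_real continuous_compose2[OF cut] continuous_compose2[OF cbx] continuous_intros)
    then show ?thesis by (simp add: Shbx)
  qed
  have L1: "integral {t1..t2} (\<lambda>t. integral {x1..x2} (\<lambda>x. \<bar>Sh (m i) t x\<bar>)) \<le> y * N" for i
  proof -
    define g where "g t x = \<bar>m i t x\<bar>" for t x
    have cg: "continuous_on UNIV (\<lambda>(t,x). g t x)" using continuous_on_rabs[OF cm[of i]] by (simp add: g_def split_def)
    have cS: "continuous_on UNIV (\<lambda>(t,x). \<bar>Sh (m i) t x\<bar>)"
      using continuous_on_rabs[OF cSh[OF cm[of i]]] by (simp add: split_def)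
    have le: "\<bar>Sh (m i) t x\<bar> \<le> Sh g t x" for t x
    proof -
      have "norm (integral {0..y} (\<lambda>\<theta>. m i t (x+\<theta>))) \<le> integral {0..y} (\<lambda>\<theta>. g t (x+\<theta>))"
        by (intro integral_norm_bound_integral integrable_continuous_real continuous_compose2[OF cm]
               continuous_compose2[OF cg] continuous_intros) (auto simp: g_def)
      then show ?thesis by (simp add: Sh_def)
    qed
    \<comment> \<open>After exchanging the integrals, the x-interval is translated by \<theta> \<le>
      y \<le> 1 and so stays inside {x1..x2+1}. This is why the source is measured on an interval
      longer by 1. The integral over \<theta> supplies the factor y.\<close>
    have inner: "integral {x1..x2} (\<lambda>x. \<bar>Sh (m i) t x\<bar>) \<le> y * integral {x1..x2+1} (g t)" for t
    proof -
      have "integral {x1..x2} (\<lambda>x. \<bar>Sh (m i) t x\<bar>) \<le> integral {x1..x2} (\<lambda>x. Sh g t x)"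
        by (intro integral_le integrable_continuous_real continuous_slice[OF cS] continuous_slice[OF cSh[OF cg]] le)
      also have "\<dots> = integral {0..y} (\<lambda>\<theta>. integral {x1..x2} (\<lambda>x. g t (x+\<theta>)))" unfolding Sh_def
        by (intro iterated_integral_swap) (auto simp: split_def intro!: continuous_compose2[OF cg] continuous_intros)
      also have "\<dots> \<le> integral {0..y} (\<lambda>\<theta>. integral {x1..x2+1} (g t))"
      proof (rule integral_le)
        have "continuous_on {0..y} (\<lambda>\<theta>. integral (cbox x1 x2) ((\<lambda>\<theta> x. g t (x+\<theta>)) \<theta>))"
          by (rule integral_continuous_on_param)
            (auto simp: split_def intro!: continuous_intros continuous_compose2[OF cg])
        then show "(\<lambda>\<theta>. integral {x1..x2} (\<lambda>x. g t (x+\<theta>))) integrable_on {0..y}"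
          by (intro integrable_continuous_real) simp
        show "(\<lambda>\<theta>. integral {x1..x2+1} (g t)) integrable_on {0..y}" by (rule integrable_const_ivl)
        fix \<theta> assume \<theta>: "\<theta> \<in> {0..y}"
        have "integral {x1..x2} (\<lambda>x. g t (x+\<theta>)) = integral {x1+\<theta>..x2+\<theta>} (g t)"
          using integral_shift_Icc_real[of x1 x2 "g t" \<theta>] by (simp add: add.commute o_def)
        also have "\<dots> \<le> integral {x1..x2+1} (g t)"
          using \<theta> y by (intro integral_subset_le integrable_continuous_real continuous_slice[OF cg]) (auto simp: g_def)
        finally show "integral {x1..x2} (\<lambda>x. g t (x+\<theta>)) \<le> integral {x1..x2+1} (g t)" .
      qed
      also have "\<dots> = y * integral {x1..x2+1} (g t)" using y by simp
      finally show ?thesis .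
    qed
    have ci: "continuous_on A (\<lambda>t. integral {c..d} (F t))" if "continuous_on UNIV (\<lambda>(t,x). F t x)" for A c d and F :: "real \<Rightarrow> real \<Rightarrow> real"
    proof -
      have "continuous_on A (\<lambda>t. integral (cbox c d) (F t))"
        by (intro integral_continuous_on_param continuous_on_subset[OF that]) auto
      then show ?thesis by simp
    qed
    have "integral {t1..t2} (\<lambda>t. integral {x1..x2} (\<lambda>x. \<bar>Sh (m i) t x\<bar>))
          \<le> integral {t1..t2} (\<lambda>t. y * integral {x1..x2+1} (g t))"
      by (intro integral_le integrable_continuous_real continuous_intros ci cS cg inner)
    also have "\<dots> = y * integral {t1..t2} (\<lambda>t. integral {x1..x2+1} (g t))" by simp
    also have "\<dots> \<le> y * N" using N[of i] y by (intro mult_left_mono) (auto simp: g_def[abs_def] m_def)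
    finally show ?thesis .
  qed
  define w where "w i = Sh (u i)" for i
  define wt where "wt i = Sh (ut i)" for i
  have cw: "continuous_on UNIV (\<lambda>(t,x). w i t x)" and cwt: "continuous_on UNIV (\<lambda>(t,x). wt i t x)"
    and cDu: "continuous_on UNIV (\<lambda>(t,x). D (u i) t x)" and cDb: "continuous_on UNIV (\<lambda>(t,x). D (b i) t x)"
    and cDut: "continuous_on UNIV (\<lambda>(t,x). D (ut i) t x)" and cSm: "continuous_on UNIV (\<lambda>(t,x). Sh (m i) t x)" for i
    unfolding w_def wt_def by (intro cSh cD cu cut cb cm)+
  have cp: "continuous_on A p" and cq: "continuous_on A q" for A using dp dq by (auto intro!: continuous_at_imp_continuous_on DERIV_isCont)
  note cs = continuous_compose2[OF cw] continuous_compose2[OF cwt] continuous_compose2[OF cDu]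
    continuous_compose2[OF cDb] continuous_compose2[OF cDut] continuous_compose2[OF cSm]
    continuous_on_compose2[OF cp[of UNIV] _ subset_UNIV] continuous_on_compose2[OF cq[of UNIV] _ subset_UNIV]
    continuous_on_compose2[OF cp' _ subset_UNIV] continuous_on_compose2[OF cq' _ subset_UNIV]
  \<comment> \<open>\<open>HT\<close> is the t-derivative of p q (w 0) \<partial>x (w 1), and
    \<open>HX\<close> the x-derivative of p q (w 0) \<partial>t (w 1), both expanded by the product
    rule. Each integrates to zero because p and q vanish at the ends, and the mixed second
    derivative of w 1, present in both as \<open>D (ut 1)\<close>, cancels in their
    difference.\<close>
  define HT where "HT t x = p' t * q x * (w 0 t x * D (u 1) t x)
      + p t * q x * (wt 0 t x * D (u 1) t x + w 0 t x * D (ut 1) t x)" for t x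
  define HX where "HX t x = p t * q' x * (w 0 t x * wt 1 t x)
      + p t * q x * (D (u 0) t x * wt 1 t x + w 0 t x * D (ut 1) t x)" for t x
  define Q where "Q t x = p t * q x * (D (u 0) t x * D (b 1) t x - D (u 1) t x * D (b 0) t x)" for t x
  have cHT: "continuous_on UNIV (\<lambda>(t,x). HT t x)" and cHX: "continuous_on UNIV (\<lambda>(t,x). HX t x)"
    and cQ: "continuous_on UNIV (\<lambda>(t,x). Q t x)"
    unfolding HT_def HX_def Q_def split_def by (intro continuous_intros cs)+
  have DDu: "((\<lambda>t. D (u i) t x) has_real_derivative D (ut i) t x) (at t)" for i t x
    unfolding D_def by (auto intro!: derivative_eq_intros dut)
  have Dw: "(w i t has_real_derivative D (u i) t x) (at x)" and Dwt: "(wt i t has_real_derivative D (ut i) t x) (at x)"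
     and Dtw: "((\<lambda>t. w i t x) has_real_derivative wt i t x) (at t)" for i t x
    unfolding w_def wt_def by (intro dSh dSht cu cut dut)+
  have "integral {t1..t2} (\<lambda>t. HT t x) = 0" for x
  proof -
    have "((\<lambda>t. HT t x) has_integral p t2 * q x * (w 0 t2 x * D (u 1) t2 x) - p t1 * q x * (w 0 t1 x * D (u 1) t1 x)) {t1..t2}"
      using t12 by (intro fundamental_theorem_of_calculus)
       (auto simp: HT_def algebra_simps simp flip: has_real_derivative_iff_has_vector_derivative
           intro!: derivative_eq_intros has_field_derivative_at_within[OF dp] has_field_derivative_at_within[OF Dtw] has_field_derivative_at_within[OF DDu])
    then show ?thesis using p0 by (simp add: integral_unique)
  qed
  then have IT: "integral (cbox (t1,x1) (t2,x2)) (\<lambda>(t,x). HT t x) = 0"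
    by (simp flip: iterated_integral_cbox[OF cHT] add: iterated_integral_swap[OF cHT])
  have "integral {x1..x2} (HX t) = 0" for t
  proof -
    have "((HX t) has_integral p t * q x2 * (w 0 t x2 * wt 1 t x2) - p t * q x1 * (w 0 t x1 * wt 1 t x1)) {x1..x2}"
      using x12 by (intro fundamental_theorem_of_calculus)
       (auto simp: HX_def algebra_simps simp flip: has_real_derivative_iff_has_vector_derivative
           intro!: derivative_eq_intros has_field_derivative_at_within[OF dq] has_field_derivative_at_within[OF Dw] has_field_derivative_at_within[OF Dwt])
    then show ?thesis using q0 by (simp add: integral_unique)
  qed
  then have IX: "integral (cbox (t1,x1) (t2,x2)) (\<lambda>(t,x). HX t x) = 0" by (simp flip: iterated_integral_cbox[OF cHX])
  \<comment> \<open>The factor y comes from two sources. Terms with \<open>Sh (m i)\<close> get it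
    after integration, by \<open>L1\<close>; terms in which a derivative falls on p or q get it from
    |w 0| \<le> y U. The 3 is 2 + 1, from the products of \<open>Sh (m 1)\<close> with
    \<open>D (u 0)\<close> and with w 0; the 4 is 2 + 2, from w 0 against \<open>D (u 1)\<close> and
    against \<open>D (b 1)\<close>.\<close>
  define R where "R t x = X * U * (3 * \<bar>Sh (m 1) t x\<bar> + 2 * \<bar>Sh (m 0) t x\<bar>) + 4 * X * U\<^sup>2 * y" for t x
  have U0: "0 \<le> U" using bu[of 0 0 0] by linarith
  have X0: "0 \<le> X" using X[of t1 x1] t12 x12 by (simp add: p0)
  have cabs: "continuous_on UNIV (\<lambda>(t,x). \<bar>Sh (m i) t x\<bar>)" for i
    using continuous_on_rabs[OF cSm[of i]] by (simp add: split_def)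
  have cR: "continuous_on UNIV (\<lambda>(t,x). R t x)" unfolding R_def split_def by (intro continuous_intros cs)+
  have pw: "\<bar>Q t x - HT t x + HX t x\<bar> \<le> R t x" if tx: "t \<in> {t1..t2}" "x \<in> {x1..x2}" for t x
  proof -
    define M0 where "M0 = Sh (m 0) t x"
    define M1 where "M1 = Sh (m 1) t x"
    have w1: "wt 1 t x = M1 - D (b 1) t x" "wt 0 t x = M0 - D (b 0) t x" by (simp_all add: M0_def M1_def Shm wt_def)
    have eq: "Q t x - HT t x + HX t x = p t * q x * (D (u 0) t x * M1 - D (u 1) t x * M0)
        - p' t * q x * (w 0 t x * D (u 1) t x) + p t * q' x * (w 0 t x * (M1 - D (b 1) t x))"
      unfolding Q_def HT_def HX_def w1 by (simp add: algebra_simps)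
    have d: "\<bar>D (u i) t x\<bar> \<le> 2 * U" "\<bar>D (b i) t x\<bar> \<le> 2 * U" for i
      using bu[of i t x] bu[of i t "x+y"] bb[of i t x] bb[of i t "x+y"] unfolding D_def by linarith+
    have w0: "\<bar>w 0 t x\<bar> \<le> y * U" unfolding w_def by (intro Shb cu bu)
    have w0': "y * U \<le> U" using y U0 by (simp add: mult_left_le_one_le)
    have a1: "\<bar>p t * q x * (D (u 0) t x * M1 - D (u 1) t x * M0)\<bar> \<le> X * (2 * U * \<bar>M1\<bar> + 2 * U * \<bar>M0\<bar>)"
    proof -
      have "\<bar>D (u 0) t x * M1 - D (u 1) t x * M0\<bar> \<le> \<bar>D (u 0) t x\<bar> * \<bar>M1\<bar> + \<bar>D (u 1) t x\<bar> * \<bar>M0\<bar>"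
        by (metis abs_triangle_ineq4 abs_mult)
      also have "\<dots> \<le> 2 * U * \<bar>M1\<bar> + 2 * U * \<bar>M0\<bar>" by (intro add_mono mult_right_mono d) auto
      finally show ?thesis unfolding abs_mult[of "p t * q x"] using X[OF tx] X0 by (intro mult_mono) auto
    qed
    have a2: "\<bar>p' t * q x * (w 0 t x * D (u 1) t x)\<bar> \<le> X * (y * U * (2 * U))"
      unfolding abs_mult[of "p' t * q x"] abs_mult[of "w 0 t x"] using X[OF tx] X0 U0 y by (intro mult_mono w0 d) auto
    have a3: "\<bar>p t * q' x * (w 0 t x * (M1 - D (b 1) t x))\<bar> \<le> X * (U * \<bar>M1\<bar> + y * U * (2 * U))"
    proof -
      have "\<bar>w 0 t x * (M1 - D (b 1) t x)\<bar> \<le> \<bar>w 0 t x\<bar> * \<bar>M1\<bar> + \<bar>w 0 t x\<bar> * \<bar>D (b 1) t x\<bar>"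
        by (metis abs_triangle_ineq4 abs_mult right_diff_distrib)
      also have "\<dots> \<le> U * \<bar>M1\<bar> + y * U * (2 * U)" using w0 w0' U0 y by (intro add_mono mult_mono d) auto
      finally show ?thesis unfolding abs_mult[of "p t * q' x"] using X[OF tx] X0 by (intro mult_mono) auto
    qed
    have "\<bar>Q t x - HT t x + HX t x\<bar> \<le> X * (2 * U * \<bar>M1\<bar> + 2 * U * \<bar>M0\<bar>) + X * (y * U * (2 * U)) + X * (U * \<bar>M1\<bar> + y * U * (2 * U))"
      unfolding eq using a1 a2 a3 by linarith
    also have "\<dots> = R t x" by (simp add: R_def M0_def M1_def algebra_simps power2_eq_square)
    finally show ?thesis .
  qed
  have ic: "(\<lambda>(t,x). F t x) integrable_on cbox (t1,x1) (t2,x2)" if "continuous_on UNIV (\<lambda>(t,x). F t x)" for F :: "real \<Rightarrow> real \<Rightarrow> real"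
    by (intro integrable_continuous continuous_on_subset[OF that]) auto
  let ?B = "cbox (t1,x1) (t2,x2)"
  have "integral ?B (\<lambda>(t,x). Q t x) = integral ?B (\<lambda>z. (\<lambda>(t,x). Q t x) z - (\<lambda>(t,x). HT t x) z + (\<lambda>(t,x). HX t x) z)"
    using has_integral_add[OF has_integral_diff[OF integrable_integral[OF ic[OF cQ]] integrable_integral[OF ic[OF cHT]]]
        integrable_integral[OF ic[OF cHX]]]
    unfolding IT IX by (auto dest!: integral_unique)
  also have "norm \<dots> \<le> integral ?B (\<lambda>(t,x). R t x)"
    using pw by (intro integral_norm_bound_integral integrable_add integrable_diff ic cHT cHX cQ cR) (auto simp: cbox_Pair_eq)
  finally have "\<bar>integral ?B (\<lambda>(t,x). Q t x)\<bar> \<le> integral ?B (\<lambda>(t,x). R t x)" by simp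
  also have "integral ?B (\<lambda>(t,x). R t x) = X * U * (3 * integral ?B (\<lambda>(t,x). \<bar>Sh (m 1) t x\<bar>) + 2 * integral ?B (\<lambda>(t,x). \<bar>Sh (m 0) t x\<bar>))
       + 4 * X * U\<^sup>2 * y * ((t2-t1)*(x2-x1))"
  proof -
    have i: "((\<lambda>(t,x). \<bar>Sh (m i) t x\<bar>) has_integral integral ?B (\<lambda>(t,x). \<bar>Sh (m i) t x\<bar>)) ?B" for i
      by (intro integrable_integral ic cabs)
    have c: "((\<lambda>z. 4 * X * U\<^sup>2 * y) has_integral ((t2-t1)*(x2-x1)) *\<^sub>R (4 * X * U\<^sup>2 * y)) ?B"
      using has_integral_const[of "4 * X * U\<^sup>2 * y" "(t1,x1)" "(t2,x2)"] t12 x12 by (simp add: content_Pair)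
    have "((\<lambda>z. X * U * (3 * (\<lambda>(t,x). \<bar>Sh (m 1) t x\<bar>) z + 2 * (\<lambda>(t,x). \<bar>Sh (m 0) t x\<bar>) z) + 4 * X * U\<^sup>2 * y) has_integral
        X * U * (3 * integral ?B (\<lambda>(t,x). \<bar>Sh (m 1) t x\<bar>) + 2 * integral ?B (\<lambda>(t,x). \<bar>Sh (m 0) t x\<bar>))
       + ((t2-t1)*(x2-x1)) *\<^sub>R (4 * X * U\<^sup>2 * y)) ?B"
      by (intro has_integral_add has_integral_mult_right i c)
    then show ?thesis by (intro integral_unique) (simp add: R_def split_def mult_ac)
  qed
  also have "\<dots> \<le> X * U * (3 * (y * N) + 2 * (y * N)) + 4 * X * U\<^sup>2 * y * ((t2-t1)*(x2-x1))"
    using L1[of 0] L1[of 1] X0 U0 iterated_integral_cbox[OF cabs] by (intro add_right_mono mult_left_mono add_mono) auto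
  also have "\<dots> = y * (5 * X * U * N + 4 * X * U\<^sup>2 * ((t2-t1)*(x2-x1)))" by (simp add: algebra_simps)
  finally show ?thesis using iterated_integral_cbox[OF cQ] by (simp add: Q_def D_def)
qed

section \<open>Mollification\<close>

lemma borel_measurable_fst_snd [measurable]:
  "fst \<in> borel_measurable (borel :: ('a::euclidean_space \<times> 'b::euclidean_space) measure)"
  "snd \<in> borel_measurable (borel :: ('a::euclidean_space \<times> 'b::euclidean_space) measure)"
  by (intro borel_measurable_continuous_onI continuous_intros)+

lemma integrable_indicator_cbox: "integrable lborel (indicator (cbox a b) :: 'a::euclidean_space \<Rightarrow> real)"
  using emeasure_lborel_cbox_finite[of a b] by (simp add: integrable_indicator_iff)

text \<open>Measurability in the sense of \<open>measurable_on\<close> supplies continuous functions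
  that converge almost everywhere. Clamping them to [-U, U] keeps the limit, as |u| \<le> U, and
  makes dominated convergence available on a box.\<close>

lemma L1_continuous_approx:
  fixes u :: "'a::euclidean_space \<Rightarrow> real"
  assumes [measurable]: "u \<in> borel_measurable borel" and U: "\<And>x. \<bar>u x\<bar> \<le> U" and e: "0 < e"
  obtains g where "continuous_on UNIV g" "\<And>x. \<bar>g x\<bar> \<le> U"
    "(\<integral>\<^sup>+x. ennreal \<bar>u x - g x\<bar> * indicator (cbox a b) x \<partial>lborel) < ennreal e"
proof -
  have "u measurable_on UNIV" by (intro lebesgue_measurable_imp_measurable_on measurable_completion) simp_all
  then obtain N g where N: "negligible N" and g: "\<And>n. continuous_on UNIV (g n)"
    and lim: "\<And>x. x \<notin> N \<Longrightarrow> (\<lambda>n. g n x) \<longlonglongrightarrow> u x"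
    by (auto simp: measurable_on_def)
  define h where "h n x = max (-U) (min U (g n x))" for n :: nat and x
  have h: "continuous_on UNIV (h n)" for n unfolding h_def by (intro continuous_intros g)
  then have [measurable]: "h n \<in> borel_measurable borel" for n by (rule borel_measurable_continuous_onI)
  have U0: "0 \<le> U" using U[of undefined] by linarith
  then have hb: "\<bar>h n x\<bar> \<le> U" for n x by (auto simp: h_def)
  have limh: "(\<lambda>n. h n x) \<longlonglongrightarrow> u x" if "x \<notin> N" for x
  proof -
    have "(\<lambda>n. h n x) \<longlonglongrightarrow> max (-U) (min U (u x))" unfolding h_def by (intro tendsto_intros lim that)
    moreover have "max (-U) (min U (u x)) = u x" using U[of x] by (auto simp: abs_le_iff)
    ultimately show ?thesis by simp
  qed
  have "AE x in lebesgue. x \<notin> N" using N by (simp add: negligible_iff_null_sets AE_not_in)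
  then have ae: "AE x in lborel. x \<notin> N" by (simp add: AE_completion_iff)
  have "(\<lambda>n. \<integral>\<^sup>+x. ennreal \<bar>u x - h n x\<bar> * indicator (cbox a b) x \<partial>lborel)
          \<longlonglongrightarrow> (\<integral>\<^sup>+x. 0 \<partial>(lborel :: 'a measure))"
  proof (rule nn_integral_dominated_convergence[where w="\<lambda>x. ennreal (2 * U) * indicator (cbox a b) x"])
    have "(\<integral>\<^sup>+x. ennreal (2 * U) * indicator (cbox a b) x \<partial>lborel) = ennreal (2*U) * emeasure lborel (cbox a b)"
      by (intro nn_integral_cmult_indicator) simp
    also have "\<dots> < \<infinity>" using emeasure_lborel_cbox_finite[of a b] by (simp add: ennreal_mult_less_top)
    finally show "(\<integral>\<^sup>+x. ennreal (2 * U) * indicator (cbox a b) x \<partial>lborel) < \<infinity>" .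
    show "AE x in lborel. ennreal \<bar>u x - h n x\<bar> * indicator (cbox a b) x \<le> ennreal (2 * U) * indicator (cbox a b) x" for n
    proof (intro AE_I2 mult_right_mono ennreal_leI)
      show "\<bar>u x - h n x\<bar> \<le> 2 * U" for x using U[of x] hb[of n x] by linarith
    qed simp
    show "AE x in lborel. (\<lambda>n. ennreal \<bar>u x - h n x\<bar> * indicator (cbox a b) x) \<longlonglongrightarrow> 0" using ae
    proof eventually_elim
      case (elim x)
      have "(\<lambda>n. ennreal \<bar>u x - h n x\<bar>) \<longlonglongrightarrow> ennreal \<bar>u x - u x\<bar>"
        by (intro tendsto_intros limh elim)
      then show ?case by (auto simp: indicator_def)
    qed
  qed auto
  then have "\<forall>\<^sub>F n in sequentially. (\<integral>\<^sup>+x. ennreal \<bar>u x - h n x\<bar> * indicator (cbox a b) x \<partial>lborel) < ennreal e"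
    using e by (intro order_tendstoD(2)) auto
  then obtain n where "(\<integral>\<^sup>+x. ennreal \<bar>u x - h n x\<bar> * indicator (cbox a b) x \<partial>lborel) < ennreal e"
    by (auto simp: eventually_sequentially)
  with that h hb show ?thesis by blast
qed

text \<open>Only continuity is demanded, which is enough for convergence in L^1; smoothness is added
  where a derivative falls on the kernel. Unit mass forces the radius r to be positive.\<close>

definition mollifier :: "real \<Rightarrow> (real \<Rightarrow> real) \<Rightarrow> bool" where
  "mollifier r k \<longleftrightarrow> continuous_on UNIV k \<and> (\<forall>s. 0 \<le> k s) \<and> (\<forall>s. r < \<bar>s\<bar> \<longrightarrow> k s = 0) \<and>
     (\<integral>\<^sup>+s. ennreal (k s) \<partial>lborel) = 1"

lemma mollifierD:
  assumes "mollifier r k"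
  shows "continuous_on UNIV k" "0 \<le> k s" "r < \<bar>s\<bar> \<Longrightarrow> k s = 0" "k \<in> borel_measurable borel"
    "(\<integral>\<^sup>+s. ennreal (k (t - s)) \<partial>lborel) = 1" "(\<integral>\<^sup>+s. ennreal (k (s - t)) \<partial>lborel) = 1"
proof -
  show c: "continuous_on UNIV k" and "0 \<le> k s" "r < \<bar>s\<bar> \<Longrightarrow> k s = 0" using assms by (auto simp: mollifier_def)
  show m[measurable]: "k \<in> borel_measurable borel" using c by (rule borel_measurable_continuous_onI)
  show "(\<integral>\<^sup>+s. ennreal (k (t - s)) \<partial>lborel) = 1" "(\<integral>\<^sup>+s. ennreal (k (s - t)) \<partial>lborel) = 1"
    using nn_integral_real_affine[of "\<lambda>s. ennreal (k s)" "-1" t] nn_integral_real_affine[of "\<lambda>s. ennreal (k s)" 1 "-t"] assms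
    by (auto simp: mollifier_def)
qed

lemma nn_integral_pair_mult:
  assumes [measurable]: "p \<in> borel_measurable borel" "q \<in> borel_measurable borel"
  shows "(\<integral>\<^sup>+z. p (fst z) * q (snd z) \<partial>lborel)
      = (\<integral>\<^sup>+s. p s \<partial>(lborel :: 'a::euclidean_space measure)) * (\<integral>\<^sup>+s. q s \<partial>(lborel :: 'b::euclidean_space measure))"
proof -
  have "(\<integral>\<^sup>+z. p (fst z) * q (snd z) \<partial>lborel) = (\<integral>\<^sup>+s. \<integral>\<^sup>+r. p (fst (s,r)) * q (snd (s,r)) \<partial>lborel \<partial>lborel)"
    by (subst lborel.nn_integral_fst) (auto simp: lborel_prod)
  also have "\<dots> = (\<integral>\<^sup>+s. p s * (\<integral>\<^sup>+r. q r \<partial>lborel) \<partial>lborel)"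
    by (simp add: nn_integral_cmult)
  finally show ?thesis by (simp add: nn_integral_multc)
qed

text \<open>By Tonelli the kernel is integrated over z first. It has unit mass, and it vanishes on
  the box unless (\<tau> p, \<xi> p) lies within r of the box in both coordinates. The measure and
  the maps \<tau>, \<xi> are left general to cover both Lebesgue measure on the plane and Radon
  measures in (t, x, v).\<close>

lemma nn_integral_mollified_le:
  fixes \<tau> \<xi> :: "'a \<Rightarrow> real" and h :: "'a \<Rightarrow> ennreal"
  assumes "sigma_finite_measure M" and k: "mollifier r k"
    and [measurable]: "\<tau> \<in> borel_measurable M" "\<xi> \<in> borel_measurable M" "h \<in> borel_measurable M"
  shows "(\<integral>\<^sup>+z. (\<integral>\<^sup>+p. h p * ennreal (k (fst z - \<tau> p) * k (snd z - \<xi> p)) \<partial>M) * indicator (cbox (t1,x1) (t2,x2)) z \<partial>lborel)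
      \<le> (\<integral>\<^sup>+p. h p * indicator {p. t1 - r \<le> \<tau> p \<and> \<tau> p \<le> t2 + r \<and> x1 - r \<le> \<xi> p \<and> \<xi> p \<le> x2 + r} p \<partial>M)"
proof -
  interpret M: sigma_finite_measure M by fact
  interpret P: pair_sigma_finite lborel M ..
  note [measurable] = mollifierD(4)[OF k]
  define J where "J = {p. t1 - r \<le> \<tau> p \<and> \<tau> p \<le> t2 + r \<and> x1 - r \<le> \<xi> p \<and> \<xi> p \<le> x2 + r}"
  let ?F = "\<lambda>z p. h p * ennreal (k (fst z - \<tau> p) * k (snd z - \<xi> p)) * indicator (cbox (t1,x1) (t2,x2)) z"
  have [measurable]: "(\<lambda>x. fst (fst x)) \<in> borel_measurable (lborel \<Otimes>\<^sub>M M)" "(\<lambda>x. snd (fst x)) \<in> borel_measurable (lborel \<Otimes>\<^sub>M M)"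
     "(\<lambda>x. indicator (cbox (t1,x1) (t2,x2)) (fst x) :: ennreal) \<in> borel_measurable (lborel \<Otimes>\<^sub>M M)"
     "(\<lambda>x. \<tau> (snd x)) \<in> borel_measurable (lborel \<Otimes>\<^sub>M M)" "(\<lambda>x. \<xi> (snd x)) \<in> borel_measurable (lborel \<Otimes>\<^sub>M M)"
     "(\<lambda>x. h (snd x)) \<in> borel_measurable (lborel \<Otimes>\<^sub>M M)"
    by (rule measurable_compose[OF measurable_fst] measurable_compose[OF measurable_snd]; simp)+
  have [measurable]: "(\<lambda>(z, p). ?F z p) \<in> borel_measurable (lborel \<Otimes>\<^sub>M M)" by measurable
  have "(\<integral>\<^sup>+z. (\<integral>\<^sup>+p. h p * ennreal (k (fst z - \<tau> p) * k (snd z - \<xi> p)) \<partial>M) * indicator (cbox (t1,x1) (t2,x2)) z \<partial>lborel)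
     = (\<integral>\<^sup>+z. \<integral>\<^sup>+p. ?F z p \<partial>M \<partial>lborel)"
    by (simp add: nn_integral_multc)
  also have "\<dots> = (\<integral>\<^sup>+p. \<integral>\<^sup>+z. ?F z p \<partial>lborel \<partial>M)"
    using P.Fubini[of "\<lambda>(z, p). ?F z p"] by simp
  also have "\<dots> \<le> (\<integral>\<^sup>+p. h p * indicator J p \<partial>M)"
  proof (intro nn_integral_mono)
    fix p
    have "?F z p \<le> h p * indicator J p * (ennreal (k (fst z - \<tau> p)) * ennreal (k (snd z - \<xi> p)))" for z
    proof (cases "z \<in> cbox (t1,x1) (t2,x2) \<and> p \<notin> J")
      case True
      then have "r < \<bar>fst z - \<tau> p\<bar> \<or> r < \<bar>snd z - \<xi> p\<bar>" by (cases z) (auto simp: J_def cbox_Pair_eq)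
      then have "k (fst z - \<tau> p) * k (snd z - \<xi> p) = 0" using mollifierD(3)[OF k] by auto
      then show ?thesis by (metis ennreal_0 mult_zero_left mult_zero_right zero_le)
    next
      case False
      then show ?thesis using mollifierD(2)[OF k] by (auto simp: indicator_def ennreal_mult' mult.assoc)
    qed
    then have "(\<integral>\<^sup>+z. ?F z p \<partial>lborel) \<le> (\<integral>\<^sup>+z. h p * indicator J p * (ennreal (k (fst z - \<tau> p)) * ennreal (k (snd z - \<xi> p))) \<partial>lborel)"
      by (intro nn_integral_mono)
    also have "\<dots> = h p * indicator J p"
      using nn_integral_pair_mult[of "\<lambda>s. ennreal (k (s - \<tau> p))" "\<lambda>s. ennreal (k (s - \<xi> p))"]
      by (simp add: nn_integral_cmult mollifierD(6)[OF k])
    finally show "(\<integral>\<^sup>+z. ?F z p \<partial>lborel) \<le> h p * indicator J p" .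
  qed
  finally show ?thesis by (simp add: J_def)
qed

section \<open>Convolution with products of one-variable kernels\<close>

definition kernel :: "real \<Rightarrow> real \<Rightarrow> (real \<Rightarrow> real) \<Rightarrow> bool" where
  "kernel S B p \<longleftrightarrow> continuous_on UNIV p \<and> (\<forall>s. \<bar>p s\<bar> \<le> B) \<and> (\<forall>s. S < \<bar>s\<bar> \<longrightarrow> p s = 0)"

text \<open>Convolution with the tensor product of \<open>p\<close> and \<open>q\<close>. With the
  factors kept apart, a t-derivative falls on \<open>p\<close> and an x-derivative on
  \<open>q\<close>, so that derivatives of a \<open>cv\<close> are again of this form.\<close>

definition cv :: "(real \<times> real \<Rightarrow> real) \<Rightarrow> (real \<Rightarrow> real) \<Rightarrow> (real \<Rightarrow> real) \<Rightarrow> real \<Rightarrow> real \<Rightarrow> real" where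
  "cv u p q t x = (\<integral>z. u z * (p (t - fst z) * q (x - snd z)) \<partial>lborel)"

lemma kernel_measurable: "kernel S B p \<Longrightarrow> p \<in> borel_measurable borel"
  by (auto simp: kernel_def intro: borel_measurable_continuous_onI)

lemma kernel_dominated:
  fixes u :: "'a::euclidean_space \<Rightarrow> real"
  assumes [measurable]: "u \<in> borel_measurable borel" "\<And>n. \<Phi> n \<in> borel_measurable borel" "\<Psi> \<in> borel_measurable borel"
    and U: "\<And>z. \<bar>u z\<bar> \<le> U" and B: "\<And>n z. \<bar>\<Phi> n z\<bar> \<le> B * indicator (cbox a b) z"
    and lim: "\<And>z. (\<lambda>n. \<Phi> n z) \<longlonglongrightarrow> \<Psi> z"
  shows "(\<lambda>n. \<integral>z. u z * \<Phi> n z \<partial>lborel) \<longlonglongrightarrow> (\<integral>z. u z * \<Psi> z \<partial>lborel)"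
proof (rule integral_dominated_convergence[where w="\<lambda>z. U * (B * indicator (cbox a b) z)"])
  show "integrable lborel (\<lambda>z. U * (B * indicator (cbox a b) z))" by (intro integrable_mult_right integrable_indicator_cbox)
  show "AE x in lborel. norm (u x * \<Phi> n x) \<le> U * (B * indicator (cbox a b) x)" for n
  proof (intro AE_I2)
    fix x have "0 \<le> U" using U[of x] by linarith
    then show "norm (u x * \<Phi> n x) \<le> U * (B * indicator (cbox a b) x)" using U B by (simp add: abs_mult mult_mono)
  qed
  show "AE x in lborel. (\<lambda>n. u x * \<Phi> n x) \<longlonglongrightarrow> u x * \<Psi> x" by (intro AE_I2 tendsto_intros lim)
qed auto

lemma cbox_memI:
  fixes s r t x S S' T T' :: real
  assumes "\<bar>t - s\<bar> \<le> S \<and> \<bar>x - r\<bar> \<le> S'" "\<bar>t\<bar> \<le> T" "\<bar>x\<bar> \<le> T'"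
  shows "(s, r) \<in> cbox (-(T+S), -(T'+S')) (T+S, T'+S')" using assms by (auto simp: cbox_Pair_eq)

lemma kernel_zero: "kernel S B p \<Longrightarrow> p s \<noteq> 0 \<Longrightarrow> \<bar>s\<bar> \<le> S"
  by (auto simp: kernel_def simp flip: not_less)

lemma kernel_le: "kernel S B p \<Longrightarrow> \<bar>p s\<bar> \<le> B"
  by (simp add: kernel_def)

text \<open>Stated for numbers \<open>p'\<close>, \<open>q'\<close> instead of functions, so that it
  dominates difference quotients of kernels as well as kernel values.\<close>

lemma kernel_product_bound:
  fixes p' q' s r t x S S' T T' B B' :: real
  assumes p: "\<bar>p'\<bar> \<le> B" "p' \<noteq> 0 \<Longrightarrow> \<bar>t - s\<bar> \<le> S" and q: "\<bar>q'\<bar> \<le> B'" "q' \<noteq> 0 \<Longrightarrow> \<bar>x - r\<bar> \<le> S'"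
    and "\<bar>t\<bar> \<le> T" "\<bar>x\<bar> \<le> T'"
  shows "\<bar>p' * q'\<bar> \<le> B * B' * indicator (cbox (-(T+S), -(T'+S')) (T+S, T'+S')) (s, r)"
proof (cases "p' = 0 \<or> q' = 0")
  case True
  have "0 \<le> B" "0 \<le> B'" using p(1) q(1) by linarith+
  then have "0 \<le> B * B'" by simp
  with True show ?thesis by auto
next
  case False
  then have "(s, r) \<in> cbox (-(T+S), -(T'+S')) (T+S, T'+S')" using assms by (intro cbox_memI) auto
  then show ?thesis using p(1) q(1) by (simp add: abs_mult mult_mono')
qed

lemma cv_integrable:
  assumes [measurable]: "u \<in> borel_measurable borel" and U: "\<And>z. \<bar>u z\<bar> \<le> U"
    and p: "kernel S B p" and q: "kernel S' B' q"
  shows "integrable lborel (\<lambda>z. u z * (p (t - fst z) * q (x - snd z)))"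
proof (rule Bochner_Integration.integrable_bound)
  note [measurable] = kernel_measurable[OF p] kernel_measurable[OF q]
  let ?w = "\<lambda>z. U * (B * B' * indicator (cbox (-(\<bar>t\<bar>+S), -(\<bar>x\<bar>+S')) (\<bar>t\<bar>+S, \<bar>x\<bar>+S')) z)"
  show "integrable lborel ?w" by (intro integrable_mult_right integrable_indicator_cbox)
  show "AE z in lborel. norm (u z * (p (t - fst z) * q (x - snd z))) \<le> norm (?w z)"
  proof (intro AE_I2)
    fix z have "\<bar>p (t - fst z) * q (x - snd z)\<bar> \<le> B * B' * indicator (cbox (-(\<bar>t\<bar>+S), -(\<bar>x\<bar>+S')) (\<bar>t\<bar>+S, \<bar>x\<bar>+S')) (fst z, snd z)"
      by (intro kernel_product_bound kernel_le[OF p] kernel_le[OF q] kernel_zero[OF p] kernel_zero[OF q]) auto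
    moreover have "0 \<le> U" using U[of z] by linarith
    ultimately have "\<bar>u z\<bar> * \<bar>p (t - fst z) * q (x - snd z)\<bar> \<le> ?w z" using U[of z] by (intro mult_mono) auto
    then show "norm (u z * (p (t - fst z) * q (x - snd z))) \<le> norm (?w z)"
      using abs_ge_self[of "?w z"] unfolding real_norm_def abs_mult[of "u z"] by linarith
  qed
qed (use kernel_measurable[OF p] kernel_measurable[OF q] in measurable)

lemma cv_continuous:
  assumes [measurable]: "u \<in> borel_measurable borel" and U: "\<And>z. \<bar>u z\<bar> \<le> U"
    and p: "kernel S B p" and q: "kernel S' B' q"
  shows "continuous_on UNIV (\<lambda>(t,x). cv u p q t x)" unfolding continuous_on_sequentially
proof (intro allI ballI impI, elim conjE)
  note [measurable] = kernel_measurable[OF p] kernel_measurable[OF q]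
  fix X :: "nat \<Rightarrow> real \<times> real" and a assume X: "X \<longlonglongrightarrow> a"
  obtain T where T: "\<And>n. norm (X n) \<le> T"
    using convergent_imp_bounded[OF X] by (auto simp: bounded_iff)
  have T': "\<bar>fst (X n)\<bar> \<le> T" "\<bar>snd (X n)\<bar> \<le> T" for n
    using T[of n] norm_fst_le[of "fst (X n)" "snd (X n)"] norm_snd_le[of "snd (X n)" "fst (X n)"] by (auto intro: order_trans)
  have "(\<lambda>n. \<integral>z. u z * (p (fst (X n) - fst z) * q (snd (X n) - snd z)) \<partial>lborel)
     \<longlonglongrightarrow> (\<integral>z. u z * (p (fst a - fst z) * q (snd a - snd z)) \<partial>lborel)"
  proof (rule kernel_dominated[OF _ _ _ U])
    fix n z
    show "\<bar>p (fst (X n) - fst z) * q (snd (X n) - snd z)\<bar> \<le> B * B' * indicator (cbox (-(T+S), -(T+S')) (T+S, T+S')) z"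
      using kernel_product_bound[of "p (fst (X n) - fst z)" B "fst (X n)" "fst z" S "q (snd (X n) - snd z)" B' "snd (X n)" "snd z" S' T T]
         kernel_zero[OF p] kernel_zero[OF q] T'[of n] by (auto simp: kernel_le[OF p] kernel_le[OF q])
    have "isCont p s" "isCont q s" for s using p q by (auto simp: kernel_def continuous_on_eq_continuous_at)
    then show "(\<lambda>n. p (fst (X n) - fst z) * q (snd (X n) - snd z)) \<longlonglongrightarrow> p (fst a - fst z) * q (snd a - snd z)"
      by (intro tendsto_intros isCont_tendsto_compose[of _ p] isCont_tendsto_compose[of _ q] X)
  qed measurable
  then show "((\<lambda>(t,x). cv u p q t x) \<circ> X) \<longlonglongrightarrow> (case a of (t,x) \<Rightarrow> cv u p q t x)"
    by (simp add: o_def split_def cv_def)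
qed

text \<open>The mean value theorem bounds the quotient. Two centres a and b occur, both within T of
  the origin, so the support is measured from 0; \<open>0 - s\<close> is the shape that
  \<open>kernel_product_bound\<close> expects for that centre.\<close>

lemma kernel_quotient:
  assumes p: "kernel S B p" and p': "\<And>s. (p has_real_derivative p' s) (at s)" "\<And>s. \<bar>p' s\<bar> \<le> B1"
    and "a \<noteq> b" "\<bar>a\<bar> \<le> T" "\<bar>b\<bar> \<le> T"
  shows "\<bar>(p (a - s) - p (b - s)) / (a - b)\<bar> \<le> B1"
    "(p (a - s) - p (b - s)) / (a - b) \<noteq> 0 \<Longrightarrow> \<bar>0 - s\<bar> \<le> T + S"
proof -
  have "norm (p (a - s) - p (b - s)) \<le> B1 * norm ((a - s) - (b - s))"
    by (rule field_differentiable_bound[where S=UNIV and f'=p']) (auto intro: has_field_derivative_at_within p')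
  then show "\<bar>(p (a - s) - p (b - s)) / (a - b)\<bar> \<le> B1"
    using \<open>a \<noteq> b\<close> by (simp add: abs_divide divide_le_eq)
  assume "(p (a - s) - p (b - s)) / (a - b) \<noteq> 0"
  then have "p (a - s) \<noteq> 0 \<or> p (b - s) \<noteq> 0" by auto
  then have "\<bar>a - s\<bar> \<le> S \<or> \<bar>b - s\<bar> \<le> S" using kernel_zero[OF p] by blast
  then show "\<bar>0 - s\<bar> \<le> T + S" using assms by linarith
qed

lemma cv_diff:
  assumes [measurable]: "u \<in> borel_measurable borel" and U: "\<And>z. \<bar>u z\<bar> \<le> U"
    and p: "kernel S B p" and q: "kernel S' B' q"
  shows "cv u p q t' x' - cv u p q t x
     = (\<integral>z. u z * (p (t' - fst z) * q (x' - snd z) - p (t - fst z) * q (x - snd z)) \<partial>lborel)"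
  unfolding cv_def by (subst Bochner_Integration.integral_diff[symmetric]) (auto intro!: cv_integrable[OF _ U p q] simp: algebra_simps)

lemma difference_quotient_tendsto:
  assumes "(p has_real_derivative D) (at (t - c))" and X: "X \<longlonglongrightarrow> t" and "\<And>n. X n \<noteq> t"
  shows "(\<lambda>n. (p (X n - c) - p (t - c)) / (X n - t)) \<longlonglongrightarrow> D"
proof -
  have "((\<lambda>s. p (s - c)) has_real_derivative D) (at t)" using assms(1) DERIV_shift[of p D t "-c"] by simp
  then have "((\<lambda>s. (p (s - c) - p (t - c)) / (s - t)) \<longlongrightarrow> D) (at t)" by (simp add: has_field_derivative_iff)
  then show ?thesis using X assms(3) by (auto simp: tendsto_at_iff_sequentially o_def)
qed

lemma cv_derivative_fst:
  assumes [measurable]: "u \<in> borel_measurable borel" and U: "\<And>z. \<bar>u z\<bar> \<le> U"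
    and p: "kernel S B p" and q: "kernel S' B' q"
    and p': "kernel S1 B1 p'" "\<And>s. (p has_real_derivative p' s) (at s)"
  shows "((\<lambda>t. cv u p q t x) has_real_derivative cv u p' q t x) (at t)"
  unfolding has_field_derivative_iff tendsto_at_iff_sequentially
proof (intro allI impI)
  note [measurable] = kernel_measurable[OF p] kernel_measurable[OF q] kernel_measurable[OF p'(1)]
  fix X assume X': "\<forall>i. X i \<in> UNIV - {t}" and X: "X \<longlonglongrightarrow> t"
  obtain T where T: "\<And>n. \<bar>X n\<bar> \<le> T"
    using convergent_imp_bounded[OF X] by (auto simp: bounded_iff)
  define T' where "T' = max T \<bar>t\<bar>"
  have T': "\<bar>X n\<bar> \<le> T'" "\<bar>t\<bar> \<le> T'" for n using T[of n] by (auto simp: T'_def)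
  have b1: "\<bar>p' s\<bar> \<le> B1" for s using p' by (auto simp: kernel_def)
  have "(\<lambda>n. \<integral>z. u z * ((p (X n - fst z) - p (t - fst z)) / (X n - t) * q (x - snd z)) \<partial>lborel)
     \<longlonglongrightarrow> (\<integral>z. u z * (p' (t - fst z) * q (x - snd z)) \<partial>lborel)"
  proof (rule kernel_dominated[OF _ _ _ U])
    fix n z
    show "\<bar>(p (X n - fst z) - p (t - fst z)) / (X n - t) * q (x - snd z)\<bar>
        \<le> B1 * B' * indicator (cbox (-(0+(T'+S)), -(\<bar>x\<bar>+S')) (0+(T'+S), \<bar>x\<bar>+S')) z"
      using kernel_product_bound[of "(p (X n - fst z) - p (t - fst z)) / (X n - t)" B1 0 "fst z" "T'+S" "q (x - snd z)" B' x "snd z" S' 0 "\<bar>x\<bar>"]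
       kernel_quotient[OF p p'(2) b1, where a="X n" and b=t and T=T' and s="fst z"] T'(1)[of n] T'(2) X' kernel_zero[OF q]
      by (auto simp: kernel_le[OF q])
    show "(\<lambda>n. (p (X n - fst z) - p (t - fst z)) / (X n - t) * q (x - snd z)) \<longlonglongrightarrow> p' (t - fst z) * q (x - snd z)"
      using X' by (intro tendsto_intros difference_quotient_tendsto p' X) auto
  qed measurable
  moreover have "(cv u p q (X n) x - cv u p q t x) / (X n - t)
      = (\<integral>z. u z * ((p (X n - fst z) - p (t - fst z)) / (X n - t) * q (x - snd z)) \<partial>lborel)" for n
    unfolding cv_diff[OF assms(1) U p q]
    by (subst Bochner_Integration.integral_divide_zero[symmetric], intro Bochner_Integration.integral_cong)
       (auto simp: algebra_simps diff_divide_distrib)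
  ultimately show "((\<lambda>y. (cv u p q y x - cv u p q t x) / (y - t)) \<circ> X) \<longlonglongrightarrow> cv u p' q t x"
    by (simp only: o_def cv_def[of u p'])
qed

text \<open>Exchanging the coordinates turns an x-derivative into a t-derivative, so differentiation
  under the integral is carried out only once.\<close>

lemma cv_swap:
  assumes [measurable]: "u \<in> borel_measurable borel" "p \<in> borel_measurable borel" "q \<in> borel_measurable borel"
  shows "cv u p q t x = cv (\<lambda>z. u (snd z, fst z)) q p x t"
proof -
  let ?f = "\<lambda>z. u z * (p (t - fst z) * q (x - snd z))"
  have "?f \<in> borel_measurable (lborel \<Otimes>\<^sub>M lborel)" unfolding lborel_prod by simp
  from lborel_pair.integral_product_swap[OF this] show ?thesis by (simp add: lborel_prod cv_def split_def mult.commute)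
qed

lemma cv_derivative_snd:
  assumes u [measurable]: "u \<in> borel_measurable borel" and U: "\<And>z. \<bar>u z\<bar> \<le> U"
    and p: "kernel S B p" and q: "kernel S' B' q"
    and q': "kernel S1 B1 q'" "\<And>s. (q has_real_derivative q' s) (at s)"
  shows "(cv u p q t has_real_derivative cv u p q' t x) (at x)"
proof -
  have "(\<lambda>z. u (snd z, fst z)) \<in> borel_measurable borel" by measurable
  from cv_derivative_fst[OF this U q p q', of t x] show ?thesis
    unfolding cv_swap[OF u kernel_measurable[OF p] kernel_measurable[OF q], abs_def]
      cv_swap[OF u kernel_measurable[OF p] kernel_measurable[OF q'(1)]] .
qed

lemma kernelI:
  assumes c: "continuous_on UNIV p" and z: "\<And>s. S < \<bar>s\<bar> \<Longrightarrow> p s = 0"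
  obtains B where "kernel S B p"
proof -
  have "bounded (p ` {-S..S})" by (intro compact_imp_bounded compact_continuous_image continuous_on_subset[OF c]) auto
  then obtain B where B: "\<forall>s\<in>{-S..S}. \<bar>p s\<bar> \<le> B" by (auto simp: bounded_iff)
  have "\<bar>p s\<bar> \<le> max 0 B" for s
    using bspec[OF B, of s] z[of s] by (cases "S < \<bar>s\<bar>") (simp, fastforce simp: abs_le_iff)
  then show thesis using that c z by (auto simp: kernel_def)
qed

lemma mollifier_kernel:
  assumes "mollifier r k" obtains B where "kernel r B k"
  using kernelI[of k r] mollifierD[OF assms] by blast

lemma mollifier_pair:
  assumes k: "mollifier r k"
  shows "(\<integral>\<^sup>+z. ennreal (k (t - fst z) * k (x - snd z)) \<partial>lborel) = 1"
    and "integrable lborel (\<lambda>z. k (t - fst z) * k (x - snd z))"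
    and "(\<integral>z. k (t - fst z) * k (x - snd z) \<partial>lborel) = 1"
proof -
  note [measurable] = mollifierD(4)[OF k]
  show i: "(\<integral>\<^sup>+z. ennreal (k (t - fst z) * k (x - snd z)) \<partial>lborel) = 1"
    using nn_integral_pair_mult[of "\<lambda>s. ennreal (k (t - s))" "\<lambda>s. ennreal (k (x - s))"]
    by (simp add: ennreal_mult' mollifierD[OF k])
  show "integrable lborel (\<lambda>z. k (t - fst z) * k (x - snd z))"
    using i by (intro integrableI_nonneg) (auto simp: mollifierD(2)[OF k])
  show "(\<integral>z. k (t - fst z) * k (x - snd z) \<partial>lborel) = 1"
    using i by (subst integral_eq_nn_integral) (auto simp: mollifierD(2)[OF k])
qed

lemma abs_cv_le_nn_integral:
  assumes [measurable]: "u \<in> borel_measurable borel" and k: "mollifier r k"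
  shows "ennreal \<bar>cv u k k t x\<bar> \<le> (\<integral>\<^sup>+z. ennreal \<bar>u z\<bar> * ennreal (k (t - fst z) * k (x - snd z)) \<partial>lborel)"
proof -
  note [measurable] = mollifierD(4)[OF k]
  \<comment> \<open>If the integrand is not integrable, its Bochner integral is 0 by convention and
    the inequality is trivial.\<close>
  have "ennreal \<bar>cv u k k t x\<bar> \<le> (\<integral>\<^sup>+z. norm (u z * (k (t - fst z) * k (x - snd z))) \<partial>lborel)"
    unfolding cv_def using integral_norm_bound_ennreal by (cases "integrable lborel (\<lambda>z. u z * (k (t - fst z) * k (x - snd z)))")
      (auto simp: not_integrable_integral_eq simp flip: real_norm_def)
  also have "\<dots> = (\<integral>\<^sup>+z. ennreal \<bar>u z\<bar> * ennreal (k (t - fst z) * k (x - snd z)) \<partial>lborel)"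
    by (intro nn_integral_cong) (simp add: abs_mult mollifierD(2)[OF k] ennreal_mult')
  finally show ?thesis .
qed

lemma abs_cv_le:
  assumes [measurable]: "u \<in> borel_measurable borel" and U: "\<And>z. \<bar>u z\<bar> \<le> U" and k: "mollifier r k"
  shows "\<bar>cv u k k t x\<bar> \<le> U"
proof -
  note [measurable] = mollifierD(4)[OF k]
  have U0: "0 \<le> U" using U[of undefined] by linarith
  have "ennreal \<bar>cv u k k t x\<bar> \<le> (\<integral>\<^sup>+z. ennreal U * ennreal (k (t - fst z) * k (x - snd z)) \<partial>lborel)"
    by (intro order_trans[OF abs_cv_le_nn_integral[OF assms(1) k]] nn_integral_mono mult_right_mono ennreal_leI U) auto
  also have "\<dots> = ennreal U" by (simp add: nn_integral_cmult mollifier_pair(1)[OF k])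
  finally show ?thesis using U0 by (simp add: ennreal_le_iff)
qed

abbreviation mollify_err :: "(real \<times> real \<Rightarrow> real) \<Rightarrow> (real \<Rightarrow> real) \<Rightarrow> (real \<times> real) set \<Rightarrow> ennreal" where
  "mollify_err w k R \<equiv> (\<integral>\<^sup>+z. ennreal \<bar>cv w k k (fst z) (snd z) - w z\<bar> * indicator R z \<partial>lborel)"

text \<open>An e/3 argument through a continuous approximation g: the mollification of u - g, the
  modulus of continuity of g, and u - g itself. The same \<delta> serves every kernel of radius at
  most \<delta>, so that one kernel can later be used for several functions at once.\<close>

lemma cv_mollify_L1:
  assumes [measurable]: "u \<in> borel_measurable borel" and U: "\<And>z. \<bar>u z\<bar> \<le> U" and e: "0 < e"
  shows "\<exists>\<delta>>0. \<forall>r k. r \<le> \<delta> \<longrightarrow> mollifier r k \<longrightarrow>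
    mollify_err u k (cbox (t1,x1) (t2,x2)) \<le> ennreal e"
proof -
  let ?R = "cbox (t1,x1) (t2,x2)" and ?R' = "cbox (t1-1,x1-1) (t2+1,x2+1)"
  obtain g where g: "continuous_on UNIV g" "\<And>x. \<bar>g x\<bar> \<le> U" and
    gu: "(\<integral>\<^sup>+x. ennreal \<bar>u x - g x\<bar> * indicator ?R' x \<partial>lborel) < ennreal (e/3)"
    by (rule L1_continuous_approx[OF assms(1) U, of "e/3" "(t1-1,x1-1)" "(t2+1,x2+1)"]) (use e in auto)
  have [measurable]: "g \<in> borel_measurable borel" using g(1) by (rule borel_measurable_continuous_onI)
  define A where "A = measure lborel ?R"
  have eA: "emeasure lborel ?R = ennreal A"
    unfolding A_def by (intro emeasure_eq_ennreal_measure) (use emeasure_lborel_cbox_finite[of "(t1,x1)" "(t2,x2)"] in auto)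
  \<comment> \<open>A uniform error \<eta> over a box of area \<open>A\<close> costs at most e/3;
    the summand 1 covers boxes of area zero.\<close>
  define \<eta> where "\<eta> = e / (3 * (A + 1))"
  have A0: "0 \<le> A" by (simp add: A_def)
  have \<eta>: "0 < \<eta>" "\<eta> * A \<le> e / 3" using e A0 by (auto simp: \<eta>_def field_simps)
  have "uniformly_continuous_on ?R' g" by (intro compact_uniformly_continuous continuous_on_subset[OF g(1)]) auto
  then obtain d where d: "d > 0" "\<And>z z'. z \<in> ?R' \<Longrightarrow> z' \<in> ?R' \<Longrightarrow> dist z' z < d \<Longrightarrow> dist (g z') (g z) < \<eta>"
    using \<eta>(1) unfolding uniformly_continuous_on_def by metis
  \<comment> \<open>The bound 1 keeps the support of the kernel inside the enlarged box
    \<open>?R'\<close>. Since the distance is at most the sum of two coordinate differences, d/3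
    keeps it below 2d/3 < d.\<close>
  define \<delta> where "\<delta> = min 1 (d / 3)"
  have "\<delta> > 0" using d by (auto simp: \<delta>_def)
  moreover have "mollify_err u k ?R \<le> ennreal e"
    if r: "r \<le> \<delta>" and k: "mollifier r k" for r k
  proof -
    note [measurable] = mollifierD(4)[OF k]
    obtain B where B: "kernel r B k" using mollifier_kernel[OF k] .
    let ?k = "\<lambda>z z'. k (fst z - fst z') * k (snd z - snd z')"
    have gb: "\<bar>cv g k k (fst z) (snd z) - g z\<bar> \<le> \<eta>" if z: "z \<in> ?R" for z
    proof -
      have i1: "integrable lborel (\<lambda>z'. g z' * ?k z z')" by (rule cv_integrable[OF _ g(2) B B]) simp
      have i2: "integrable lborel (\<lambda>z'. g z * ?k z z')" by (intro integrable_mult_right mollifier_pair[OF k])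
      have "cv g k k (fst z) (snd z) - g z = (\<integral>z'. g z' * ?k z z' \<partial>lborel) - (\<integral>z'. g z * ?k z z' \<partial>lborel)"
        using mollifier_pair(3)[OF k] by (simp add: cv_def)
      also have "\<dots> = (\<integral>z'. (g z' - g z) * ?k z z' \<partial>lborel)"
        by (subst Bochner_Integration.integral_diff[symmetric, OF i1 i2]) (simp add: algebra_simps)
      also have "norm \<dots> \<le> (\<integral>z'. \<eta> * ?k z z' \<partial>lborel)"
      proof (rule Bochner_Integration.integral_norm_bound_integral)
        show "integrable lborel (\<lambda>z'. (g z' - g z) * ?k z z')"
          using Bochner_Integration.integrable_diff[OF i1 i2] by (simp add: left_diff_distrib)
        show "integrable lborel (\<lambda>z'. \<eta> * ?k z z')" by (intro integrable_mult_right mollifier_pair[OF k])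
        fix z'
        show "norm ((g z' - g z) * ?k z z') \<le> \<eta> * ?k z z'"
        proof (cases "?k z z' = 0")
          case False
          then have a: "\<bar>fst z - fst z'\<bar> \<le> r" "\<bar>snd z - snd z'\<bar> \<le> r" using kernel_zero[OF B] by auto
          then have "z' \<in> ?R'" "z \<in> ?R'" using r z by (cases z, cases z', auto simp: \<delta>_def cbox_Pair_eq)+
          moreover have "dist z' z < d"
          proof -
            have "dist z' z \<le> \<bar>fst z - fst z'\<bar> + \<bar>snd z - snd z'\<bar>"
              using sqrt_sum_squares_le_sum_abs[of "fst z' - fst z" "snd z' - snd z"]
              by (simp add: dist_prod_def dist_real_def abs_minus_commute)
            also have "\<dots> \<le> 2 * (d / 3)" using a r by (simp add: \<delta>_def)
            finally show ?thesis using d by linarith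
          qed
          ultimately have "\<bar>g z' - g z\<bar> \<le> \<eta>" using d(2) by (fastforce simp: dist_real_def)
          then show ?thesis using mollifierD(2)[OF k] by (simp add: abs_mult mult_right_mono)
        qed (auto simp del: mult_eq_0_iff)
      qed
      also have "\<dots> = \<eta>" using mollifier_pair(3)[OF k] by simp
      finally show ?thesis by simp
    qed
    let ?D = "\<lambda>z. \<integral>\<^sup>+z'. ennreal \<bar>u z' - g z'\<bar> * ennreal (?k z z') \<partial>lborel"
    have pw: "ennreal \<bar>cv u k k (fst z) (snd z) - u z\<bar> * indicator ?R z
       \<le> ?D z * indicator ?R z + (ennreal \<eta> * indicator ?R z + ennreal \<bar>u z - g z\<bar> * indicator ?R' z)" for z
    proof (cases "z \<in> ?R")
      case True
      then have z': "z \<in> ?R'" by (cases z) (auto simp: cbox_Pair_eq)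
      have "cv u k k (fst z) (snd z) = cv (\<lambda>z. u z - g z) k k (fst z) (snd z) + cv g k k (fst z) (snd z)"
        using Bochner_Integration.integral_diff[OF cv_integrable[OF assms(1) U B B, of "fst z" "snd z"]
          cv_integrable[OF \<open>g \<in> borel_measurable borel\<close> g(2) B B, of "fst z" "snd z"]]
        by (simp add: cv_def left_diff_distrib)
      then have "\<bar>cv u k k (fst z) (snd z) - u z\<bar> \<le> \<bar>cv (\<lambda>z. u z - g z) k k (fst z) (snd z)\<bar> + (\<eta> + \<bar>u z - g z\<bar>)"
        using gb[OF True] by linarith
      then have "ennreal \<bar>cv u k k (fst z) (snd z) - u z\<bar> \<le> ennreal \<bar>cv (\<lambda>z. u z - g z) k k (fst z) (snd z)\<bar> + (ennreal \<eta> + ennreal \<bar>u z - g z\<bar>)"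
        using \<eta> by (simp flip: ennreal_plus)
      also have "\<dots> \<le> ?D z + (ennreal \<eta> + ennreal \<bar>u z - g z\<bar>)"
        by (intro add_right_mono abs_cv_le_nn_integral[OF _ k]) simp
      finally show ?thesis using True z' by simp
    qed simp
    have "mollify_err u k ?R
       \<le> (\<integral>\<^sup>+z. ?D z * indicator ?R z + (ennreal \<eta> * indicator ?R z + ennreal \<bar>u z - g z\<bar> * indicator ?R' z) \<partial>lborel)"
      by (intro nn_integral_mono pw)
    also have "\<dots> = (\<integral>\<^sup>+z. ?D z * indicator ?R z \<partial>lborel) + ((\<integral>\<^sup>+z. ennreal \<eta> * indicator ?R z \<partial>lborel)
         + (\<integral>\<^sup>+z. ennreal \<bar>u z - g z\<bar> * indicator ?R' z \<partial>lborel))"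
      by (subst nn_integral_add) (auto simp: nn_integral_add)
    also have "\<dots> \<le> ennreal (e/3) + (ennreal (e/3) + ennreal (e/3))"
    proof (intro add_mono)
      have "(\<integral>\<^sup>+z. ?D z * indicator ?R z \<partial>lborel)
        \<le> (\<integral>\<^sup>+p. ennreal \<bar>u p - g p\<bar> * indicator {p. t1 - r \<le> fst p \<and> fst p \<le> t2 + r \<and> x1 - r \<le> snd p \<and> snd p \<le> x2 + r} p \<partial>lborel)"
        by (intro nn_integral_mollified_le k sigma_finite_lborel) auto
      also have "\<dots> \<le> (\<integral>\<^sup>+p. ennreal \<bar>u p - g p\<bar> * indicator ?R' p \<partial>lborel)"
        using r by (intro nn_integral_mono mult_left_mono) (auto simp: indicator_def \<delta>_def cbox_Pair_eq)
      finally show "(\<integral>\<^sup>+z. ?D z * indicator ?R z \<partial>lborel) \<le> ennreal (e/3)" using gu by simp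
      have "(\<integral>\<^sup>+z. ennreal \<eta> * indicator ?R z \<partial>lborel) = ennreal \<eta> * ennreal A"
        by (subst nn_integral_cmult_indicator) (auto simp: eA)
      also have "\<dots> \<le> ennreal (e/3)" using \<eta> A0 by (metis ennreal_mult ennreal_leI less_imp_le)
      finally show "(\<integral>\<^sup>+z. ennreal \<eta> * indicator ?R z \<partial>lborel) \<le> ennreal (e/3)" .
      show "(\<integral>\<^sup>+z. ennreal \<bar>u z - g z\<bar> * indicator ?R' z \<partial>lborel) \<le> ennreal (e/3)" using gu by simp
    qed
    also have "\<dots> = ennreal e" using e by (simp flip: ennreal_plus)
    finally show ?thesis .
  qed
  ultimately show ?thesis by blast
qed

section \<open>Smooth functions and product test functions\<close>

definition smooth1 :: "(real \<Rightarrow> real) \<Rightarrow> bool" where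
  "smooth1 f \<longleftrightarrow> (\<forall>k x. ((deriv ^^ k) f) differentiable (at x))"

text \<open>A finite order allows induction: the derivative of a product is again a sum of products,
  of functions with one order of differentiability less to spare.\<close>

definition diff_upto :: "nat \<Rightarrow> (real \<Rightarrow> real) \<Rightarrow> bool" where
  "diff_upto n f \<longleftrightarrow> (\<forall>k<n. \<forall>x. ((deriv ^^ k) f) differentiable (at x))"

lemma smooth1_iff_diff_upto: "smooth1 f \<longleftrightarrow> (\<forall>n. diff_upto n f)"
  by (auto simp: smooth1_def diff_upto_def)

lemma diff_upto_Suc: "diff_upto (Suc n) f \<longleftrightarrow> (\<forall>x. f differentiable (at x)) \<and> diff_upto n (deriv f)"
  by (auto simp: diff_upto_def less_Suc_eq_0_disj funpow_swap1 simp del: funpow.simps(2) simp add: funpow_Suc_right)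

lemma diff_upto_mono: "diff_upto (Suc n) f \<Longrightarrow> diff_upto n f"
  by (auto simp: diff_upto_def)

lemma deriv_has_real_derivative:
  assumes "(f :: real \<Rightarrow> real) differentiable (at x)"
  shows "(f has_real_derivative deriv f x) (at x)" using assms by (auto simp: real_differentiable_def dest: DERIV_imp_deriv)

lemma has_real_derivative_affine:
  assumes "\<And>x. (f has_real_derivative f' x) (at x)"
  shows "((\<lambda>x. f (a + b * x)) has_real_derivative b * f' (a + b * x)) (at x)"
proof -
  have "((\<lambda>x. a + b * x) has_real_derivative b) (at x)" by (auto intro!: derivative_eq_intros)
  from DERIV_chain2[OF assms this] show ?thesis by (simp add: mult.commute)
qed

lemma diff_upto_add:
  "diff_upto n f \<Longrightarrow> diff_upto n g \<Longrightarrow> diff_upto n (\<lambda>x. f x + g x)"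
proof (induction n arbitrary: f g)
  case (Suc n)
  then have d: "f differentiable (at x)" "g differentiable (at x)" for x by (auto simp: diff_upto_Suc)
  have "deriv (\<lambda>x. f x + g x) = (\<lambda>x. deriv f x + deriv g x)"
    by (intro ext DERIV_imp_deriv DERIV_add deriv_has_real_derivative d)
  then show ?case using Suc d by (auto simp: diff_upto_Suc)
qed (simp add: diff_upto_def)

lemma diff_upto_mult:
  "diff_upto n f \<Longrightarrow> diff_upto n g \<Longrightarrow> diff_upto n (\<lambda>x. f x * g x)"
proof (induction n arbitrary: f g)
  case (Suc n)
  then have d: "f differentiable (at x)" "g differentiable (at x)" for x by (auto simp: diff_upto_Suc)
  have "deriv (\<lambda>x. f x * g x) = (\<lambda>x. deriv f x * g x + f x * deriv g x)"
    by (intro ext DERIV_imp_deriv) (auto intro!: derivative_eq_intros deriv_has_real_derivative d)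
  moreover have "diff_upto n (\<lambda>x. deriv f x * g x + f x * deriv g x)"
    using Suc.prems by (intro diff_upto_add Suc.IH) (auto simp: diff_upto_Suc dest: diff_upto_mono intro: diff_upto_mono[unfolded diff_upto_Suc])
  ultimately show ?case using d by (auto simp: diff_upto_Suc)
qed (simp add: diff_upto_def)

lemma smooth1_mult: "smooth1 f \<Longrightarrow> smooth1 g \<Longrightarrow> smooth1 (\<lambda>x. f x * g x)"
  by (simp add: smooth1_iff_diff_upto diff_upto_mult)

lemma smooth1_const: "smooth1 (\<lambda>x. c)"
proof -
  have "diff_upto n (\<lambda>x. c)" for n c by (induction n arbitrary: c) (auto simp: diff_upto_Suc, auto simp: diff_upto_def)
  then show ?thesis by (simp add: smooth1_iff_diff_upto)
qed

lemma smooth1_ident: "smooth1 (\<lambda>x. x)"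
proof -
  have "diff_upto n (\<lambda>x. x)" for n
    using smooth1_const by (cases n) (auto simp: diff_upto_Suc smooth1_iff_diff_upto, auto simp: diff_upto_def)
  then show ?thesis by (simp add: smooth1_iff_diff_upto)
qed

lemma smooth1_deriv: "smooth1 f \<Longrightarrow> smooth1 (deriv f)"
  using diff_upto_Suc smooth1_iff_diff_upto by blast

lemma smooth1_funpow_deriv: "smooth1 f \<Longrightarrow> smooth1 ((deriv ^^ k) f)"
  by (induction k) (auto intro: smooth1_deriv)

lemma smooth1_derivative: "smooth1 f \<Longrightarrow> (f has_real_derivative deriv f x) (at x)"
  unfolding smooth1_def by (intro deriv_has_real_derivative) (metis funpow_0)

lemma smooth1_continuous: "smooth1 f \<Longrightarrow> continuous_on A f"
  by (meson DERIV_isCont continuous_at_imp_continuous_on smooth1_derivative)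

lemma smooth1_affine:
  assumes "smooth1 f" shows "smooth1 (\<lambda>x. f (a + b * x))"
proof -
  have "diff_upto n f \<Longrightarrow> diff_upto n (\<lambda>x. f (a + b * x))" for n f
  proof (induction n arbitrary: f)
    case (Suc n)
    then have d: "(f has_real_derivative deriv f x) (at x)" for x by (auto simp: diff_upto_Suc intro: deriv_has_real_derivative)
    have d': "((\<lambda>x. f (a + b * x)) has_real_derivative b * deriv f (a + b * x)) (at x)" for x
      by (rule has_real_derivative_affine[OF d])
    then have "deriv (\<lambda>x. f (a + b * x)) = (\<lambda>x. b * deriv f (a + b * x))" by (intro ext DERIV_imp_deriv)
    moreover have "diff_upto n (\<lambda>x. b * deriv f (a + b * x))"
      using Suc smooth1_const by (intro diff_upto_mult) (auto simp: diff_upto_Suc smooth1_iff_diff_upto)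
    moreover have "(\<lambda>x. f (a + b * x)) differentiable (at x)" for x using d' real_differentiable_def by blast
    ultimately show ?case by (simp add: diff_upto_Suc)
  qed (simp add: diff_upto_def)
  then show ?thesis using assms by (simp add: smooth1_iff_diff_upto)
qed

lemma smooth1_reflect: "smooth1 f \<Longrightarrow> smooth1 (\<lambda>s. f (t - s))"
  using smooth1_affine[of f t "-1"] by simp

lemma deriv_reflect:
  assumes "smooth1 f" shows "deriv (\<lambda>s. f (t - s)) s = - deriv f (t - s)"
  using has_real_derivative_affine[OF smooth1_derivative[OF assms], of t "-1" s] by (intro DERIV_imp_deriv) simp

lemma deriv_zero_outside:
  assumes "\<And>s. S < \<bar>s\<bar> \<Longrightarrow> f s = (0::real)" "S < \<bar>s\<bar>"
  shows "deriv f s = 0"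
proof -
  have "((\<lambda>_. 0) has_real_derivative 0) (at s)" by simp
  moreover have "open {s::real. S < \<bar>s\<bar>}" by (intro open_Collect_less continuous_intros)
  ultimately have "(f has_real_derivative 0) (at s)" by (rule has_field_derivative_transform_within_open) (use assms in auto)
  then show ?thesis by (rule DERIV_imp_deriv)
qed

lemma funpow_deriv_zero_outside:
  assumes "\<And>s. S < \<bar>s\<bar> \<Longrightarrow> f s = (0::real)" "S < \<bar>s\<bar>"
  shows "(deriv ^^ k) f s = 0" using assms(2) by (induction k arbitrary: s) (auto intro: assms(1) deriv_zero_outside)

text \<open>Each partial derivative acts on one factor and treats the others as constants, so the
  order of the directions is lost and only their multiplicities remain.\<close>

lemma iter_pdiff3_product:
  assumes "smooth1 \<theta>" "smooth1 \<eta>" "smooth1 \<omega>" "set is \<subseteq> {0,1,2}"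
  shows "iter_pdiff3 is (\<lambda>(t,x,v). \<theta> t * \<eta> x * \<omega> v)
     = (\<lambda>(t,x,v). (deriv ^^ count_list is 0) \<theta> t * (deriv ^^ count_list is 1) \<eta> x * (deriv ^^ count_list is 2) \<omega> v)"
    (is "_ = ?R is")
  using assms(4)
proof (induction "is")
  case (Cons i "is")
  have d: "((\<lambda>h. (deriv ^^ k) f (a + h)) has_real_derivative (deriv ^^ Suc k) f a) (at 0)" if "smooth1 f" for f k a
    using DERIV_shift[of "(deriv ^^ k) f" "(deriv ^^ Suc k) f a" 0 a] smooth1_derivative[OF smooth1_funpow_deriv[OF that, of k], of a]
    by (simp add: add.commute)
  have "iter_pdiff3 (i # is) (\<lambda>(t,x,v). \<theta> t * \<eta> x * \<omega> v) p = ?R (i # is) p" for p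
  proof -
    obtain t x v where p: "p = (t,x,v)" by (cases p)
    consider "i = 0" | "i = 1" | "i = 2" using Cons.prems by auto
    then show ?thesis
    proof cases
      case 1
      then show ?thesis using Cons d[OF assms(1)] by (auto simp: p pdiff3_def unitv3_def intro!: DERIV_imp_deriv derivative_eq_intros)
    next
      case 2
      then show ?thesis using Cons d[OF assms(2)] by (auto simp: p pdiff3_def unitv3_def intro!: DERIV_imp_deriv derivative_eq_intros)
    next
      case 3
      then show ?thesis using Cons d[OF assms(3)] by (auto simp: p pdiff3_def unitv3_def intro!: DERIV_imp_deriv derivative_eq_intros)
    qed
  qed
  then show ?case by (rule ext)
qed auto

lemma smooth3_product:
  assumes "smooth1 \<theta>" "smooth1 \<eta>" "smooth1 \<omega>"
  shows "smooth3 (\<lambda>(t,x,v). \<theta> t * \<eta> x * \<omega> v)" unfolding smooth3_def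
proof (intro allI impI conjI ballI)
  fix "is" :: "nat list" assume i: "set is \<subseteq> {0,1,2}"
  have c: "continuous_on UNIV (\<lambda>p. (deriv ^^ k) f (g p))" if "smooth1 f" "continuous_on UNIV g" for f k and g :: "real \<times> real \<times> real \<Rightarrow> real"
    using continuous_on_compose[OF that(2) smooth1_continuous[OF smooth1_funpow_deriv[OF that(1)]]] by (simp add: o_def)
  show "continuous_on UNIV (iter_pdiff3 is (\<lambda>(t,x,v). \<theta> t * \<eta> x * \<omega> v))"
    by (subst iter_pdiff3_product[OF assms i], unfold split_def, intro continuous_intros c assms)
  fix j :: nat and p :: "real \<times> real \<times> real" assume "j \<in> {0,1,2}"
  obtain t x v where p: "p = (t,x,v)" by (cases p)
  have d: "(\<lambda>h. (deriv ^^ k) f (a + h * b)) differentiable (at 0)" if "smooth1 f" for f k a b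
    using smooth1_derivative[OF smooth1_affine[OF smooth1_funpow_deriv[OF that, of k], of a b], of 0] real_differentiable_def
    by (fastforce simp: mult.commute)
  show "(\<lambda>h. iter_pdiff3 is (\<lambda>(t,x,v). \<theta> t * \<eta> x * \<omega> v) (p + h *\<^sub>R unitv3 j)) differentiable (at 0)"
    unfolding iter_pdiff3_product[OF assms i] by (cases "unitv3 j") (auto simp: p intro!: differentiable_mult d assms)
qed

lemma test_fun3_product:
  assumes "smooth1 \<theta>" "smooth1 \<eta>" "smooth1 \<omega>" and c: "0 < c"
    and "\<And>t. \<theta> t \<noteq> 0 \<Longrightarrow> c \<le> t \<and> t \<le> d" "\<And>x. \<eta> x \<noteq> 0 \<Longrightarrow> c' \<le> x \<and> x \<le> d'" "\<And>v. \<omega> v \<noteq> 0 \<Longrightarrow> c'' \<le> v \<and> v \<le> d''"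
  shows "test_fun3 Dom3 (\<lambda>(t,x,v). \<theta> t * \<eta> x * \<omega> v)"
proof -
  let ?S = "{p. (\<lambda>(t,x,v). \<theta> t * \<eta> x * \<omega> v) p \<noteq> 0}"
  have "?S \<subseteq> cbox (c,c',c'') (d,d',d'')" using assms(5-7) by (auto simp: cbox_Pair_eq)
  then have s: "closure ?S \<subseteq> cbox (c,c',c'') (d,d',d'')" by (intro closure_minimal) auto
  also have "\<dots> \<subseteq> Dom3" using c by (auto simp: cbox_Pair_eq Dom3_def)
  finally have "closure ?S \<subseteq> Dom3" .
  moreover have "compact (closure ?S)" using s by (meson bounded_cbox bounded_subset closed_closure compact_eq_bounded_closed)
  ultimately show ?thesis using smooth3_product[OF assms(1-3)] by (auto simp: test_fun3_def)
qed

lemma count_list_replicate: "count_list (replicate n x) y = (if x = y then n else 0)"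
  by (induction n) auto

lemma pdiff3_product:
  assumes "smooth1 \<theta>" "smooth1 \<eta>" "smooth1 \<omega>"
  shows "pdiff3 0 (\<lambda>(t,x,v). \<theta> t * \<eta> x * \<omega> v) = (\<lambda>(t,x,v). deriv \<theta> t * \<eta> x * \<omega> v)"
    "pdiff3 1 (\<lambda>(t,x,v). \<theta> t * \<eta> x * \<omega> v) = (\<lambda>(t,x,v). \<theta> t * deriv \<eta> x * \<omega> v)"
    "iter_pdiff3 (replicate \<gamma> 2) (\<lambda>(t,x,v). \<theta> t * \<eta> x * \<omega> v) = (\<lambda>(t,x,v). \<theta> t * \<eta> x * (deriv ^^ \<gamma>) \<omega> v)"
  using iter_pdiff3_product[OF assms, of "[0]"] iter_pdiff3_product[OF assms, of "[1]"] iter_pdiff3_product[OF assms, of "replicate \<gamma> 2"]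
    set_replicate_conv_if[of \<gamma> "2::nat"]
  by (auto simp: count_list_replicate split: if_splits)

lemma smooth1_kernel:
  assumes "smooth1 f" "\<And>s. S < \<bar>s\<bar> \<Longrightarrow> f s = 0"
  obtains B where "kernel S B ((deriv ^^ k) f)"
proof (rule kernelI[OF smooth1_continuous[OF smooth1_funpow_deriv[OF assms(1)]]])
  show "S < \<bar>s\<bar> \<Longrightarrow> (deriv ^^ k) f s = 0" for s by (rule funpow_deriv_zero_outside[OF assms(2)])
qed (rule that)

section \<open>Mollifiers and a majorant obtained from a single test function\<close>

lemma test_fun1_smooth1:
  assumes "test_fun1 \<psi>" obtains S where "smooth1 \<psi>" "S > 0" "\<And>s. S < \<bar>s\<bar> \<Longrightarrow> \<psi> s = 0"
proof -
  have "bounded {x. \<psi> x \<noteq> 0}" using assms unfolding test_fun1_def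
    by (intro bounded_subset[OF compact_imp_bounded closure_subset]) auto
  then obtain S where "S > 0" "\<forall>s\<in>{x. \<psi> x \<noteq> 0}. norm s \<le> S" by (meson bounded_pos)
  then show thesis using that[of S] assms by (force simp: test_fun1_def smooth1_def)
qed

text \<open>Any nonzero smooth function of compact support yields mollifiers of every radius:
  squaring makes it nonnegative, dilation by S / r brings the support into [-r, r], and division by
  the integral normalises it.\<close>

lemma exists_smooth_mollifier:
  assumes f: "smooth1 f" "f x0 \<noteq> 0" and S: "S > 0" "\<And>s. S < \<bar>s\<bar> \<Longrightarrow> f s = 0" and r: "0 < r"
  shows "\<exists>k. mollifier r k \<and> smooth1 k"
proof -
  define b where "b = S / r"
  have b: "b > 0" using S r by (simp add: b_def)
  define g where "g s = f (0 + b * s) * f (0 + b * s)" for s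
  have sg: "smooth1 g" unfolding g_def by (intro smooth1_mult smooth1_affine f)
  have g0: "0 \<le> g s" for s by (simp add: g_def)
  have gz: "g s = 0" if "r < \<bar>s\<bar>" for s
  proof -
    have "S < \<bar>b * s\<bar>" using that r b S by (simp add: b_def abs_mult field_simps)
    then show ?thesis using S by (simp add: g_def)
  qed
  have [measurable]: "g \<in> borel_measurable borel" by (intro borel_measurable_continuous_onI smooth1_continuous sg)
  obtain B where B: "kernel r B g" using kernelI[OF smooth1_continuous[OF sg] gz] by blast
  have "(\<integral>\<^sup>+s. ennreal (g s) \<partial>lborel) \<le> (\<integral>\<^sup>+s. ennreal B * indicator {-r..r} s \<partial>lborel)"
  proof (intro nn_integral_mono)
    fix s show "ennreal (g s) \<le> ennreal B * indicator {-r..r} s"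
      using kernel_le[OF B, of s] gz[of s] by (cases "r < \<bar>s\<bar>") (auto simp: indicator_def abs_le_iff intro!: ennreal_leI)
  qed
  also have "\<dots> < \<infinity>" using r by (simp add: nn_integral_cmult_indicator ennreal_mult_less_top)
  finally have fin: "(\<integral>\<^sup>+s. ennreal (g s) \<partial>lborel) < \<infinity>" .
  \<comment> \<open>A zero integral would make the open set where g is nonzero negligible, hence
    empty, yet it contains x0 / b.\<close>
  have "(\<integral>\<^sup>+s. ennreal (g s) \<partial>lborel) \<noteq> 0"
  proof
    assume "(\<integral>\<^sup>+s. ennreal (g s) \<partial>lborel) = 0"
    then have "AE s in lborel. ennreal (g s) = 0" by (simp add: nn_integral_0_iff_AE)
    then have "AE s in lborel. s \<notin> {s. g s \<noteq> 0}"
      by eventually_elim (use g0 in \<open>simp add: ennreal_eq_0_iff order_antisym\<close>)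
    then have "AE s in lebesgue. s \<notin> {s. g s \<noteq> 0}" by (rule AE_completion)
    moreover have o: "open {s. g s \<noteq> 0}" by (intro open_Collect_neq smooth1_continuous sg continuous_intros)
    ultimately have "negligible {s. g s \<noteq> 0}" by (simp add: negligible_iff_null_sets AE_iff_null_sets borel_open)
    then have "{s. g s \<noteq> 0} = {}" using o open_not_negligible by blast
    moreover have "g (x0 / b) \<noteq> 0" using b f by (simp add: g_def)
    ultimately show False by blast
  qed
  then obtain c where c: "c > 0" "(\<integral>\<^sup>+s. ennreal (g s) \<partial>lborel) = ennreal c"
    using fin by (cases "\<integral>\<^sup>+s. ennreal (g s) \<partial>lborel") (auto simp: less_le)
  define k where "k s = 1 / c * g s" for s
  have sk: "smooth1 k" unfolding k_def by (intro smooth1_mult smooth1_const sg)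
  have "(\<integral>\<^sup>+s. ennreal (k s) \<partial>lborel) = ennreal (1/c) * ennreal c"
    using c g0 by (simp add: k_def ennreal_mult' nn_integral_cmult del: times_divide_eq_left)
  also have "\<dots> = 1" using c by (simp flip: ennreal_mult)
  finally have "mollifier r k" using smooth1_continuous[OF sk] c g0 gz by (auto simp: mollifier_def k_def)
  then show ?thesis using sk by blast
qed

text \<open>Stretched about x0, a copy of f stays away from zero on all of [-S, S]. A large multiple
  of its square is smooth, nonnegative and compactly supported, and dominates |f| there; elsewhere f
  vanishes.\<close>

lemma exists_smooth_majorant:
  assumes f: "smooth1 f" "f x0 \<noteq> 0" and S: "S > 0" "\<And>s. S < \<bar>s\<bar> \<Longrightarrow> f s = 0"
  obtains g S' where "smooth1 g" "S' > 0" "\<And>s. S' < \<bar>s\<bar> \<Longrightarrow> g s = 0" "\<And>s. \<bar>f s\<bar> \<le> g s"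
proof -
  obtain B where B: "kernel S B f" using kernelI[OF smooth1_continuous[OF f(1)] S(2)] by blast
  have "isCont f x0" using smooth1_derivative[OF f(1)] DERIV_isCont by blast
  then obtain \<delta> where \<delta>: "\<delta> > 0" "\<And>s. \<bar>s - x0\<bar> < \<delta> \<Longrightarrow> \<bar>f s - f x0\<bar> < \<bar>f x0\<bar> / 2"
    using f(2) unfolding continuous_at_eps_delta dist_real_def by (metis half_gt_zero zero_less_abs_iff)
  \<comment> \<open>For |s| \<le> S the argument x0 + b s moves by at most b S = \<delta>/2, so |f|
    remains at least |f x0| / 2. The constant \<open>C\<close> is then chosen so that C (f x0 / 2)^2
    equals the bound B of |f|.\<close>
  define b where "b = \<delta> / (2 * S)"
  have b: "b > 0" using S \<delta> by (simp add: b_def)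
  define C where "C = 4 * B / (f x0)\<^sup>2"
  have B0: "B \<ge> 0" using kernel_le[OF B, of 0] by linarith
  define g where "g s = C * (f (x0 + b * s) * f (x0 + b * s))" for s
  have C0: "C \<ge> 0" using B0 by (simp add: C_def)
  have "smooth1 g" unfolding g_def by (intro smooth1_mult smooth1_const smooth1_affine f)
  moreover have "(S + \<bar>x0\<bar>) / b > 0" using S b by (simp add: add_pos_nonneg)
  moreover have "g s = 0" if "(S + \<bar>x0\<bar>) / b < \<bar>s\<bar>" for s
  proof -
    have "S + \<bar>x0\<bar> < \<bar>b * s\<bar>" using that b by (simp add: abs_mult divide_less_eq mult.commute)
    then have "S < \<bar>x0 + b * s\<bar>" by linarith
    then show ?thesis using S by (simp add: g_def)
  qed
  moreover have "\<bar>f s\<bar> \<le> g s" for s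
  proof (cases "S < \<bar>s\<bar>")
    case True then show ?thesis using S C0 by (simp add: g_def)
  next
    case False
    have "\<bar>b * s\<bar> \<le> b * S" using False b by (simp add: abs_mult)
    also have "\<dots> < \<delta>" using S \<delta> by (simp add: b_def)
    finally have "\<bar>f (x0 + b * s) - f x0\<bar> < \<bar>f x0\<bar> / 2" by (intro \<delta>) simp
    then have "\<bar>f x0\<bar> / 2 \<le> \<bar>f (x0 + b * s)\<bar>" by linarith
    then have "(\<bar>f x0\<bar> / 2)\<^sup>2 \<le> \<bar>f (x0 + b * s)\<bar>\<^sup>2" by (intro power_mono) auto
    then have "C * (\<bar>f x0\<bar> / 2)\<^sup>2 \<le> C * \<bar>f (x0 + b * s)\<bar>\<^sup>2" using C0 by (rule mult_left_mono)
    then have "C * (\<bar>f x0\<bar> / 2)\<^sup>2 \<le> g s" by (simp add: g_def power2_eq_square)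
    moreover have "C * (\<bar>f x0\<bar> / 2)\<^sup>2 = B" using f(2) by (simp add: C_def power_divide)
    ultimately show ?thesis using kernel_le[OF B, of s] by linarith
  qed
  ultimately show thesis using that by blast
qed

section \<open>Velocity moments and the mollified source\<close>

definition mom :: "(real \<times> real \<times> real \<Rightarrow> real) \<Rightarrow> (real \<Rightarrow> real) \<Rightarrow> real \<times> real \<Rightarrow> real" where
  "mom F w z = (\<integral>v. F (fst z, snd z, v) * w v \<partial>lborel)"

declare borel_measurable_Pair [measurable (raw)]

lemma integrable_bounded_cbox:
  fixes f :: "'a::euclidean_space \<Rightarrow> real"
  assumes [measurable]: "f \<in> borel_measurable borel" and "\<And>z. \<bar>f z\<bar> \<le> c * indicator (cbox a b) z"
  shows "integrable lborel f"
proof (rule Bochner_Integration.integrable_bound)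
  show "integrable lborel (\<lambda>z. c * indicator (cbox a b) z :: real)" by (intro integrable_mult_right integrable_indicator_cbox)
  show "AE z in lborel. norm (f z) \<le> norm (c * indicator (cbox a b) z :: real)"
    using assms(2) abs_ge_self order_trans by (intro AE_I2) (fastforce)
qed simp

lemma mom_measurable [measurable]:
  assumes [measurable]: "F \<in> borel_measurable borel" "w \<in> borel_measurable borel"
  shows "mom F w \<in> borel_measurable borel"
proof -
  have "(\<lambda>z. \<integral>v. F (fst z, snd z, v) * w v \<partial>lborel) \<in> borel_measurable borel"
    by (rule lborel.borel_measurable_lebesgue_integral) (simp add: split_def)
  then show ?thesis by (simp add: mom_def[abs_def])
qed

lemma kernel_indicator:
  assumes "kernel S B w" shows "\<bar>w v\<bar> \<le> B * indicator {-S..S} v"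
  using kernel_le[OF assms, of v] kernel_zero[OF assms, of v] by (cases "w v = 0") (auto simp: indicator_def abs_le_iff)

lemma section_measurable:
  assumes "F \<in> borel_measurable borel" shows "(\<lambda>v. F (t, x, v)) \<in> borel_measurable borel"
proof -
  have "continuous_on UNIV (\<lambda>v. (t, x, v))" by (intro continuous_intros)
  from measurable_compose[OF borel_measurable_continuous_onI[OF this] assms] show ?thesis .
qed

lemma mom_integrable:
  assumes [measurable]: "F \<in> borel_measurable borel" and C: "\<And>p. \<bar>F p\<bar> \<le> C" and w: "kernel S B w"
  shows "integrable lborel (\<lambda>v. F (t, x, v) * w v)"
proof (rule integrable_bounded_cbox)
  show "(\<lambda>v. F (t, x, v) * w v) \<in> borel_measurable borel" by (intro borel_measurable_times kernel_measurable[OF w] section_measurable[OF assms(1)])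
  have "0 \<le> C" using C[of undefined] by linarith
  then have "\<bar>F (t,x,v)\<bar> * \<bar>w v\<bar> \<le> C * (B * indicator {-S..S} v)" for v
    by (intro mult_mono C kernel_indicator[OF w]) auto
  then show "\<bar>F (t,x,v) * w v\<bar> \<le> (C * B) * indicator (cbox (-S) S) v" for v by (simp add: abs_mult mult.assoc)
qed

lemma mom_bounded:
  assumes [measurable]: "F \<in> borel_measurable borel" and C: "\<And>p. \<bar>F p\<bar> \<le> C" and w: "kernel S B w" and S: "0 \<le> S"
  shows "\<bar>mom F w z\<bar> \<le> C * B * (2 * S)"
proof -
  have "norm (\<integral>v. F (fst z, snd z, v) * w v \<partial>lborel) \<le> (\<integral>v. C * B * indicator {-S..S} v \<partial>lborel)"
  proof (rule Bochner_Integration.integral_norm_bound_integral)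
    show "integrable lborel (\<lambda>v. C * B * indicator {-S..S} v :: real)"
      using integrable_indicator_cbox[of "-S" S] by (intro integrable_mult_right) simp
    have "0 \<le> C" using C[of undefined] by linarith
    then have "\<bar>F (fst z, snd z,v)\<bar> * \<bar>w v\<bar> \<le> C * (B * indicator {-S..S} v)" for v
      by (intro mult_mono C kernel_indicator[OF w]) auto
    then show "norm (F (fst z, snd z,v) * w v) \<le> C * B * indicator {-S..S} v" for v by (simp add: abs_mult mult.assoc)
  qed (rule mom_integrable[OF assms(1) C w])
  also have "\<dots> = C * B * (2 * S)" using S by simp
  finally show ?thesis by (simp add: mom_def)
qed

text \<open>This turns the weak equation in (t, x, v) into one for functions of (t, x). The
  integrand is bounded with support in a box, which justifies the iterated integration.\<close>

lemma integral_product_kernel_mom: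
  assumes [measurable]: "F \<in> borel_measurable borel" and C: "\<And>p. \<bar>F p\<bar> \<le> C"
    and p: "kernel S B p" and q: "kernel S' B' q" and w: "kernel S'' B'' w"
  shows "(\<integral>P. F P * (case P of (t,x,v) \<Rightarrow> p t * q x * w v) \<partial>lborel) = (\<integral>z. mom F w z * (p (fst z) * q (snd z)) \<partial>lborel)"
    and "integrable lborel (\<lambda>P. F P * (case P of (t,x,v) \<Rightarrow> p t * q x * w v))"
proof -
  note [measurable] = kernel_measurable[OF p] kernel_measurable[OF q] kernel_measurable[OF w]
  note nn = mult_nonneg_nonneg order_trans[OF abs_ge_zero kernel_le[OF p]] order_trans[OF abs_ge_zero kernel_le[OF q]]
  let ?G = "\<lambda>P. F P * (case P of (t,x,v) \<Rightarrow> p t * q x * w v)"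
  have C0: "0 \<le> C" using C[of undefined] by linarith
  have b: "\<bar>?G (t,x,v)\<bar> \<le> C * (B * indicator {-S..S} t * (B' * indicator {-S'..S'} x) * (B'' * indicator {-S''..S''} v))" for t x v
    unfolding abs_mult prod.case using C0
    by (intro mult_mono C kernel_indicator[OF w] kernel_indicator[OF p] kernel_indicator[OF q])
      (auto intro!: nn)
  show i3: "integrable lborel ?G"
  proof (rule integrable_bounded_cbox)
    show "?G \<in> borel_measurable borel" unfolding split_def by measurable
    show "\<bar>?G P\<bar> \<le> (C*B*B'*B'') * indicator (cbox (-S,-S',-S'') (S,S',S'')) P" for P
      using b by (cases P) (auto simp: cbox_Pair_eq indicator_times mult_ac)
  qed
  have i2: "integrable lborel (\<lambda>z. ?G (t, z))" for t
  proof (rule integrable_bounded_cbox)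
    show "(\<lambda>z. ?G (t, z)) \<in> borel_measurable borel" unfolding split_def by measurable
    show "\<bar>?G (t, z)\<bar> \<le> (C*B*B'*B'' * indicator {-S..S} t) * indicator (cbox (-S',-S'') (S',S'')) z" for z
      using b by (cases z) (auto simp: cbox_Pair_eq indicator_times mult_ac)
  qed
  \<comment> \<open>The radius of a kernel may be negative, whereas \<open>mom_bounded\<close> asks
    for a nonnegative one.\<close>
  have M: "\<bar>mom F w z\<bar> \<le> C * B'' * (2 * max 0 S'')" for z
  proof (rule mom_bounded[OF assms(1) C])
    show "kernel (max 0 S'') B'' w" using w by (auto simp: kernel_def)
  qed simp
  let ?H = "\<lambda>z. mom F w z * (p (fst z) * q (snd z))"
  have iH: "integrable lborel ?H"
  proof (rule integrable_bounded_cbox)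
    show "?H \<in> borel_measurable borel" by measurable
    have M0: "0 \<le> C * B'' * (2 * max 0 S'')" using M[of undefined] by linarith
    have "\<bar>?H (t,x)\<bar> \<le> C * B'' * (2 * max 0 S'') * (B * indicator {-S..S} t * (B' * indicator {-S'..S'} x))" for t x
      unfolding abs_mult fst_conv snd_conv using M0 by (intro mult_mono M kernel_indicator[OF p] kernel_indicator[OF q])
         (auto intro!: nn)
    then show "\<bar>?H z\<bar> \<le> (C * B'' * (2 * max 0 S'') * B * B') * indicator (cbox (-S,-S') (S,S')) z" for z
      by (cases z) (auto simp: cbox_Pair_eq indicator_times mult_ac)
  qed
  have "integral\<^sup>L lborel ?G = (\<integral>t. \<integral>z. ?G (t,z) \<partial>lborel \<partial>lborel)"
    using lborel_pair.integral_fst'[of ?G] i3 by (simp add: lborel_prod)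
  also have "\<dots> = (\<integral>t. \<integral>x. \<integral>v. ?G (t,x,v) \<partial>lborel \<partial>lborel \<partial>lborel)"
    using lborel_pair.integral_fst'[of "\<lambda>z. ?G (t,z)" for t] i2 by (simp add: lborel_prod)
  also have "\<dots> = (\<integral>t. \<integral>x. ?H (t,x) \<partial>lborel \<partial>lborel)"
  proof (intro Bochner_Integration.integral_cong refl)
    fix t x
    have "(\<integral>v. ?G (t,x,v) \<partial>lborel) = (\<integral>v. p t * q x * (F (t,x,v) * w v) \<partial>lborel)"
      by (intro Bochner_Integration.integral_cong) (auto simp: mult_ac)
    then show "(\<integral>v. ?G (t,x,v) \<partial>lborel) = ?H (t,x)" by (simp add: mom_def)
  qed
  also have "\<dots> = integral\<^sup>L lborel ?H" using lborel_pair.integral_fst'[of ?H] iH by (simp add: lborel_prod)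
  finally show "integral\<^sup>L lborel ?G = integral\<^sup>L lborel ?H" .
qed

lemma kernel_reflect_shift:
  assumes "kernel S B p" shows "kernel (\<bar>t\<bar> + S) B (\<lambda>s. p (t - s))"
proof -
  have "continuous_on UNIV (\<lambda>s. p (t - s))"
    using assms by (auto simp: kernel_def intro!: continuous_on_compose2[of UNIV p] continuous_intros)
  moreover have "p (t - s) = 0" if "\<bar>t\<bar> + S < \<bar>s\<bar>" for s using kernel_zero[OF assms, of "t - s"] that by linarith
  ultimately show ?thesis using kernel_le[OF assms] by (simp add: kernel_def)
qed

lemma kernel_uminus: "kernel S B p \<Longrightarrow> kernel S B (\<lambda>s. - p s)"
  by (auto simp: kernel_def intro: continuous_intros)

section \<open>Radon measures on the half-space and the mollified source\<close>

lemma radon_measurable: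
  assumes "radon_on_Dom3 M" "f \<in> borel_measurable borel" shows "f \<in> borel_measurable M"
  using assms measurable_restrict_space1 by (auto simp: radon_on_Dom3_def cong: measurable_cong_sets)

lemma radon_compact_sets:
  assumes M: "radon_on_Dom3 M" and K: "compact K" "K \<subseteq> Dom3" shows "K \<in> sets M"
proof -
  have "open Dom3" unfolding Dom3_def by (intro open_Times) auto
  then have "K \<in> sets (restrict_space borel Dom3)" using K by (subst sets_restrict_space_iff) (auto intro: borel_compact)
  then show ?thesis using M by (simp add: radon_on_Dom3_def)
qed

lemma radon_sigma_finite:
  assumes M: "radon_on_Dom3 M" shows "sigma_finite_measure M"
proof
  have sp: "space M = Dom3" using M by (auto simp: radon_on_Dom3_def space_restrict_space dest!: sets_eq_imp_space_eq)
  \<comment> \<open>An exhaustion by compact boxes; the lower edge 1 / (n + 1) keeps them away from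
    t = 0, where the measure may be infinite.\<close>
  define K :: "nat \<Rightarrow> (real \<times> real \<times> real) set" where "K n = cbox (1 / Suc n, - real n, - real n) (real n, real n, real n)" for n
  have K: "K n \<subseteq> Dom3" for n
  proof -
    have "0 < 1 / real (Suc n)" by simp
    then have "0 < t" if "1 / real (Suc n) \<le> t" for t using that by linarith
    then show ?thesis by (auto simp: K_def Dom3_def cbox_Pair_eq simp del: of_nat_Suc)
  qed
  have "K n \<in> sets M" for n using radon_compact_sets[OF M _ K[of n]] by (simp add: K_def)
  moreover have "emeasure M (K n) \<noteq> \<infinity>" for n
    using M K[of n] unfolding radon_on_Dom3_def K_def by (metis compact_cbox less_irrefl infinity_ennreal_def)
  moreover have "(\<Union>n. K n) = Dom3"
  proof
    show "Dom3 \<subseteq> (\<Union>n. K n)"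
    proof
      fix p assume p: "p \<in> Dom3"
      obtain t x v where tv: "p = (t,x,v)" by (cases p)
      have t: "0 < t" using p tv by (simp add: Dom3_def)
      obtain n1 where n1: "1 / real (Suc n1) < t" using t nat_approx_posE by blast
      obtain n2 :: nat where n2: "max \<bar>t\<bar> (max \<bar>x\<bar> \<bar>v\<bar>) \<le> n2" using real_arch_simple by blast
      define n where "n = max n1 n2"
      have "1 / real (Suc n) \<le> 1 / real (Suc n1)" by (auto simp: n_def intro!: divide_left_mono)
      moreover have "real n2 \<le> real n" by (simp add: n_def)
      ultimately have "p \<in> K n" using n1 n2 by (auto simp: K_def tv cbox_Pair_eq simp del: of_nat_Suc)
      then show "p \<in> (\<Union>n. K n)" by blast
    qed
  qed (use K in auto)
  ultimately show "\<exists>A. countable A \<and> A \<subseteq> sets M \<and> \<Union> A = space M \<and> (\<forall>a\<in>A. emeasure M a \<noteq> \<infinity>)"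
    using sp by (intro exI[of _ "range K"]) auto
qed

text \<open>The L^1 norm on R of \<partial>t u + \<partial>x b after mollification by k in both
  variables, with the derivatives moved onto the kernel.\<close>

abbreviation source_mass :: "(real \<times> real \<Rightarrow> real) \<Rightarrow> (real \<times> real \<Rightarrow> real) \<Rightarrow> (real \<Rightarrow> real) \<Rightarrow> (real \<times> real) set \<Rightarrow> ennreal" where
  "source_mass u b k R \<equiv> (\<integral>\<^sup>+z. ennreal \<bar>cv u (deriv k) k (fst z) (snd z) + cv b k (deriv k) (fst z) (snd z)\<bar>
      * indicator R z \<partial>lborel)"

text \<open>The density at (t, x) obtained by weighting M with |g(v)|, projecting out v and
  mollifying.\<close>

abbreviation smear :: "(real \<Rightarrow> real) \<Rightarrow> (real \<Rightarrow> real) \<Rightarrow> real \<Rightarrow> real \<Rightarrow> (real \<times> real \<times> real) measure \<Rightarrow> ennreal" where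
  "smear g k t x M \<equiv> (\<integral>\<^sup>+p. ennreal \<bar>g (snd (snd p))\<bar> * ennreal (k (t - fst p) * k (x - fst (snd p))) \<partial>M)"

text \<open>The total mass of a mollified measure on a box is at most the mass on the box enlarged
  by r0. Together with the support of g in v this enlarged box is compact, and r0 < t1 keeps it in t
  > 0, so its measure is finite and independent of the kernel.\<close>

lemma smear_radon_bound:
  assumes M: "radon_on_Dom3 M" and g: "kernel S B g" and S: "0 \<le> S" and r0: "r0 < t1"
  obtains N where "N \<ge> 0" "\<And>r k. r \<le> r0 \<Longrightarrow> mollifier r k \<Longrightarrow>
     (\<integral>\<^sup>+z. smear g k (fst z) (snd z) M
        * indicator (cbox (t1,x1) (t2,x2)) z \<partial>lborel) \<le> ennreal N"
proof -
  define K where "K = cbox (t1 - r0, x1 - r0, -S) (t2 + r0, x2 + r0, S)"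
  have KD: "K \<subseteq> Dom3" using r0 by (auto simp: K_def Dom3_def cbox_Pair_eq)
  have Ks: "K \<in> sets M" using radon_compact_sets[OF M _ KD] by (simp add: K_def)
  have fin: "emeasure M K < \<infinity>" using M KD compact_cbox by (simp add: radon_on_Dom3_def K_def)
  have B0: "0 \<le> B" using kernel_le[OF g, of 0] by linarith
  note [measurable] = kernel_measurable[OF g]
  have [measurable]: "fst \<in> borel_measurable M" "(\<lambda>p. fst (snd p)) \<in> borel_measurable M" "(\<lambda>p. g (snd (snd p))) \<in> borel_measurable M"
    by (intro radon_measurable[OF M]; measurable)+
  define N where "N = B * measure M K"
  have N: "ennreal N = ennreal B * emeasure M K"
  proof -
    have "emeasure M K \<noteq> top" using fin by auto
    then show ?thesis using B0 by (simp add: N_def ennreal_mult emeasure_eq_ennreal_measure)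
  qed
  show thesis
  proof (rule that)
    show "0 \<le> N" using B0 by (simp add: N_def)
    fix r k assume r: "r \<le> r0" and k: "mollifier r k"
    have "(\<integral>\<^sup>+z. smear g k (fst z) (snd z) M
        * indicator (cbox (t1,x1) (t2,x2)) z \<partial>lborel)
       \<le> (\<integral>\<^sup>+p. ennreal \<bar>g (snd (snd p))\<bar> * indicator {p. t1 - r \<le> fst p \<and> fst p \<le> t2 + r \<and> x1 - r \<le> fst (snd p) \<and> fst (snd p) \<le> x2 + r} p \<partial>M)"
      by (intro nn_integral_mollified_le radon_sigma_finite[OF M] k) auto
    also have "\<dots> \<le> (\<integral>\<^sup>+p. ennreal B * indicator K p \<partial>M)"
    proof (intro nn_integral_mono)
      fix p
      show "ennreal \<bar>g (snd (snd p))\<bar> * indicator {p. t1 - r \<le> fst p \<and> fst p \<le> t2 + r \<and> x1 - r \<le> fst (snd p) \<and> fst (snd p) \<le> x2 + r} p \<le> ennreal B * indicator K p"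
        (is "?a * indicator ?J p \<le> _")
      proof (cases "p \<in> ?J \<and> g (snd (snd p)) \<noteq> 0")
        case True
        obtain t x v where p: "p = (t,x,v)" by (cases p)
        have "\<bar>v\<bar> \<le> S" using True kernel_zero[OF g, of v] by (simp add: p)
        then have "p \<in> K" using True r by (auto simp: K_def cbox_Pair_eq p)
        then show ?thesis using True kernel_le[OF g, of v] by (simp add: p ennreal_leI)
      next
        case False then show ?thesis by (cases "p \<in> ?J") simp_all
      qed
    qed
    also have "\<dots> = ennreal N" unfolding N by (rule nn_integral_cmult_indicator[OF Ks])
    finally show "(\<integral>\<^sup>+z. smear g k (fst z) (snd z) M
        * indicator (cbox (t1,x1) (t2,x2)) z \<partial>lborel) \<le> ennreal N" .
  qed
qed

text \<open>The signed measure enters as a difference of two positive Radon measures. Either may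
  have infinite total mass, so the subtraction takes place between integrals against test
  functions.\<close>

definition kinetic_eq :: "(real \<Rightarrow> real) \<Rightarrow> nat \<Rightarrow> (real \<times> real \<times> real) measure \<Rightarrow> (real \<times> real \<times> real) measure
    \<Rightarrow> (real \<times> real \<times> real \<Rightarrow> real) \<Rightarrow> bool" where
  "kinetic_eq a' \<gamma> mp mn F \<longleftrightarrow> (\<forall>\<phi>. test_fun3 Dom3 \<phi> \<longrightarrow>
        - (\<integral>p. F p * (pdiff3 0 \<phi> p + a' (snd (snd p)) * pdiff3 1 \<phi> p) \<partial>lborel)
        = (-1) ^ \<gamma> * ((\<integral>p. iter_pdiff3 (replicate \<gamma> 2) \<phi> p \<partial>mp)
                        - (\<integral>p. iter_pdiff3 (replicate \<gamma> 2) \<phi> p \<partial>mn)))"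

lemma ennreal_abs_integral_le:
  fixes f :: "'a \<Rightarrow> real"
  shows "ennreal \<bar>integral\<^sup>L M f\<bar> \<le> (\<integral>\<^sup>+x. ennreal \<bar>f x\<bar> \<partial>M)"
  using integral_norm_bound_ennreal[of M f] by (cases "integrable M f") (auto simp: not_integrable_integral_eq)

lemma kernel_mult:
  assumes w: "kernel S B w" and c: "continuous_on UNIV c"
  obtains B' where "kernel S B' (\<lambda>v. c v * w v)"
proof (rule kernelI)
  show "continuous_on UNIV (\<lambda>v. c v * w v)" using w c by (auto simp: kernel_def intro: continuous_intros)
  show "S < \<bar>s\<bar> \<Longrightarrow> c s * w s = 0" for s using w by (simp add: kernel_def)
qed (rule that)

text \<open>The equation is tested with (s, y, v) \<mapsto> k(t - s) k(x - y) \<omega>(v), whose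
  support lies in positive times because r < t. Reflecting the kernel changes the sign of its
  derivative, which cancels the minus sign of the weak formulation. All \<gamma> derivatives in v
  fall on \<omega>, so the source stays a measure in (t, x).\<close>

lemma mollified_source:
  assumes [measurable]: "F \<in> borel_measurable borel" and C: "\<And>p. \<bar>F p\<bar> \<le> C"
    and kin: "kinetic_eq a' \<gamma> mp mn F" and a': "continuous_on UNIV a'"
    and \<omega>: "smooth1 \<omega>" "\<And>v. S < \<bar>v\<bar> \<Longrightarrow> \<omega> v = 0"
    and k: "mollifier r k" "smooth1 k" and r: "r < t"
  shows "ennreal \<bar>cv (mom F \<omega>) (deriv k) k t x + cv (mom F (\<lambda>v. a' v * \<omega> v)) k (deriv k) t x\<bar>
    \<le> smear ((deriv ^^ \<gamma>) \<omega>) k t x mp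
     + smear ((deriv ^^ \<gamma>) \<omega>) k t x mn"
proof -
  obtain B where B: "kernel S B \<omega>" using smooth1_kernel[OF \<omega>, where k=0] by auto
  obtain Ba where Ba: "kernel S Ba (\<lambda>v. a' v * \<omega> v)" using kernel_mult[OF B a'] .
  obtain B0 where B0: "kernel r B0 k" using mollifier_kernel[OF k(1)] .
  obtain B1 where B1: "kernel r B1 (deriv k)" using smooth1_kernel[OF k(2) mollifierD(3)[OF k(1)], where k=1] by auto
  define \<theta> where "\<theta> s = k (t - s)" for s
  define \<eta> where "\<eta> s = k (x - s)" for s
  have sm: "smooth1 \<theta>" "smooth1 \<eta>" unfolding \<theta>_def \<eta>_def by (intro smooth1_reflect k)+
  have d\<theta>: "deriv \<theta> = (\<lambda>s. - deriv k (t - s))" and d\<eta>: "deriv \<eta> = (\<lambda>s. - deriv k (x - s))"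
    unfolding \<theta>_def \<eta>_def by (intro ext deriv_reflect k)+
  define \<phi> where "\<phi> = (\<lambda>(t,x,v). \<theta> t * \<eta> x * \<omega> v)"
  let ?J = "\<lambda>M. \<integral>p. iter_pdiff3 (replicate \<gamma> 2) \<phi> p \<partial>M"
  have "test_fun3 Dom3 \<phi>" unfolding \<phi>_def
  proof (rule test_fun3_product[OF sm \<omega>(1), where c="t-r" and d="t+r" and c'="x-r" and d'="x+r" and c''="-S" and d''=S])
    show "\<theta> s \<noteq> 0 \<Longrightarrow> t - r \<le> s \<and> s \<le> t + r" "\<eta> s \<noteq> 0 \<Longrightarrow> x - r \<le> s \<and> s \<le> x + r" for s
      using kernel_zero[OF B0, of "t - s"] kernel_zero[OF B0, of "x - s"] by (auto simp: \<theta>_def \<eta>_def)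
    show "\<omega> v \<noteq> 0 \<Longrightarrow> - S \<le> v \<and> v \<le> S" for v using kernel_zero[OF B, of v] by auto
  qed (use r in simp)
  then have eq: "- (\<integral>p. F p * (pdiff3 0 \<phi> p + a' (snd (snd p)) * pdiff3 1 \<phi> p) \<partial>lborel)
        = (-1) ^ \<gamma> * (?J mp - ?J mn)"
    using kin by (simp add: kinetic_eq_def)
  note pd = pdiff3_product[OF sm \<omega>(1), folded \<phi>_def]
  note kt = kernel_reflect_shift[OF B0, of t, folded \<theta>_def] and kx = kernel_reflect_shift[OF B0, of x, folded \<eta>_def]
    and kt' = kernel_uminus[OF kernel_reflect_shift[OF B1, of t], folded d\<theta>] and kx' = kernel_uminus[OF kernel_reflect_shift[OF B1, of x], folded d\<eta>]
  note f1 = integral_product_kernel_mom[OF assms(1) C kt' kx B] and f2 = integral_product_kernel_mom[OF assms(1) C kt kx' Ba]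
  have "(\<integral>p. F p * (pdiff3 0 \<phi> p + a' (snd (snd p)) * pdiff3 1 \<phi> p) \<partial>lborel)
     = (\<integral>P. F P * (case P of (t,x,v) \<Rightarrow> deriv \<theta> t * \<eta> x * \<omega> v) + F P * (case P of (t,x,v) \<Rightarrow> \<theta> t * deriv \<eta> x * (a' v * \<omega> v)) \<partial>lborel)"
    by (intro Bochner_Integration.integral_cong refl) (auto simp: pd(1) pd(2)[unfolded One_nat_def] algebra_simps)
  also have "\<dots> = (\<integral>z. mom F \<omega> z * (deriv \<theta> (fst z) * \<eta> (snd z)) \<partial>lborel) + (\<integral>z. mom F (\<lambda>v. a' v * \<omega> v) z * (\<theta> (fst z) * deriv \<eta> (snd z)) \<partial>lborel)"
    by (simp add: Bochner_Integration.integral_add[OF f1(2) f2(2)] f1(1) f2(1))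
  also have "\<dots> = - (cv (mom F \<omega>) (deriv k) k t x + cv (mom F (\<lambda>v. a' v * \<omega> v)) k (deriv k) t x)"
    by (simp add: cv_def d\<theta> d\<eta> \<theta>_def \<eta>_def)
  finally have m: "cv (mom F \<omega>) (deriv k) k t x + cv (mom F (\<lambda>v. a' v * \<omega> v)) k (deriv k) t x
      = (-1) ^ \<gamma> * (?J mp - ?J mn)" (is "?m = _")
    using eq by simp
  have J: "ennreal \<bar>?J M\<bar>
       \<le> smear ((deriv ^^ \<gamma>) \<omega>) k t x M" for M
  proof -
    have "ennreal \<bar>?J M\<bar> \<le> (\<integral>\<^sup>+p. ennreal \<bar>iter_pdiff3 (replicate \<gamma> 2) \<phi> p\<bar> \<partial>M)"
      by (rule ennreal_abs_integral_le)
    also have "\<dots> = smear ((deriv ^^ \<gamma>) \<omega>) k t x M"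
      by (intro nn_integral_cong) (auto simp: pd \<theta>_def \<eta>_def abs_mult mollifierD(2)[OF k(1)] mult.commute simp flip: ennreal_mult)
    finally show ?thesis .
  qed
  have "\<bar>?m\<bar> \<le> \<bar>?J mp\<bar> + \<bar>?J mn\<bar>" unfolding m by (simp add: abs_mult power_abs)
  then have "ennreal \<bar>?m\<bar> \<le> ennreal \<bar>?J mp\<bar> + ennreal \<bar>?J mn\<bar>" by (simp flip: ennreal_plus)
  also have "\<dots> \<le> smear ((deriv ^^ \<gamma>) \<omega>) k t x mp
     + smear ((deriv ^^ \<gamma>) \<omega>) k t x mn"
    by (intro add_mono J)
  finally show ?thesis .
qed

text \<open>The point is that N depends on neither r nor k, so that the bound is still there when
  the radius tends to zero.\<close>

lemma source_mass_bound:
  assumes F: "F \<in> borel_measurable borel" "\<And>p. \<bar>F p\<bar> \<le> C"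
    and kin: "kinetic_eq a' \<gamma> mp mn F" and a': "continuous_on UNIV a'"
    and mp: "radon_on_Dom3 mp" and mn: "radon_on_Dom3 mn"
    and \<omega>: "smooth1 \<omega>" "\<And>v. S < \<bar>v\<bar> \<Longrightarrow> \<omega> v = 0" "0 \<le> S" and r0: "r0 < t1"
  obtains N where "N \<ge> 0" "\<And>r k. r \<le> r0 \<Longrightarrow> mollifier r k \<Longrightarrow> smooth1 k \<Longrightarrow>
    source_mass (mom F \<omega>) (mom F (\<lambda>v. a' v * \<omega> v)) k (cbox (t1,x1) (t2,x2)) \<le> ennreal N"
proof -
  obtain B where B: "kernel S B ((deriv ^^ \<gamma>) \<omega>)" using smooth1_kernel[OF \<omega>(1,2), where k=\<gamma>] by auto
  obtain N1 where N1: "N1 \<ge> 0" "\<And>r k. r \<le> r0 \<Longrightarrow> mollifier r k \<Longrightarrow>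
     (\<integral>\<^sup>+z. smear ((deriv ^^ \<gamma>) \<omega>) k (fst z) (snd z) mp
        * indicator (cbox (t1,x1) (t2,x2)) z \<partial>lborel) \<le> ennreal N1"
    by (rule smear_radon_bound[OF mp B \<omega>(3) r0]) (rule that)
  obtain N2 where N2: "N2 \<ge> 0" "\<And>r k. r \<le> r0 \<Longrightarrow> mollifier r k \<Longrightarrow>
     (\<integral>\<^sup>+z. smear ((deriv ^^ \<gamma>) \<omega>) k (fst z) (snd z) mn
        * indicator (cbox (t1,x1) (t2,x2)) z \<partial>lborel) \<le> ennreal N2"
    by (rule smear_radon_bound[OF mn B \<omega>(3) r0]) (rule that)
  show thesis
  proof (rule that)
    show "0 \<le> N1 + N2" using N1 N2 by simp
    fix r k assume r: "r \<le> r0" and k: "mollifier r k" "smooth1 k"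
    let ?I = "\<lambda>M z. smear ((deriv ^^ \<gamma>) \<omega>) k (fst z) (snd z) M * indicator (cbox (t1,x1) (t2,x2)) z"
    have me: "(\<lambda>z. ?I M z) \<in> borel_measurable borel" if M: "radon_on_Dom3 M" for M
    proof -
      interpret sigma_finite_measure M by (rule radon_sigma_finite[OF M])
      note [measurable] = kernel_measurable[OF B] mollifierD(4)[OF k(1)]
      have m1: "fst \<in> borel_measurable M" and m2: "(\<lambda>p. fst (snd p)) \<in> borel_measurable M"
        and m3: "(\<lambda>p. (deriv ^^ \<gamma>) \<omega> (snd (snd p))) \<in> borel_measurable M"
        by (intro radon_measurable[OF M]; measurable)+
      note [measurable] = measurable_compose[OF measurable_snd m1, of borel] measurable_compose[OF measurable_snd m2, of borel]
        measurable_compose[OF measurable_snd m3, of borel]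
      have [measurable]: "(\<lambda>x. fst (fst x)) \<in> borel_measurable ((borel :: (real \<times> real) measure) \<Otimes>\<^sub>M M)"
        "(\<lambda>x. snd (fst x)) \<in> borel_measurable ((borel :: (real \<times> real) measure) \<Otimes>\<^sub>M M)"
        by measurable
      show ?thesis by (simp add: split_def)
    qed
    have "source_mass (mom F \<omega>) (mom F (\<lambda>v. a' v * \<omega> v)) k (cbox (t1,x1) (t2,x2)) \<le> (\<integral>\<^sup>+z. ?I mp z + ?I mn z \<partial>lborel)"
    proof (intro nn_integral_mono)
      fix z
      have "r < fst z" if "z \<in> cbox (t1,x1) (t2,x2)" using that r r0 by (cases z) (auto simp: cbox_Pair_eq)
      then show "ennreal \<bar>cv (mom F \<omega>) (deriv k) k (fst z) (snd z) + cv (mom F (\<lambda>v. a' v * \<omega> v)) k (deriv k) (fst z) (snd z)\<bar>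
      * indicator (cbox (t1,x1) (t2,x2)) z \<le> ?I mp z + ?I mn z"
        using mollified_source[OF F kin a' \<omega>(1,2) k, where t="fst z" and x="snd z"] by (auto simp: indicator_def)
    qed
    also have "\<dots> = (\<integral>\<^sup>+z. ?I mp z \<partial>lborel) + (\<integral>\<^sup>+z. ?I mn z \<partial>lborel)"
      using me[OF mp] me[OF mn] by (intro nn_integral_add) simp_all
    also have "\<dots> \<le> ennreal N1 + ennreal N2" by (intro add_mono N1(2)[OF r k(1)] N2(2)[OF r k(1)])
    finally show "source_mass (mom F \<omega>) (mom F (\<lambda>v. a' v * \<omega> v)) k (cbox (t1,x1) (t2,x2)) \<le> ennreal (N1 + N2)" using N1 N2 by simp
  qed
qed

section \<open>The div-curl estimate for bounded measurable functions\<close>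

lemma continuous_set_integral:
  fixes g :: "'a::euclidean_space \<Rightarrow> real"
  assumes "continuous_on UNIV g"
  shows "integrable lborel (\<lambda>z. indicator (cbox a b) z * g z)"
    and "(\<integral>z. indicator (cbox a b) z * g z \<partial>lborel) = integral (cbox a b) g"
proof -
  have "set_integrable lborel (cbox a b) g" unfolding set_integrable_def
    using borel_integrable_compact[of "cbox a b" g] continuous_on_subset[OF assms] by (auto simp: indicator_def if_distrib cong: if_cong)
  then show "integrable lborel (\<lambda>z. indicator (cbox a b) z * g z)" "(\<integral>z. indicator (cbox a b) z * g z \<partial>lborel) = integral (cbox a b) g"
    using set_borel_integral_eq_integral[of "cbox a b" g] by (auto simp: set_integrable_def set_lebesgue_integral_def)
qed

lemma integral_cbox_le_nn_integral:
  fixes g :: "'a::euclidean_space \<Rightarrow> real"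
  assumes g: "continuous_on UNIV g" "\<And>z. 0 \<le> g z" and sub: "cbox a b \<subseteq> R"
    and N: "(\<integral>\<^sup>+z. ennreal (g z) * indicator R z \<partial>lborel) \<le> ennreal N" "0 \<le> N"
  shows "integral (cbox a b) g \<le> N"
proof -
  have "ennreal (integral (cbox a b) g) = (\<integral>\<^sup>+z. ennreal (indicator (cbox a b) z * g z) \<partial>lborel)"
    unfolding continuous_set_integral(2)[OF g(1), symmetric]
    by (intro nn_integral_eq_integral[symmetric] continuous_set_integral(1)[OF g(1)]) (auto simp: g)
  also have "\<dots> \<le> (\<integral>\<^sup>+z. ennreal (g z) * indicator R z \<partial>lborel)"
    using sub by (intro nn_integral_mono) (auto simp: indicator_def)
  also have "\<dots> \<le> ennreal N" by fact
  finally show ?thesis using N(2) by simp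
qed

lemma nn_integral_lborel_translate:
  fixes g :: "'a::euclidean_space \<Rightarrow> ennreal"
  assumes [measurable]: "g \<in> borel_measurable borel"
  shows "(\<integral>\<^sup>+z. g (z + h) \<partial>lborel) = (\<integral>\<^sup>+z. g z \<partial>lborel)"
proof -
  have "(\<integral>\<^sup>+z. g z \<partial>lborel) = (\<integral>\<^sup>+z. g z \<partial>(distr lborel borel ((+) h)))" by (simp add: lborel_distr_plus)
  also have "\<dots> = (\<integral>\<^sup>+z. g (h + z) \<partial>lborel)" by (intro nn_integral_distr) auto
  finally show ?thesis by (simp add: add.commute)
qed

definition incr :: "real \<times> real \<Rightarrow> (real \<times> real \<Rightarrow> real) \<Rightarrow> real \<times> real \<Rightarrow> real" where
  "incr h g z = g (z + h) - g z"

definition wronski :: "(nat \<Rightarrow> real \<times> real \<Rightarrow> real) \<Rightarrow> (nat \<Rightarrow> real \<times> real \<Rightarrow> real) \<Rightarrow> real \<times> real \<Rightarrow> real \<times> real \<Rightarrow> real" where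
  "wronski u b h z = incr h (u 0) z * incr h (b 1) z - incr h (u 1) z * incr h (b 0) z"

text \<open>A cutoff that is positive inside the interval and zero at its ends. The div-curl
  estimate integrates by parts on a rectangle and asks for nothing beyond continuous
  differentiability and these zeros, so a quadratic can replace a bump function.\<close>

definition hat :: "real \<Rightarrow> real \<Rightarrow> real \<Rightarrow> real" where
  "hat a b s = (s - a) * (b - s)"

lemma hat_derivative: "(hat a b has_real_derivative (a + b - 2 * s)) (at s)"
  unfolding hat_def[abs_def] by (auto intro!: derivative_eq_intros)

lemma hat_continuous: "continuous_on A (hat a b)"
  unfolding hat_def[abs_def] by (intro continuous_intros)

abbreviation hat_le :: "real \<Rightarrow> real \<Rightarrow> real \<Rightarrow> real \<Rightarrow> real \<Rightarrow> real \<Rightarrow> real \<Rightarrow> bool" where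
  "hat_le t1 t2 x1 x2 X t x \<equiv> \<bar>hat t1 t2 t * hat x1 x2 x\<bar> \<le> X \<and> \<bar>(t1 + t2 - 2 * t) * hat x1 x2 x\<bar> \<le> X
     \<and> \<bar>hat t1 t2 t * (x1 + x2 - 2 * x)\<bar> \<le> X"

lemma hat_bound:
  obtains X where "X \<ge> 0" "\<And>t x. t \<in> {t1..t2} \<Longrightarrow> x \<in> {x1..x2} \<Longrightarrow>
     hat_le t1 t2 x1 x2 X t x"
proof -
  let ?f = "\<lambda>z. \<bar>hat t1 t2 (fst z) * hat x1 x2 (snd z)\<bar> + \<bar>(t1 + t2 - 2 * fst z) * hat x1 x2 (snd z)\<bar> + \<bar>hat t1 t2 (fst z) * (x1 + x2 - 2 * snd z)\<bar>"
  have "bounded (?f ` cbox (t1,x1) (t2,x2))"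
    by (intro compact_imp_bounded compact_continuous_image continuous_intros continuous_on_compose2[OF hat_continuous[of UNIV]]) auto
  then obtain X where X: "X > 0" "\<forall>y\<in>?f ` cbox (t1,x1) (t2,x2). norm y \<le> X" by (meson bounded_pos)
  show thesis
  proof (rule that[of X])
    fix t x assume "t \<in> {t1..t2}" "x \<in> {x1..x2}"
    then have "norm (?f (t,x)) \<le> X" using X(2) by (intro bspec[OF X(2)] imageI) (auto simp: cbox_Pair_eq)
    then show "hat_le t1 t2 x1 x2 X t x" unfolding real_norm_def fst_conv snd_conv by (intro conjI; linarith)
  qed (use X in simp)
qed

abbreviation mollified :: "(real \<Rightarrow> real) \<Rightarrow> (nat \<Rightarrow> real \<times> real \<Rightarrow> real) \<Rightarrow> nat \<Rightarrow> real \<times> real \<Rightarrow> real" where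
  "mollified k u \<equiv> \<lambda>i z. cv (u i) k k (fst z) (snd z)"

text \<open>For a shift in x this is \<open>compensated_increment_bound\<close> as it stands. A
  shift in t reduces to it by the symmetry of \<partial>t u + \<partial>x b under the exchange of
  (t, u) with (x, b), which only changes the sign of the determinant. Hence the source is controlled
  on a rectangle longer by 1 in both directions.\<close>

lemma mollified_wronski_bound:
  assumes u [measurable]: "\<And>i. u i \<in> borel_measurable borel" and b [measurable]: "\<And>i. b i \<in> borel_measurable borel"
    and bu: "\<And>i z. \<bar>u i z\<bar> \<le> U" and bb: "\<And>i z. \<bar>b i z\<bar> \<le> U"
    and tx: "t1 \<le> t2" "x1 \<le> x2" and N0: "0 \<le> N" and k: "mollifier r k" "smooth1 k"
    and N: "\<And>i. source_mass (u i) (b i) k (cbox (t1,x1) (t2+1,x2+1)) \<le> ennreal N"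
    and X: "\<And>t x. t \<in> {t1..t2} \<Longrightarrow> x \<in> {x1..x2} \<Longrightarrow>
     hat_le t1 t2 x1 x2 X t x"
    and \<eta>: "0 \<le> \<eta>" "\<eta> \<le> 1" and h: "h \<in> {(\<eta>,0), (0,\<eta>)}"
  shows "\<bar>\<integral>z. indicator (cbox (t1,x1) (t2,x2)) z * (hat t1 t2 (fst z) * hat x1 x2 (snd z)
            * wronski (mollified k u) (mollified k b) h z) \<partial>lborel\<bar>
     \<le> \<eta> * (5 * X * U * N + 4 * X * U\<^sup>2 * ((t2-t1)*(x2-x1)))"
proof -
  obtain B where B: "kernel r B k" using mollifier_kernel[OF k(1)] .
  obtain B' where B': "kernel r B' (deriv k)" using smooth1_kernel[OF k(2) mollifierD(3)[OF k(1)], where k=1] by auto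
  note dk = smooth1_derivative[OF k(2)]
  define m where "m i t x = \<bar>cv (u i) (deriv k) k t x + cv (b i) k (deriv k) t x\<bar>" for i t x
  have cu: "continuous_on UNIV (\<lambda>(t,x). cv (u i) k k t x)" and cb: "continuous_on UNIV (\<lambda>(t,x). cv (b i) k k t x)"
    and cut: "continuous_on UNIV (\<lambda>(t,x). cv (u i) (deriv k) k t x)" and cbx: "continuous_on UNIV (\<lambda>(t,x). cv (b i) k (deriv k) t x)" for i
    by (rule cv_continuous[OF u bu] cv_continuous[OF b bb]; fact B B')+
  have dut: "((\<lambda>t. cv (u i) k k t x) has_real_derivative cv (u i) (deriv k) k t x) (at t)"
    and dbx: "(cv (b i) k k t has_real_derivative cv (b i) k (deriv k) t x) (at x)" for i t x
    by (rule cv_derivative_fst[OF u bu B B B' dk] cv_derivative_snd[OF b bb B B B' dk])+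
  have cm: "continuous_on UNIV (\<lambda>(t,x). m i t x)" for i
    using continuous_on_rabs[OF continuous_on_add[OF cut[of i] cbx[of i]]] by (simp add: m_def split_def)
  have swap: "continuous_on UNIV (\<lambda>(x,t). F t x)" if "continuous_on UNIV (\<lambda>(t,x). F t x)" for F :: "real \<Rightarrow> real \<Rightarrow> real"
    unfolding split_def by (intro continuous_compose2[OF that] continuous_intros)
  have N1: "integral {t1..t2} (\<lambda>t. integral {x1..x2+1} (m i t)) \<le> N" for i unfolding iterated_integral_cbox[OF cm]
    by (rule integral_cbox_le_nn_integral[OF cm _ _ _ N0, where R="cbox (t1,x1) (t2+1,x2+1)"])
       (use N[of i] in \<open>auto simp: m_def split_def cbox_Pair_eq\<close>)
  have N2: "integral {x1..x2} (\<lambda>x. integral {t1..t2+1} (\<lambda>t. m i t x)) \<le> N" for i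
    unfolding iterated_integral_swap[OF cm, symmetric] iterated_integral_cbox[OF cm]
    by (rule integral_cbox_le_nn_integral[OF cm _ _ _ N0, where R="cbox (t1,x1) (t2+1,x2+1)"])
       (use N[of i] in \<open>auto simp: m_def split_def cbox_Pair_eq\<close>)
  define Q where "Q t x = hat t1 t2 t * hat x1 x2 x * wronski (mollified k u) (mollified k b) h (t,x)" for t x
  have cQ: "continuous_on UNIV (\<lambda>(t,x). Q t x)" unfolding Q_def wronski_def incr_def split_def
    by (intro continuous_intros continuous_compose2[OF cu] continuous_compose2[OF cb] continuous_on_compose2[OF hat_continuous[of UNIV]]) auto
  have eq: "(\<integral>z. indicator (cbox (t1,x1) (t2,x2)) z * (hat t1 t2 (fst z) * hat x1 x2 (snd z)
            * wronski (mollified k u) (mollified k b) h z) \<partial>lborel)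
        = integral {t1..t2} (\<lambda>t. integral {x1..x2} (Q t))"
    using continuous_set_integral(2)[OF cQ, of "(t1,x1)" "(t2,x2)"] by (simp add: iterated_integral_cbox[OF cQ] Q_def split_def)
  have hd: "continuous_on UNIV (\<lambda>s. a + b - 2 * s)" for a b :: real by (intro continuous_intros)
  have hz: "hat a b a = 0" "hat a b b = 0" for a b by (simp_all add: hat_def)
  note au = abs_cv_le[OF u bu k(1)] and ab = abs_cv_le[OF b bb k(1)]
  have h': "h = (0, \<eta>) \<or> h = (\<eta>, 0)" using h by auto
  then show ?thesis unfolding eq
  proof
    assume h: "h = (0, \<eta>)"
    have Q: "Q t x = hat t1 t2 t * hat x1 x2 x *
       ((cv (u 0) k k t (x+\<eta>) - cv (u 0) k k t x) * (cv (b 1) k k t (x+\<eta>) - cv (b 1) k k t x)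
      - (cv (u 1) k k t (x+\<eta>) - cv (u 1) k k t x) * (cv (b 0) k k t (x+\<eta>) - cv (b 0) k k t x))" for t x
      by (simp add: Q_def wronski_def incr_def h)
    show "\<bar>integral {t1..t2} (\<lambda>t. integral {x1..x2} (Q t))\<bar> \<le> \<eta> * (5 * X * U * N + 4 * X * U\<^sup>2 * ((t2-t1)*(x2-x1)))"
      unfolding Q
      by (rule compensated_increment_bound[of "\<lambda>i. cv (u i) k k" "\<lambda>i. cv (b i) k k" "\<lambda>i. cv (u i) (deriv k) k" "\<lambda>i. cv (b i) k (deriv k)",
          OF cu cb cut cbx dut dbx au ab tx \<eta> hat_derivative hat_derivative hd hd hz(1) hz(2) hz(1) hz(2) X N1[unfolded m_def]])
  next
    assume h: "h = (\<eta>, 0)"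
    have Q: "Q t x = - (hat x1 x2 x * hat t1 t2 t *
       ((cv (b 0) k k (t+\<eta>) x - cv (b 0) k k t x) * (cv (u 1) k k (t+\<eta>) x - cv (u 1) k k t x)
      - (cv (b 1) k k (t+\<eta>) x - cv (b 1) k k t x) * (cv (u 0) k k (t+\<eta>) x - cv (u 0) k k t x)))" for t x
      by (simp add: Q_def wronski_def incr_def h algebra_simps)
    have "\<bar>integral {x1..x2} (\<lambda>x. integral {t1..t2} (\<lambda>t. hat x1 x2 x * hat t1 t2 t *
       ((cv (b 0) k k (t+\<eta>) x - cv (b 0) k k t x) * (cv (u 1) k k (t+\<eta>) x - cv (u 1) k k t x)
      - (cv (b 1) k k (t+\<eta>) x - cv (b 1) k k t x) * (cv (u 0) k k (t+\<eta>) x - cv (u 0) k k t x))))\<bar>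
      \<le> \<eta> * (5 * X * U * N + 4 * X * U\<^sup>2 * ((x2-x1)*(t2-t1)))" (is "\<bar>?I\<bar> \<le> _")
    proof (rule compensated_increment_bound[of "\<lambda>i x t. cv (b i) k k t x" "\<lambda>i x t. cv (u i) k k t x" "\<lambda>i x t. cv (b i) k (deriv k) t x" "\<lambda>i x t. cv (u i) (deriv k) k t x",
          OF swap[OF cb] swap[OF cu] swap[OF cbx] swap[OF cut] dbx dut ab au tx(2) tx(1) \<eta> hat_derivative hat_derivative hd hd hz(1) hz(2) hz(1) hz(2)])
      show "\<bar>hat x1 x2 x * hat t1 t2 t\<bar> \<le> X \<and> \<bar>(x1 + x2 - 2 * x) * hat t1 t2 t\<bar> \<le> X \<and> \<bar>hat x1 x2 x * (t1 + t2 - 2 * t)\<bar> \<le> X"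
        if "x \<in> {x1..x2}" "t \<in> {t1..t2}" for t x using X[OF that(2,1)] by (simp add: mult.commute)
      show "integral {x1..x2} (\<lambda>x. integral {t1..t2 + 1} (\<lambda>t. \<bar>cv (b i) k (deriv k) t x + cv (u i) (deriv k) k t x\<bar>)) \<le> N" for i
        using N2[of i] by (simp add: m_def add.commute)
    qed
    also have "?I
      = - integral {t1..t2} (\<lambda>t. integral {x1..x2} (Q t))"
      unfolding iterated_integral_swap[OF cQ] by (simp add: Q)
    finally show "\<bar>integral {t1..t2} (\<lambda>t. integral {x1..x2} (Q t))\<bar> \<le> \<eta> * (5 * X * U * N + 4 * X * U\<^sup>2 * ((t2-t1)*(x2-x1)))"
      by (simp add: mult.commute)
  qed
qed

lemma incr_abs_le:
  assumes "\<And>z. \<bar>g z\<bar> \<le> U" shows "\<bar>incr h g z\<bar> \<le> 2 * U"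
  using assms[of z] assms[of "z+h"] unfolding incr_def by linarith

lemma wronski_integrable:
  assumes [measurable]: "\<And>i. u i \<in> borel_measurable borel" "\<And>i. b i \<in> borel_measurable borel"
    and bu: "\<And>i z. \<bar>u i z\<bar> \<le> U" and bb: "\<And>i z. \<bar>b i z\<bar> \<le> U"
  shows "integrable lborel (\<lambda>z. indicator (cbox (t1,x1) (t2,x2)) z * (hat t1 t2 (fst z) * hat x1 x2 (snd z) * wronski u b h z))"
proof -
  let ?R = "cbox (t1,x1) (t2,x2)"
  define ch where "ch z = hat t1 t2 (fst z) * hat x1 x2 (snd z)" for z
  obtain X where X0: "X \<ge> 0" and X: "\<And>t x. t \<in> {t1..t2} \<Longrightarrow> x \<in> {x1..x2} \<Longrightarrow>
     hat_le t1 t2 x1 x2 X t x"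
    by (rule hat_bound) (rule that)
  have U0: "0 \<le> U" using bu[of 0 "(0,0)"] by linarith
  have [measurable]: "ch \<in> borel_measurable borel"
    unfolding ch_def by (intro borel_measurable_continuous_onI continuous_intros continuous_on_compose2[OF hat_continuous[of UNIV]]) auto
  have chX: "\<bar>ch z\<bar> \<le> X" if "z \<in> ?R" for z using X[of "fst z" "snd z"] that by (cases z) (auto simp: ch_def cbox_Pair_eq)
  have wb: "\<bar>wronski u b h z\<bar> \<le> 8 * U\<^sup>2" for z
  proof -
    have "\<bar>incr h (u i) z * incr h (b j) z\<bar> \<le> (2 * U) * (2 * U)" for i j
      unfolding abs_mult by (intro mult_mono incr_abs_le bu bb) (use U0 in auto)
    from this[of 0 1] this[of 1 0] show ?thesis by (simp add: wronski_def power2_eq_square)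
  qed
  show ?thesis unfolding ch_def[symmetric]
  proof (rule integrable_bounded_cbox)
    show "(\<lambda>z. indicator ?R z * (ch z * wronski u b h z)) \<in> borel_measurable borel" unfolding wronski_def incr_def by measurable
    have "\<bar>ch z * wronski u b h z\<bar> \<le> X * (8 * U\<^sup>2)" if "z \<in> ?R" for z
      unfolding abs_mult using X0 by (intro mult_mono chX that wb) simp_all
    then show "\<bar>indicator ?R z * (ch z * wronski u b h z)\<bar> \<le> X * (8 * U\<^sup>2) * indicator ?R z" for z
      by (auto simp: indicator_def)
  qed
qed

text \<open>From a' c' - a c = (a' - a) c' + a (c' - c): in each product the sup bound handles one
  factor, so closeness in L^1 suffices for the other. An increment sees the error at both z and z +
  h.\<close>

lemma wronski_perturbation:
  assumes "\<And>i z. \<bar>u i z\<bar> \<le> U" "\<And>i z. \<bar>b i z\<bar> \<le> U" "\<And>i z. \<bar>u' i z\<bar> \<le> U" "\<And>i z. \<bar>b' i z\<bar> \<le> U"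
  defines "err \<equiv> \<lambda>z. \<bar>u' 0 z - u 0 z\<bar> + \<bar>u' 1 z - u 1 z\<bar> + \<bar>b' 0 z - b 0 z\<bar> + \<bar>b' 1 z - b 1 z\<bar>"
  shows "\<bar>wronski u' b' h z - wronski u b h z\<bar> \<le> 2 * U * (err z + err (z + h))"
proof -
  have d: "\<bar>a' * c' - a * c\<bar> \<le> 2 * U * (\<bar>a' - a\<bar> + \<bar>c' - c\<bar>)" if "\<bar>c'\<bar> \<le> 2 * U" "\<bar>a\<bar> \<le> 2 * U" for a c a' c' :: real
  proof -
    have "a' * c' - a * c = (a' - a) * c' + a * (c' - c)" by (simp add: algebra_simps)
    also have "\<bar>\<dots>\<bar> \<le> \<bar>a' - a\<bar> * \<bar>c'\<bar> + \<bar>a\<bar> * \<bar>c' - c\<bar>" by (metis abs_triangle_ineq abs_mult)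
    also have "\<dots> \<le> \<bar>a' - a\<bar> * (2 * U) + (2 * U) * \<bar>c' - c\<bar>" using that by (intro add_mono mult_mono) auto
    finally show ?thesis by (simp add: algebra_simps)
  qed
  have e: "\<bar>incr h g' z - incr h g z\<bar> \<le> \<bar>g' z - g z\<bar> + \<bar>g' (z+h) - g (z+h)\<bar>" for g g'
    unfolding incr_def by linarith
  have "\<bar>wronski u' b' h z - wronski u b h z\<bar> \<le> 2 * U * (\<bar>incr h (u' 0) z - incr h (u 0) z\<bar> + \<bar>incr h (b' 1) z - incr h (b 1) z\<bar>)
      + 2 * U * (\<bar>incr h (u' 1) z - incr h (u 1) z\<bar> + \<bar>incr h (b' 0) z - incr h (b 0) z\<bar>)"
    (is "_ \<le> ?A + ?B")
  proof -
    have 1: "\<bar>incr h (u' 0) z * incr h (b' 1) z - incr h (u 0) z * incr h (b 1) z\<bar> \<le> ?A"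
      and 2: "\<bar>incr h (u' 1) z * incr h (b' 0) z - incr h (u 1) z * incr h (b 0) z\<bar> \<le> ?B"
      by (intro d incr_abs_le assms)+
    have "wronski u' b' h z - wronski u b h z = (incr h (u' 0) z * incr h (b' 1) z - incr h (u 0) z * incr h (b 1) z)
        - (incr h (u' 1) z * incr h (b' 0) z - incr h (u 1) z * incr h (b 0) z)"
      unfolding wronski_def by simp
    then show ?thesis using order_trans[OF abs_triangle_ineq4 add_mono[OF 1 2]] by presburger
  qed
  also have "\<dots> \<le> 2 * U * (err z + err (z + h))"
    unfolding distrib_left[symmetric] err_def using e[of "u' 0" "u 0"] e[of "u' 1" "u 1"] e[of "b' 0" "b 0"] e[of "b' 1" "b 1"]
      order_trans[OF abs_ge_zero assms(1)[of 0 z]]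
    by (intro mult_left_mono) linarith+
  finally show ?thesis .
qed

text \<open>The mollified estimate holds with a constant independent of the kernel. For given \<eta>
  and h the kernel is chosen after an arbitrary tolerance e0, which is then removed.\<close>

lemma wronski_bound:
  assumes u [measurable]: "\<And>i. u i \<in> borel_measurable borel" and b [measurable]: "\<And>i. b i \<in> borel_measurable borel"
    and bu: "\<And>i z. \<bar>u i z\<bar> \<le> U" and bb: "\<And>i z. \<bar>b i z\<bar> \<le> U"
    and tx: "t1 \<le> t2" "x1 \<le> x2" and N0: "0 \<le> N" and r0: "0 < r0"
    and ex: "\<And>r. 0 < r \<Longrightarrow> \<exists>k. mollifier r k \<and> smooth1 k"
    and N: "\<And>i r k. r \<le> r0 \<Longrightarrow> mollifier r k \<Longrightarrow> smooth1 k \<Longrightarrow>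
       source_mass (u i) (b i) k (cbox (t1,x1) (t2+1,x2+1)) \<le> ennreal N"
  obtains C where "C \<ge> 0" "\<And>\<eta> h. 0 \<le> \<eta> \<Longrightarrow> \<eta> \<le> 1 \<Longrightarrow> h \<in> {(\<eta>,0), (0,\<eta>)} \<Longrightarrow>
    \<bar>\<integral>z. indicator (cbox (t1,x1) (t2,x2)) z * (hat t1 t2 (fst z) * hat x1 x2 (snd z) * wronski u b h z) \<partial>lborel\<bar> \<le> C * \<eta>"
proof -
  obtain X where X0: "X \<ge> 0" and X: "\<And>t x. t \<in> {t1..t2} \<Longrightarrow> x \<in> {x1..x2} \<Longrightarrow>
     hat_le t1 t2 x1 x2 X t x"
    by (rule hat_bound) (rule that)
  have U0: "0 \<le> U" using bu[of 0 "(0,0)"] by linarith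
  define C where "C = 5 * X * U * N + 4 * X * U\<^sup>2 * ((t2-t1)*(x2-x1))"
  have C0: "0 \<le> C" using X0 U0 N0 tx by (simp add: C_def)
  let ?R = "cbox (t1,x1) (t2,x2)" and ?R' = "cbox (t1,x1) (t2+1,x2+1)"
  have main: "\<bar>\<integral>z. indicator ?R z * (hat t1 t2 (fst z) * hat x1 x2 (snd z) * wronski u b h z) \<partial>lborel\<bar> \<le> C * \<eta>"
    if \<eta>: "0 \<le> \<eta>" "\<eta> \<le> 1" and h: "h \<in> {(\<eta>,0), (0,\<eta>)}" for \<eta> h
  proof (rule field_le_epsilon)
    fix e0 :: real assume e0: "0 < e0"
    \<comment> \<open>Four functions, each with error e, occur at two points with the factor 2 X U,
      for a total of 16 X U e; the summand 1 covers X U = 0.\<close>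
    define e where "e = e0 / (16 * (X * U) + 1)"
    have XU: "0 \<le> X * U" using X0 U0 by simp
    have e: "0 < e" "16 * (X * U) * e \<le> e0"
    proof -
      show "0 < e" using XU e0 by (simp add: e_def add_nonneg_pos)
      then have "16 * (X * U) * e \<le> (16 * (X * U) + 1) * e" by simp
      also have "\<dots> = e0" using XU by (simp add: e_def add_nonneg_eq_0_iff)
      finally show "16 * (X * U) * e \<le> e0" .
    qed
    let ?S = "{u 0, u 1, b 0, b 1}"
    let ?P = "\<lambda>w \<delta>. 0 < \<delta> \<and> (\<forall>r k. r \<le> \<delta> \<longrightarrow> mollifier r k \<longrightarrow> mollify_err w k ?R' \<le> ennreal e)"
    have "\<forall>w\<in>?S. \<exists>\<delta>. ?P w \<delta>"
    proof
      fix w assume "w \<in> ?S"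
      then have "w \<in> borel_measurable borel" "\<And>z. \<bar>w z\<bar> \<le> U" using u b bu bb by auto
      from cv_mollify_L1[OF this e(1)] show "\<exists>\<delta>. ?P w \<delta>" .
    qed
    from bchoice[OF this] obtain \<delta> where \<delta>': "\<forall>w\<in>?S. ?P w (\<delta> w)" by blast
    have \<delta>: "\<And>w. w \<in> ?S \<Longrightarrow> \<delta> w > 0"
       "\<And>w r k. w \<in> ?S \<Longrightarrow> r \<le> \<delta> w \<Longrightarrow> mollifier r k \<Longrightarrow> mollify_err w k ?R' \<le> ennreal e"
      using \<delta>' by blast+
    \<comment> \<open>One radius small enough for all four functions and for the source bound at the
      same time.\<close>
    define r where "r = Min (insert r0 (\<delta> ` ?S))"
    have r: "0 < r" "r \<le> r0"
      unfolding r_def using \<delta>(1)[of "u 0"] \<delta>(1)[of "u 1"] \<delta>(1)[of "b 0"] \<delta>(1)[of "b 1"] r0 by (simp_all add: min_def)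
    have rw: "r \<le> \<delta> w" if "w \<in> ?S" for w unfolding r_def using that by (intro Min_le) blast+
    obtain k where k: "mollifier r k" "smooth1 k" using ex[OF r(1)] by blast
    define u' where "u' i z = cv (u i) k k (fst z) (snd z)" for i z
    define b' where "b' i z = cv (b i) k k (fst z) (snd z)" for i z
    define err where "err z = \<bar>u' 0 z - u 0 z\<bar> + \<bar>u' 1 z - u 1 z\<bar> + \<bar>b' 0 z - b 0 z\<bar> + \<bar>b' 1 z - b 1 z\<bar>" for z
    obtain B where B: "kernel r B k" using mollifier_kernel[OF k(1)] .
    have cu': "continuous_on UNIV (u' i)" and cb': "continuous_on UNIV (b' i)" for i
      using cv_continuous[OF u bu B B] cv_continuous[OF b bb B B] by (simp_all add: u'_def[abs_def] b'_def[abs_def] split_def)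
    note [measurable] = borel_measurable_continuous_onI[OF cu'] borel_measurable_continuous_onI[OF cb']
    have [measurable]: "err \<in> borel_measurable borel" unfolding err_def[abs_def] by measurable
    have ie: "(\<integral>\<^sup>+z. ennreal (err z) * indicator ?R' z \<partial>lborel) \<le> ennreal (4 * e)"
    proof -
      have "(\<integral>\<^sup>+z. ennreal (err z) * indicator ?R' z \<partial>lborel)
        = (\<integral>\<^sup>+z. ennreal \<bar>u' 0 z - u 0 z\<bar> * indicator ?R' z \<partial>lborel) + (\<integral>\<^sup>+z. ennreal \<bar>u' 1 z - u 1 z\<bar> * indicator ?R' z \<partial>lborel)
         + (\<integral>\<^sup>+z. ennreal \<bar>b' 0 z - b 0 z\<bar> * indicator ?R' z \<partial>lborel) + (\<integral>\<^sup>+z. ennreal \<bar>b' 1 z - b 1 z\<bar> * indicator ?R' z \<partial>lborel)"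
        by (simp add: err_def nn_integral_add[symmetric] distrib_right)
      also have "\<dots> \<le> ennreal e + ennreal e + ennreal e + ennreal e"
        unfolding u'_def b'_def by (intro add_mono \<delta>(2)[OF _ rw k(1)]) auto
      also have "\<dots> = ennreal (4 * e)" using e by (simp flip: ennreal_plus)
      finally show ?thesis .
    qed
    define ch where "ch z = hat t1 t2 (fst z) * hat x1 x2 (snd z)" for z
    have [measurable]: "ch \<in> borel_measurable borel"
      unfolding ch_def by (intro borel_measurable_continuous_onI continuous_intros continuous_on_compose2[OF hat_continuous[of UNIV]]) auto
    have chX: "\<bar>ch z\<bar> \<le> X" if "z \<in> ?R" for z using X[of "fst z" "snd z"] that by (cases z) (auto simp: ch_def cbox_Pair_eq)
    have bu': "\<bar>u' i z\<bar> \<le> U" "\<bar>b' i z\<bar> \<le> U" for i z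
      unfolding u'_def b'_def by (intro abs_cv_le[OF u bu k(1)] abs_cv_le[OF b bb k(1)])+
    define Q where "Q z = indicator ?R z * (ch z * wronski u b h z)" for z
    define Q' where "Q' z = indicator ?R z * (ch z * wronski u' b' h z)" for z
    have [measurable]: "Q \<in> borel_measurable borel" "Q' \<in> borel_measurable borel"
      unfolding Q_def[abs_def] Q'_def[abs_def] wronski_def incr_def by measurable
    have "integrable lborel Q" unfolding Q_def[abs_def] ch_def by (rule wronski_integrable[OF u b bu bb])
    moreover have "integrable lborel Q'" unfolding Q'_def[abs_def] ch_def by (rule wronski_integrable[OF _ _ bu']) measurable
    ultimately have iQ: "integrable lborel Q" "integrable lborel Q'" .
    have QQ: "ennreal \<bar>Q z - Q' z\<bar> \<le> ennreal (2 * (X * U)) * (ennreal (err z) * indicator ?R' z + ennreal (err (z+h)) * indicator ?R' (z+h))" for z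
    proof (cases "z \<in> ?R")
      case True
      then have in': "z \<in> ?R'" "z + h \<in> ?R'" using h \<eta> by (cases z, auto simp: cbox_Pair_eq)+
      have "\<bar>Q z - Q' z\<bar> = \<bar>ch z\<bar> * \<bar>wronski u' b' h z - wronski u b h z\<bar>"
        using True by (simp add: Q_def Q'_def abs_mult[symmetric] right_diff_distrib abs_minus_commute)
      also have "\<dots> \<le> X * (2 * U * (err z + err (z+h)))"
        unfolding err_def using X0 by (intro mult_mono chX True wronski_perturbation bu bb bu') auto
      finally have "\<bar>Q z - Q' z\<bar> \<le> 2 * (X * U) * (err z + err (z+h))" by (simp add: mult_ac)
      then have "ennreal \<bar>Q z - Q' z\<bar> \<le> ennreal (2 * (X * U)) * ennreal (err z + err (z+h))"
        using XU by (simp add: ennreal_leI flip: ennreal_mult')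
      also have "ennreal (err z + err (z+h)) = ennreal (err z) + ennreal (err (z+h))" by (simp add: err_def)
      finally show ?thesis using in' by simp
    qed (simp add: Q_def Q'_def)
    have "(\<integral>\<^sup>+z. ennreal \<bar>Q z - Q' z\<bar> \<partial>lborel) \<le> (\<integral>\<^sup>+z. ennreal (2 * (X * U)) * (ennreal (err z) * indicator ?R' z + ennreal (err (z+h)) * indicator ?R' (z+h)) \<partial>lborel)"
      by (intro nn_integral_mono QQ)
    also have "\<dots> = ennreal (2 * (X * U)) * ((\<integral>\<^sup>+z. ennreal (err z) * indicator ?R' z \<partial>lborel) + (\<integral>\<^sup>+z. ennreal (err (z+h)) * indicator ?R' (z+h) \<partial>lborel))"
      by (simp add: nn_integral_cmult nn_integral_add)
    also have "(\<integral>\<^sup>+z. ennreal (err (z+h)) * indicator ?R' (z+h) \<partial>lborel) = (\<integral>\<^sup>+z. ennreal (err z) * indicator ?R' z \<partial>lborel)"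
      by (rule nn_integral_lborel_translate) measurable
    also have "ennreal (2 * (X * U)) * ((\<integral>\<^sup>+z. ennreal (err z) * indicator ?R' z \<partial>lborel) + (\<integral>\<^sup>+z. ennreal (err z) * indicator ?R' z \<partial>lborel))
       \<le> ennreal (2 * (X * U)) * (ennreal (4 * e) + ennreal (4 * e))"
      by (intro mult_left_mono add_mono ie) simp
    also have "\<dots> = ennreal (16 * (X * U) * e)" using XU e by (simp add: mult.assoc flip: ennreal_plus ennreal_mult)
    also have "\<dots> \<le> ennreal e0" using e by (intro ennreal_leI)
    finally have nn: "(\<integral>\<^sup>+z. ennreal \<bar>Q z - Q' z\<bar> \<partial>lborel) \<le> ennreal e0" .
    have "ennreal \<bar>\<integral>z. Q z - Q' z \<partial>lborel\<bar> \<le> ennreal e0"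
      using ennreal_abs_integral_le nn by (rule order_trans)
    then have "\<bar>(\<integral>z. Q z \<partial>lborel) - (\<integral>z. Q' z \<partial>lborel)\<bar> \<le> e0" using e0 iQ by simp
    moreover have "\<bar>\<integral>z. Q' z \<partial>lborel\<bar> \<le> \<eta> * C" unfolding Q'_def ch_def u'_def b'_def C_def
      by (rule mollified_wronski_bound[OF u b bu bb tx N0 k N[OF r(2) k] X \<eta> h])
    ultimately have "\<bar>\<integral>z. Q z \<partial>lborel\<bar> \<le> C * \<eta> + e0" by (simp add: mult.commute)
    then show "\<bar>\<integral>z. indicator ?R z * (hat t1 t2 (fst z) * hat x1 x2 (snd z) * wronski u b h z) \<partial>lborel\<bar> \<le> C * \<eta> + e0"
      by (simp add: Q_def ch_def)
  qed
  show thesis by (rule that[OF C0 main])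
qed

section \<open>Coercivity from the nondegeneracy of the flux\<close>

lemma integral_pair_mult:
  fixes g1 g2 :: "real \<Rightarrow> real"
  assumes [measurable]: "g1 \<in> borel_measurable borel" "g2 \<in> borel_measurable borel"
    and b: "\<And>v. \<bar>g1 v\<bar> \<le> c1 * indicator {-S..S} v" "\<And>v. \<bar>g2 v\<bar> \<le> c2 * indicator {-S..S} v"
  shows "integrable lborel (\<lambda>p. g1 (fst p) * g2 (snd p))"
    and "(\<integral>p. g1 (fst p) * g2 (snd p) \<partial>lborel) = (\<integral>v. g1 v \<partial>lborel) * (\<integral>v. g2 v \<partial>lborel)"
proof -
  show i: "integrable lborel (\<lambda>p. g1 (fst p) * g2 (snd p))"
  proof (rule integrable_bounded_cbox)
    fix p :: "real \<times> real"
    have "0 \<le> c1 * indicator {-S..S} (fst p)" using b(1)[of "fst p"] by linarith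
    then have "\<bar>g1 (fst p)\<bar> * \<bar>g2 (snd p)\<bar> \<le> (c1 * indicator {-S..S} (fst p)) * (c2 * indicator {-S..S} (snd p))"
      by (intro mult_mono b) auto
    then show "\<bar>g1 (fst p) * g2 (snd p)\<bar> \<le> c1 * c2 * indicator (cbox (-S,-S) (S,S)) p"
      by (cases p) (auto simp: abs_mult cbox_Pair_eq indicator_times mult_ac)
  qed measurable
  show "(\<integral>p. g1 (fst p) * g2 (snd p) \<partial>lborel) = (\<integral>v. g1 v \<partial>lborel) * (\<integral>v. g2 v \<partial>lborel)"
    using lborel_pair.integral_fst'[of "\<lambda>p. g1 (fst p) * g2 (snd p)"] i by (simp add: lborel_prod)
qed

text \<open>The strip is not cut off in the second variable, so every section has length exactly
  2\<delta>, over an interval of length 2S.\<close>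

lemma diagonal_strip:
  assumes "0 \<le> S" "0 \<le> \<delta>"
  shows "integrable lborel (\<lambda>p::real \<times> real. indicator {-S..S} (fst p) * indicator {fst p - \<delta>..fst p + \<delta>} (snd p) :: real)"
    and "(\<integral>p. indicator {-S..S} (fst p) * indicator {fst p - \<delta>..fst p + \<delta>} (snd p) \<partial>lborel) = 4 * S * \<delta>"
proof -
  let ?f = "\<lambda>p::real \<times> real. indicator {-S..S} (fst p) * indicator {fst p - \<delta>..fst p + \<delta>} (snd p) :: real"
  have "{p::real \<times> real. fst p - \<delta> \<le> snd p \<and> snd p \<le> fst p + \<delta>} \<in> sets borel"
    by (intro borel_closed closed_Collect_conj closed_Collect_le continuous_intros)
  then have [measurable]: "(\<lambda>p::real \<times> real. indicator {p. fst p - \<delta> \<le> snd p \<and> snd p \<le> fst p + \<delta>} p :: real) \<in> borel_measurable borel"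
    by measurable
  have f: "?f = (\<lambda>p. indicator {-S..S} (fst p) * indicator {p. fst p - \<delta> \<le> snd p \<and> snd p \<le> fst p + \<delta>} p)"
    by (auto simp: indicator_def)
  show i: "integrable lborel ?f"
  proof (rule integrable_bounded_cbox)
    show "?f \<in> borel_measurable borel" unfolding f by measurable
    show "\<bar>?f p\<bar> \<le> 1 * indicator (cbox (-S,-S-\<delta>) (S,S+\<delta>)) p" for p
      by (cases p) (auto simp: indicator_def cbox_Pair_eq)
  qed
  have "integral\<^sup>L lborel ?f = (\<integral>v. \<integral>w. ?f (v,w) \<partial>lborel \<partial>lborel)"
    using lborel_pair.integral_fst'[of ?f] i by (simp add: lborel_prod)
  also have "\<dots> = (\<integral>v. indicator {-S..S} v * (2 * \<delta>) \<partial>lborel)" using assms by simp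
  also have "\<dots> = 4 * S * \<delta>" using assms by simp
  finally show "integral\<^sup>L lborel ?f = 4 * S * \<delta>" .
qed

text \<open>Expanding \<open>(v - w) (a' v - a' w)\<close> exhibits \<open>2 W\<close> as the double integral of
  \<open>f v f w \<Psi> v \<Psi> w (v - w) (a' v - a' w)\<close>, which controls the part of \<open>(\<integral> f \<psi>)\<^sup>2\<close> away from the diagonal;
  near the diagonal boundedness of \<open>f\<close> suffices.\<close>

lemma kinetic_lower_bound:
  fixes f \<psi> \<Psi> a' :: "real \<Rightarrow> real"
  assumes f [measurable]: "f \<in> borel_measurable borel" and K: "\<And>v. \<bar>f v\<bar> \<le> K"
    and \<Psi>: "kernel S B \<Psi>" and a': "continuous_on UNIV a'" and S: "0 < S"
    and \<psi>: "kernel S B' \<psi>" "\<And>v. \<bar>\<psi> v\<bar> \<le> \<Psi> v"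
    and nd: "\<And>v w. -S \<le> w \<Longrightarrow> w < v \<Longrightarrow> v \<le> S \<Longrightarrow> a' v - a' w \<ge> \<alpha> * (v - w) powr \<beta>"
    and \<alpha>: "0 < \<alpha>" and \<beta>: "0 \<le> \<beta>" and \<delta>: "0 < \<delta>"
    and sgn: "AE p in lborel. 0 \<le> f (fst p) * f (snd p)"
  defines "W \<equiv> (\<integral>v. f v * \<Psi> v \<partial>lborel) * (\<integral>v. f v * (a' v * (v * \<Psi> v)) \<partial>lborel)
     - (\<integral>v. f v * (v * \<Psi> v) \<partial>lborel) * (\<integral>v. f v * (a' v * \<Psi> v) \<partial>lborel)"
  shows "0 \<le> W" and "(\<integral>v. f v * \<psi> v \<partial>lborel)\<^sup>2 \<le> 4 * K\<^sup>2 * B\<^sup>2 * S * \<delta> + 2 / \<alpha> * \<delta> powr (-(\<beta>+1)) * W"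
proof -
  obtain B1 where B1: "kernel S B1 (\<lambda>v. v * \<Psi> v)" using kernel_mult[OF \<Psi>, of "\<lambda>v. v"] by (auto intro: continuous_intros)
  obtain B2 where B2: "kernel S B2 (\<lambda>v. a' v * \<Psi> v)" using kernel_mult[OF \<Psi> a'] .
  obtain B3 where B3: "kernel S B3 (\<lambda>v. a' v * (v * \<Psi> v))" using kernel_mult[OF B1 a'] .
  have K0: "0 \<le> K" using K[of 0] by linarith
  have \<Psi>0: "0 \<le> \<Psi> v" for v using \<psi>(2)[of v] by linarith
  have fw: "\<bar>f v * w v\<bar> \<le> (K * c) * indicator {-S..S} v" if "kernel S c w" for w v c
    using mult_mono[OF K[of v] kernel_indicator[OF that, of v]] K0 by (simp add: abs_mult mult.assoc)
  have fm: "(\<lambda>v. f v * w v) \<in> borel_measurable borel" if "kernel S c w" for w c using kernel_measurable[OF that] by measurable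
  have ip: "integrable lborel (\<lambda>p. f (fst p) * w (fst p) * (f (snd p) * w' (snd p)))"
      "(\<integral>p. f (fst p) * w (fst p) * (f (snd p) * w' (snd p)) \<partial>lborel) = (\<integral>v. f v * w v \<partial>lborel) * (\<integral>v. f v * w' v \<partial>lborel)"
    if "kernel S c w" "kernel S c' w'" for w w' c c'
    using integral_pair_mult[OF fm[OF that(1)] fm[OF that(2)] fw[OF that(1)] fw[OF that(2)]] by simp_all
  define G where "G p = f (fst p) * f (snd p) * (\<Psi> (fst p) * \<Psi> (snd p)) * ((fst p - snd p) * (a' (fst p) - a' (snd p)))" for p
  \<comment> \<open>Of the four terms, the outer two are interchanged by swapping v and w, and so
    are the inner two. Each pair therefore contributes one of the products in \<open>W\<close>
    twice.\<close>
  have Geq: "G p = f (fst p) * \<Psi> (fst p) * (f (snd p) * (a' (snd p) * (snd p * \<Psi> (snd p))))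
      - f (fst p) * (fst p * \<Psi> (fst p)) * (f (snd p) * (a' (snd p) * \<Psi> (snd p)))
      - f (fst p) * (a' (fst p) * \<Psi> (fst p)) * (f (snd p) * (snd p * \<Psi> (snd p)))
      + f (fst p) * (a' (fst p) * (fst p * \<Psi> (fst p))) * (f (snd p) * \<Psi> (snd p))" for p
    by (simp add: G_def algebra_simps)
  have iG: "integrable lborel G" and GW: "(\<integral>p. G p \<partial>lborel) = 2 * W" unfolding Geq W_def
    by (simp_all add: ip[OF \<Psi> B3] ip[OF B1 B2] ip[OF B2 B1] ip[OF B3 \<Psi>])
  \<comment> \<open>Nondegeneracy is given only for w < v, but both sides are symmetric in v and w,
    so it extends to all pairs; the additional factor v - w raises the exponent to \<beta> +
    1.\<close>
  have gap: "\<alpha> * \<bar>v - w\<bar> powr (\<beta> + 1) \<le> (v - w) * (a' v - a' w)" if "\<bar>v\<bar> \<le> S" "\<bar>w\<bar> \<le> S" for v w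
  proof -
    have *: "\<alpha> * (v - w) powr (\<beta> + 1) \<le> (v - w) * (a' v - a' w)" if "-S \<le> w" "w < v" "v \<le> S" for v w
    proof -
      have "(v - w) powr (\<beta> + 1) = (v - w) powr \<beta> * (v - w)" using that \<beta> by (simp add: powr_add)
      then show ?thesis using mult_left_mono[OF nd[OF that], of "v - w"] that by (simp add: mult_ac)
    qed
    show ?thesis
    proof (cases v w rule: linorder_cases)
      case less then show ?thesis using *[of v w] that by (simp add: algebra_simps)
    next
      case equal then show ?thesis by simp
    next
      case greater then show ?thesis using *[of w v] that by simp
    qed
  qed
  have Gpos: "0 \<le> f v * f w \<Longrightarrow> f v * f w * (\<Psi> v * \<Psi> w) * (\<alpha> * \<bar>v - w\<bar> powr (\<beta> + 1)) \<le> G (v,w)" for v w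
  proof (cases "\<Psi> v * \<Psi> w = 0")
    case False
    assume ff: "0 \<le> f v * f w"
    show ?thesis unfolding G_def fst_conv snd_conv using False kernel_zero[OF \<Psi>, of v] kernel_zero[OF \<Psi>, of w]
      by (intro mult_left_mono gap mult_nonneg_nonneg[OF ff mult_nonneg_nonneg[OF \<Psi>0 \<Psi>0]]) auto
  qed (auto simp: G_def)
  have G0: "AE p in lborel. 0 \<le> G p" using sgn
  proof eventually_elim
    case (elim p)
    have "0 \<le> f (fst p) * f (snd p) * (\<Psi> (fst p) * \<Psi> (snd p)) * (\<alpha> * \<bar>fst p - snd p\<bar> powr (\<beta> + 1))"
      using \<alpha> by (intro mult_nonneg_nonneg[OF mult_nonneg_nonneg[OF elim mult_nonneg_nonneg[OF \<Psi>0 \<Psi>0]]]) auto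
    then show ?case using Gpos[OF elim] by simp
  qed
  then have "0 \<le> (\<integral>p. G p \<partial>lborel)" by (rule integral_nonneg_AE)
  then show W0: "0 \<le> W" by (simp add: GW)
  let ?D = "\<lambda>p::real \<times> real. indicator {-S..S} (fst p) * indicator {fst p - \<delta>..fst p + \<delta>} (snd p) :: real"
  have "(\<integral>v. f v * \<psi> v \<partial>lborel)\<^sup>2 = (\<integral>p. f (fst p) * \<psi> (fst p) * (f (snd p) * \<psi> (snd p)) \<partial>lborel)"
    by (simp add: ip(2)[OF \<psi>(1) \<psi>(1)] power2_eq_square)
  also have "\<dots> \<le> (\<integral>p. K\<^sup>2 * B\<^sup>2 * ?D p + \<delta> powr (-(\<beta>+1)) / \<alpha> * G p \<partial>lborel)"
  proof (rule integral_mono_AE)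
    show "integrable lborel (\<lambda>p. f (fst p) * \<psi> (fst p) * (f (snd p) * \<psi> (snd p)))" by (rule ip(1)[OF \<psi>(1) \<psi>(1)])
    show "integrable lborel (\<lambda>p. K\<^sup>2 * B\<^sup>2 * ?D p + \<delta> powr (-(\<beta>+1)) / \<alpha> * G p)"
      using S \<delta> by (intro Bochner_Integration.integrable_add integrable_mult_right diagonal_strip iG) auto
    show "AE p in lborel. f (fst p) * \<psi> (fst p) * (f (snd p) * \<psi> (snd p)) \<le> K\<^sup>2 * B\<^sup>2 * ?D p + \<delta> powr (-(\<beta>+1)) / \<alpha> * G p"
      using sgn G0
    proof eventually_elim
      case (elim p)
      obtain v w where p: "p = (v,w)" by (cases p)
      have ff: "0 \<le> f v * f w" using elim(1) by (simp add: p)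
      have cG: "0 \<le> \<delta> powr (-(\<beta>+1)) / \<alpha> * G p" using elim(2) \<alpha> by simp
      \<comment> \<open>Because f v * f w \<ge> 0, replacing \<psi> by its majorant can only
        increase the integrand, even where \<psi> v * \<psi> w is negative.\<close>
      have "\<psi> v * \<psi> w \<le> \<bar>\<psi> v\<bar> * \<bar>\<psi> w\<bar>" by (metis abs_ge_self abs_mult)
      also have "\<dots> \<le> \<Psi> v * \<Psi> w" by (intro mult_mono \<psi> \<Psi>0) auto
      finally have "\<psi> v * \<psi> w \<le> \<Psi> v * \<Psi> w" .
      from mult_left_mono[OF this ff] have le1: "f v * \<psi> v * (f w * \<psi> w) \<le> f v * f w * (\<Psi> v * \<Psi> w)"
        by (simp add: mult_ac)
      have "f v * f w * (\<Psi> v * \<Psi> w) \<le> K\<^sup>2 * B\<^sup>2 * ?D p + \<delta> powr (-(\<beta>+1)) / \<alpha> * G p"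
      proof (cases "\<Psi> v * \<Psi> w = 0")
        case True
        have "0 \<le> K\<^sup>2 * B\<^sup>2 * ?D p" by simp
        then show ?thesis unfolding True using cG by linarith
      next
        case False
        then have v: "\<bar>v\<bar> \<le> S" "\<bar>w\<bar> \<le> S" using kernel_zero[OF \<Psi>] by auto
        show ?thesis
        proof (cases "\<bar>v - w\<bar> \<le> \<delta>")
          case True
          then have "?D p = 1" using v by (auto simp: p indicator_def abs_le_iff)
          moreover have "f v * f w * (\<Psi> v * \<Psi> w) \<le> K\<^sup>2 * B\<^sup>2"
          proof -
            have A: "f v * f w \<le> K * K" using mult_mono[OF K[of v] K[of w]] K0 ff by (simp flip: abs_mult)
            have B: "\<Psi> v * \<Psi> w \<le> B * B" using kernel_le[OF \<Psi>, of v] kernel_le[OF \<Psi>, of w] \<Psi>0[of v] \<Psi>0[of w] by (intro mult_mono) auto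
            have "(f v * f w) * (\<Psi> v * \<Psi> w) \<le> (K * K) * (B * B)" by (rule mult_mono[OF A B zero_le_square mult_nonneg_nonneg[OF \<Psi>0 \<Psi>0]])
            then show ?thesis by (simp add: power2_eq_square)
          qed
          ultimately have "f v * f w * (\<Psi> v * \<Psi> w) \<le> K\<^sup>2 * B\<^sup>2 * ?D p" by (simp only: mult_1_right)
          then show ?thesis using cG by linarith
        next
          case False
          \<comment> \<open>Off the strip, (|v - w| / \<delta>) raised to \<beta> + 1 is at least 1.
            Inserting it as a factor produces exactly the weight that \<open>G\<close>
            controls.\<close>
          then have "\<delta> powr (\<beta> + 1) \<le> \<bar>v - w\<bar> powr (\<beta> + 1)" using \<delta> \<beta> by (intro powr_mono2) auto
          then have "\<delta> powr (-(\<beta>+1)) * \<delta> powr (\<beta> + 1) \<le> \<delta> powr (-(\<beta>+1)) * \<bar>v - w\<bar> powr (\<beta> + 1)"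
            by (rule mult_left_mono) simp
          moreover have "\<delta> powr (-(\<beta>+1)) * \<delta> powr (\<beta> + 1) = 1" using \<delta> by (simp flip: powr_add)
          ultimately have "1 \<le> \<delta> powr (-(\<beta>+1)) * \<bar>v - w\<bar> powr (\<beta> + 1)" by simp
          then have "f v * f w * (\<Psi> v * \<Psi> w) * 1 \<le> f v * f w * (\<Psi> v * \<Psi> w) * (\<delta> powr (-(\<beta>+1)) * \<bar>v - w\<bar> powr (\<beta> + 1))"
            by (intro mult_left_mono mult_nonneg_nonneg[OF ff mult_nonneg_nonneg[OF \<Psi>0 \<Psi>0]])
          also have "\<dots> = \<delta> powr (-(\<beta>+1)) / \<alpha> * (f v * f w * (\<Psi> v * \<Psi> w) * (\<alpha> * \<bar>v - w\<bar> powr (\<beta> + 1)))"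
            using \<alpha> by (simp add: field_simps)
          also have "\<dots> \<le> \<delta> powr (-(\<beta>+1)) / \<alpha> * G p"
            unfolding p using \<alpha> by (intro mult_left_mono Gpos ff) auto
          finally have "f v * f w * (\<Psi> v * \<Psi> w) \<le> \<delta> powr (-(\<beta>+1)) / \<alpha> * G p" by simp
          moreover have "0 \<le> K\<^sup>2 * B\<^sup>2 * ?D p" by simp
          ultimately show ?thesis by linarith
        qed
      qed
      with le1 show ?case by (simp add: p)
    qed
  qed
  also have "\<dots> = K\<^sup>2 * B\<^sup>2 * (4 * S * \<delta>) + \<delta> powr (-(\<beta>+1)) / \<alpha> * (2 * W)"
    using S \<delta> diagonal_strip[of S \<delta>] iG GW by (subst Bochner_Integration.integral_add) (auto intro!: integrable_mult_right)
  finally show "(\<integral>v. f v * \<psi> v \<partial>lborel)\<^sup>2 \<le> 4 * K\<^sup>2 * B\<^sup>2 * S * \<delta> + 2 / \<alpha> * \<delta> powr (-(\<beta>+1)) * W"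
    by (simp add: mult_ac)
qed

lemma mom_incr:
  assumes F: "F \<in> borel_measurable borel" "\<And>p. \<bar>F p\<bar> \<le> C" and w: "kernel S B w"
  shows "incr h (mom F w) z = (\<integral>v. (F (fst (z+h), snd (z+h), v) - F (fst z, snd z, v)) * w v \<partial>lborel)"
  unfolding incr_def mom_def by (subst Bochner_Integration.integral_diff[symmetric])
     (auto intro!: mom_integrable[OF F w] simp: left_diff_distrib)

abbreviation same_sign :: "(real \<times> real \<times> real \<Rightarrow> real) \<Rightarrow> real \<times> real \<Rightarrow> real \<times> real \<Rightarrow> bool" where
  "same_sign F h z \<equiv> AE p in lborel. 0 \<le> (F (fst (z+h), snd (z+h), fst p) - F (fst z, snd z, fst p))
     * (F (fst (z+h), snd (z+h), snd p) - F (fst z, snd z, snd p))"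

abbreviation incr_mass :: "real \<times> real \<Rightarrow> (real \<times> real \<Rightarrow> real) \<Rightarrow> (real \<times> real) set \<Rightarrow> ennreal" where
  "incr_mass h g R \<equiv> (\<integral>\<^sup>+z. ennreal ((incr h g z)\<^sup>2) * indicator R z \<partial>lborel)"

text \<open>At almost every (t, x) with t > 0, coercivity bounds the squared increment by \<delta>
  plus a multiple of the determinant. Integration over the smaller box then needs only the div-curl
  bound on a larger one, where the cutoff can be used.\<close>

lemma increment_estimate:
  assumes F: "F \<in> borel_measurable borel" and C: "\<And>p. \<bar>F p\<bar> \<le> C"
    and kin: "kinetic_eq a' \<gamma> mp mn F" and a': "continuous_on UNIV a'"
    and mp: "radon_on_Dom3 mp" and mn: "radon_on_Dom3 mn"
    and \<beta>: "1 \<le> \<beta>"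
    and nd: "\<forall>M>0. \<exists>\<alpha>>0. \<forall>v w. -M \<le> w \<and> w < v \<and> v \<le> M \<longrightarrow> a' v - a' w \<ge> \<alpha> * (v - w) powr \<beta>"
    and \<psi>: "smooth1 \<psi>" "\<psi> x0 \<noteq> 0" "0 < S0" "\<And>v. S0 < \<bar>v\<bar> \<Longrightarrow> \<psi> v = 0"
    and sgn: "\<And>\<eta> h. 0 \<le> \<eta> \<Longrightarrow> h \<in> {(\<eta>,0), (0,\<eta>)} \<Longrightarrow>
       AE z in lborel. 0 < fst z \<longrightarrow> same_sign F h z"
    and s: "0 < s1" "s1 \<le> s2" "y1 \<le> y2"
  obtains C' where "C' \<ge> 0" "\<And>\<eta> h. 0 \<le> \<eta> \<Longrightarrow> \<eta> \<le> 1 \<Longrightarrow> h \<in> {(\<eta>,0), (0,\<eta>)} \<Longrightarrow>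
    incr_mass h (mom F \<psi>) (cbox (s1,y1) (s2,y2)) \<le> ennreal (C' * \<eta> powr (1 / (2 + \<beta>)))"
proof -
  note [measurable] = F
  obtain \<Psi> S1 where \<Psi>: "smooth1 \<Psi>" "S1 > 0" "\<And>v. S1 < \<bar>v\<bar> \<Longrightarrow> \<Psi> v = 0" "\<And>v. \<bar>\<psi> v\<bar> \<le> \<Psi> v"
    by (rule exists_smooth_majorant[OF \<psi>(1-3)], rule \<psi>(4), assumption, rule that)
  define S where "S = max S0 S1"
  have S: "0 < S" and \<Psi>S: "\<And>v. S < \<bar>v\<bar> \<Longrightarrow> \<Psi> v = 0" and \<psi>S: "\<And>v. S < \<bar>v\<bar> \<Longrightarrow> \<psi> v = 0"
    using \<psi>(3,4) \<Psi>(2,3) by (auto simp: S_def)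
  \<comment> \<open>The div-curl lemmas quantify over all indices, so every i \<ge> 1 is given the
    weight v \<Psi> v. Bounds for the indices 0 and 1 are thereby bounds for all, which is the
    purpose of \<open>min i 1\<close> below.\<close>
  define \<omega> where "\<omega> i v = (if i = (0::nat) then \<Psi> v else v * \<Psi> v)" for i v
  have s\<omega>: "smooth1 (\<omega> i)" for i
    using \<Psi>(1) smooth1_mult[OF smooth1_ident \<Psi>(1)] by (cases "i = 0") (simp_all add: \<omega>_def[abs_def])
  have z\<omega>: "S < \<bar>v\<bar> \<Longrightarrow> \<omega> i v = 0" for i v using \<Psi>S by (simp add: \<omega>_def)
  define u where "u i = mom F (\<omega> i)" for i
  define b where "b i = mom F (\<lambda>v. a' v * \<omega> i v)" for i
  have "\<exists>B. kernel S B (\<omega> i)" for i using smooth1_kernel[OF s\<omega> z\<omega>, where k=0] by (metis funpow_0)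
  then obtain B1 where B1: "\<And>i. kernel S (B1 i) (\<omega> i)" by metis
  have "\<exists>B. kernel S B (\<lambda>v. a' v * \<omega> i v)" for i using kernel_mult[OF B1 a'] by metis
  then obtain B2 where B2: "\<And>i. kernel S (B2 i) (\<lambda>v. a' v * \<omega> i v)" by metis
  obtain B where B: "kernel S B \<Psi>" using B1[of 0] by (simp add: \<omega>_def[abs_def])
  obtain B' where B': "kernel S B' \<psi>" using kernelI[OF smooth1_continuous[OF \<psi>(1)] \<psi>S] by blast
  have um [measurable]: "u i \<in> borel_measurable borel" "b i \<in> borel_measurable borel" for i
    using kernel_measurable[OF B1[of i]] kernel_measurable[OF B2[of i]] by (simp_all add: u_def b_def mom_measurable F)
  have C0: "0 \<le> C" using C[of undefined] by linarith
  have \<omega>1: "\<omega> i = \<omega> (min i 1)" for i by (auto simp: \<omega>_def min_def)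
  define U where "U = Max ((\<lambda>i. C * B1 i * (2 * S)) ` {0,1} \<union> (\<lambda>i. C * B2 i * (2 * S)) ` {0,1})"
  have bu: "\<bar>u i z\<bar> \<le> U" and bb: "\<bar>b i z\<bar> \<le> U" for i z
  proof -
    have i: "min i 1 \<in> {0,1}" by (auto simp: min_def)
    have "\<bar>u (min i 1) z\<bar> \<le> C * B1 (min i 1) * (2 * S)" unfolding u_def using S by (intro mom_bounded[OF F C B1]) simp
    also have "\<dots> \<le> U" unfolding U_def using i by (intro Max_ge) auto
    finally show "\<bar>u i z\<bar> \<le> U" using \<omega>1[of i] by (simp add: u_def)
    have "\<bar>b (min i 1) z\<bar> \<le> C * B2 (min i 1) * (2 * S)" unfolding b_def using S by (intro mom_bounded[OF F C B2]) simp
    also have "\<dots> \<le> U" unfolding U_def using i by (intro Max_ge) auto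
    finally show "\<bar>b i z\<bar> \<le> U" using \<omega>1[of i] by (simp add: b_def)
  qed
  \<comment> \<open>The cutoff vanishes on the boundary of \<open>?R\<close>, so \<open>?K\<close>
    must lie strictly inside. The margin is 1 except at the lower time, where s1 / 2 is used to stay
    in t > 0; the radius r0 = s1 / 4 leaves room for the mollifier.\<close>
  define t1 t2 x1 x2 where "t1 = s1 / 2" and "t2 = s2 + 1" and "x1 = y1 - 1" and "x2 = y2 + 1"
  have tx: "t1 \<le> t2" "x1 \<le> x2" using s by (auto simp: t1_def t2_def x1_def x2_def)
  define r0 where "r0 = s1 / 4"
  have r0: "0 < r0" "r0 < t1" using s by (auto simp: r0_def t1_def)
  have "\<forall>i. \<exists>N. 0 \<le> N \<and> (\<forall>r k. r \<le> r0 \<longrightarrow> mollifier r k \<longrightarrow> smooth1 k \<longrightarrow>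
       source_mass (u i) (b i) k (cbox (t1,x1) (t2+1,x2+1)) \<le> ennreal N)"
    unfolding u_def b_def
  proof
    fix i show "\<exists>N. 0 \<le> N \<and> (\<forall>r k. r \<le> r0 \<longrightarrow> mollifier r k \<longrightarrow> smooth1 k \<longrightarrow>
       source_mass (mom F (\<omega> i)) (mom F (\<lambda>v. a' v * \<omega> i v)) k (cbox (t1,x1) (t2+1,x2+1)) \<le> ennreal N)"
    by (rule source_mass_bound[OF F C kin a' mp mn s\<omega>[of i] z\<omega> less_imp_le[OF S] r0(2),
          where ?t2.0="t2+1" and ?x1.0=x1 and ?x2.0="x2+1"]) (assumption, blast)
  qed
  from choice[OF this] obtain N' where "\<forall>i. 0 \<le> N' i \<and> (\<forall>r k. r \<le> r0 \<longrightarrow> mollifier r k \<longrightarrow> smooth1 k \<longrightarrow>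
       source_mass (u i) (b i) k (cbox (t1,x1) (t2+1,x2+1)) \<le> ennreal (N' i))" by blast
  then have N': "\<And>i. 0 \<le> N' i" "\<And>i r k. r \<le> r0 \<Longrightarrow> mollifier r k \<Longrightarrow> smooth1 k \<Longrightarrow>
       source_mass (u i) (b i) k (cbox (t1,x1) (t2+1,x2+1)) \<le> ennreal (N' i)"
    by blast+
  define N where "N = max (N' 0) (N' 1)"
  have N0: "0 \<le> N" using N'(1) by (simp add: N_def le_max_iff_disj)
  have N: "source_mass (u i) (b i) k (cbox (t1,x1) (t2+1,x2+1)) \<le> ennreal N" if "r \<le> r0" "mollifier r k" "smooth1 k" for i r k
  proof -
    have "u i = u (min i 1)" "b i = b (min i 1)" using \<omega>1[of i] by (simp_all add: u_def b_def)
    moreover have "ennreal (N' (min i 1)) \<le> ennreal N" by (intro ennreal_leI) (auto simp: N_def min_def le_Suc_eq)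
    ultimately show ?thesis using order_trans[OF N'(2)[OF that, of "min i 1"]] by simp
  qed
  have ex: "\<exists>k. mollifier r k \<and> smooth1 k" if "0 < r" for r by (rule exists_smooth_mollifier[OF \<psi> that])
  let ?R = "cbox (t1,x1) (t2,x2)" and ?K = "cbox (s1,y1) (s2,y2)"
  let ?ch = "\<lambda>z. hat t1 t2 (fst z) * hat x1 x2 (snd z)"
  obtain Cw where Cw: "Cw \<ge> 0" "\<And>\<eta> h. 0 \<le> \<eta> \<Longrightarrow> \<eta> \<le> 1 \<Longrightarrow> h \<in> {(\<eta>,0), (0,\<eta>)} \<Longrightarrow>
    \<bar>\<integral>z. indicator ?R z * (?ch z * wronski u b h z) \<partial>lborel\<bar> \<le> Cw * \<eta>"
    by (rule wronski_bound[OF um bu bb tx N0 r0(1) ex N]) (assumption | rule that)+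
  obtain \<alpha> where \<alpha>: "0 < \<alpha>" "\<And>v w. -S \<le> w \<Longrightarrow> w < v \<Longrightarrow> v \<le> S \<Longrightarrow> a' v - a' w \<ge> \<alpha> * (v - w) powr \<beta>"
    using nd S by blast
  have \<beta>0: "0 \<le> \<beta>" using \<beta> by simp
  define \<sigma> where "\<sigma> = 1 / (2 + \<beta>)"
  define A where "A = 4 * (2 * C)\<^sup>2 * B\<^sup>2 * S"
  define D where "D = 2 / \<alpha>"
  define c0 where "c0 = s1 / 2"
  define mK where "mK = measure lborel ?K"
  have eK: "emeasure lborel ?K = ennreal mK"
    unfolding mK_def by (intro emeasure_eq_ennreal_measure) (use emeasure_lborel_cbox_finite[of "(s1,y1)" "(s2,y2)"] in auto)
  have pos: "0 \<le> A" "0 \<le> D" "0 < c0" "0 \<le> mK" using S \<alpha> s by (auto simp: A_def D_def c0_def mK_def)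
  have chR: "0 \<le> ?ch z" if "z \<in> ?R" for z using that by (cases z) (auto simp: hat_def cbox_Pair_eq)
  have chK: "c0 \<le> ?ch z" "z \<in> ?R" if "z \<in> ?K" for z
  proof -
    obtain t x where z: "z = (t,x)" by (cases z)
    have tx': "s1 \<le> t" "t \<le> s2" "y1 \<le> x" "x \<le> y2" using that by (auto simp: z cbox_Pair_eq)
    show "z \<in> ?R" using tx' s by (auto simp: z cbox_Pair_eq t1_def t2_def x1_def x2_def)
    \<comment> \<open>On \<open>?K\<close> the distances to the two time ends are at least s1 / 2
      and 1, and to both space ends at least 1; this gives the lower bound \<open>c0\<close> of the
      cutoff.\<close>
    have "s1 / 2 * 1 \<le> hat t1 t2 t" "1 * 1 \<le> hat x1 x2 x" unfolding hat_def
      using tx' s by (intro mult_mono; simp add: t1_def t2_def x1_def x2_def)+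
    then have "s1 / 2 * 1 \<le> hat t1 t2 t * hat x1 x2 x" using s by (intro mult_mono) auto
    then show "c0 \<le> ?ch z" by (simp add: z c0_def)
  qed
  define C' where "C' = A * mK + D / c0 * Cw"
  have main: "incr_mass h (mom F \<psi>) ?K \<le> ennreal (C' * \<eta> powr \<sigma>)"
    if \<eta>: "0 < \<eta>" "\<eta> \<le> 1" and h: "h \<in> {(\<eta>,0), (0,\<eta>)}" for \<eta> h
  proof -
    define \<delta> where "\<delta> = \<eta> powr \<sigma>"
    have \<delta>: "0 < \<delta>" using \<eta> by (simp add: \<delta>_def)
    define G where "G z = indicator ?R z * (?ch z * wronski u b h z)" for z
    have iG: "integrable lborel G" unfolding G_def by (rule wronski_integrable[OF um bu bb])
    then have [measurable]: "G \<in> borel_measurable borel" by (simp add: borel_measurable_integrable[of lborel, simplified])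
    define f where "f z v = F (fst (z+h), snd (z+h), v) - F (fst z, snd z, v)" for z v
    have fm: "f z \<in> borel_measurable borel" for z unfolding f_def by (intro borel_measurable_diff section_measurable[OF F])
    have fb: "\<bar>f z v\<bar> \<le> 2 * C" for z v
      using C[of "(fst (z+h), snd (z+h), v)"] C[of "(fst z, snd z, v)"] unfolding f_def by linarith
    have key: "0 \<le> wronski u b h z \<and> (incr h (mom F \<psi>) z)\<^sup>2 \<le> A * \<delta> + D * \<delta> powr (-(\<beta>+1)) * wronski u b h z"
      if sg: "AE p in lborel. 0 \<le> f z (fst p) * f z (snd p)" for z
    proof -
      have W: "wronski u b h z = (\<integral>v. f z v * \<Psi> v \<partial>lborel) * (\<integral>v. f z v * (a' v * (v * \<Psi> v)) \<partial>lborel)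
     - (\<integral>v. f z v * (v * \<Psi> v) \<partial>lborel) * (\<integral>v. f z v * (a' v * \<Psi> v) \<partial>lborel)"
        unfolding wronski_def u_def b_def mom_incr[OF F C B1] mom_incr[OF F C B2] by (simp add: f_def \<omega>_def)
      have g: "incr h (mom F \<psi>) z = (\<integral>v. f z v * \<psi> v \<partial>lborel)"
        unfolding mom_incr[OF F C B'] by (simp add: f_def)
      show ?thesis using kinetic_lower_bound[OF fm fb B a' S B' \<Psi>(4) \<alpha>(2) \<alpha>(1) \<beta>0 \<delta> sg]
        unfolding W g A_def D_def by (simp add: mult_ac)
    qed
    have ae: "AE z in lborel. 0 < fst z \<longrightarrow> (0 \<le> wronski u b h z \<and> (incr h (mom F \<psi>) z)\<^sup>2 \<le> A * \<delta> + D * \<delta> powr (-(\<beta>+1)) * wronski u b h z)"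
      using sgn[OF less_imp_le[OF \<eta>(1)] h] by eventually_elim (use key in \<open>auto simp: f_def\<close>)
    define D' where "D' = D * \<delta> powr (-(\<beta>+1)) / c0"
    have D': "0 \<le> D'" using pos by (simp add: D'_def)
    \<comment> \<open>\<open>wronski_bound\<close> controls only a signed integral. Nonnegativity
      almost everywhere makes it the full mass over \<open>?R\<close>, so the part over
      \<open>?K\<close> is bounded by it as well.\<close>
    have G0: "AE z in lborel. 0 \<le> G z" using ae
    proof eventually_elim
      case (elim z)
      show ?case
      proof (cases "z \<in> ?R")
        case True
        then have "0 < fst z" using r0 by (cases z) (auto simp: cbox_Pair_eq)
        then show ?thesis using elim chR[OF True] True by (simp add: G_def)
      qed (simp add: G_def)
    qed
    have "incr_mass h (mom F \<psi>) ?K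
      \<le> (\<integral>\<^sup>+z. ennreal (A * \<delta>) * indicator ?K z + ennreal D' * ennreal (G z) \<partial>lborel)"
    proof (rule nn_integral_mono_AE)
      show "AE z in lborel. ennreal ((incr h (mom F \<psi>) z)\<^sup>2) * indicator ?K z \<le> ennreal (A * \<delta>) * indicator ?K z + ennreal D' * ennreal (G z)"
        using ae
      proof eventually_elim
        case (elim z)
        show ?case
        proof (cases "z \<in> ?K")
          case True
          then have "0 < fst z" using s by (cases z) (auto simp: cbox_Pair_eq)
          with elim have W: "0 \<le> wronski u b h z" "(incr h (mom F \<psi>) z)\<^sup>2 \<le> A * \<delta> + D * \<delta> powr (-(\<beta>+1)) * wronski u b h z" by auto
          have "D * \<delta> powr (-(\<beta>+1)) * wronski u b h z = D' * (c0 * wronski u b h z)" using pos by (simp add: D'_def)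
          also have "\<dots> \<le> D' * (?ch z * wronski u b h z)" using chK(1)[OF True] W D' by (intro mult_left_mono mult_right_mono)
          also have "\<dots> = D' * G z" using chK(2)[OF True] by (simp add: G_def)
          finally have "(incr h (mom F \<psi>) z)\<^sup>2 \<le> A * \<delta> + D' * G z" using W by linarith
          moreover have "0 \<le> G z" using chK[OF True] W pos by (simp add: G_def mult_nonneg_nonneg)
          ultimately have "ennreal ((incr h (mom F \<psi>) z)\<^sup>2) \<le> ennreal (A * \<delta>) + ennreal D' * ennreal (G z)"
            using pos \<delta> D' by (simp flip: ennreal_plus ennreal_mult add: ennreal_leI)
          then show ?thesis using True by simp
        qed simp
      qed
    qed
    also have "\<dots> = ennreal (A * \<delta>) * ennreal mK + ennreal D' * (\<integral>\<^sup>+z. ennreal (G z) \<partial>lborel)"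
      by (subst nn_integral_add) (auto simp: nn_integral_cmult nn_integral_cmult_indicator eK)
    also have "(\<integral>\<^sup>+z. ennreal (G z) \<partial>lborel) = ennreal (\<integral>z. G z \<partial>lborel)"
      by (rule nn_integral_eq_integral[OF iG G0])
    also have "ennreal (A * \<delta>) * ennreal mK + ennreal D' * ennreal (\<integral>z. G z \<partial>lborel) \<le> ennreal (A * \<delta>) * ennreal mK + ennreal D' * ennreal (Cw * \<eta>)"
      using Cw(2)[OF less_imp_le[OF \<eta>(1)] \<eta>(2) h] unfolding G_def[symmetric]
      by (intro add_left_mono mult_left_mono ennreal_leI) auto
    also have "\<dots> = ennreal (A * \<delta> * mK + D' * (Cw * \<eta>))"
      using pos \<delta> D' Cw(1) \<eta> by (simp flip: ennreal_plus ennreal_mult)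
    also have "A * \<delta> * mK + D' * (Cw * \<eta>) = C' * \<eta> powr \<sigma>"
    proof -
      \<comment> \<open>The balance of the two error terms: with \<sigma> = 1 / (2 + \<beta>), the
        off-diagonal term has the same power of \<eta> as the strip of width \<delta>.\<close>
      have "\<delta> powr (-(\<beta>+1)) * \<eta> = \<eta> powr (\<sigma> * (-(\<beta>+1))) * \<eta> powr 1" using \<eta> by (simp add: \<delta>_def powr_powr)
      also have "\<dots> = \<eta> powr (\<sigma> * (-(\<beta>+1)) + 1)" by (simp only: powr_add)
      also have "\<sigma> * (-(\<beta>+1)) + 1 = \<sigma>" using \<beta> by (simp add: \<sigma>_def field_simps)
      finally have e: "\<delta> powr (-(\<beta>+1)) * \<eta> = \<eta> powr \<sigma>" .
      have "D' * (Cw * \<eta>) = D / c0 * Cw * (\<delta> powr (-(\<beta>+1)) * \<eta>)" by (simp add: D'_def)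
      then show ?thesis unfolding e by (simp add: C'_def \<delta>_def algebra_simps)
    qed
    finally show ?thesis .
  qed
  show thesis
  proof (rule that[of C'])
    show "0 \<le> C'" using pos Cw(1) by (simp add: C'_def)
    fix \<eta> :: real and h assume \<eta>: "0 \<le> \<eta>" "\<eta> \<le> 1" and h: "h \<in> {(\<eta>,0), (0,\<eta>)}"
    show "incr_mass h (mom F \<psi>) ?K \<le> ennreal (C' * \<eta> powr (1 / (2 + \<beta>)))"
    \<comment> \<open>The cut at \<delta> needs \<delta> > 0, so the zero shift is treated apart;
      both sides vanish there.\<close>
    proof (cases "\<eta> = 0")
      case True
      then have "h = 0" using h by (auto simp: zero_prod_def)
      then show ?thesis by (simp add: incr_def)
    next
      case False
      then show ?thesis using main[of \<eta> h] \<eta> h by (simp add: \<sigma>_def)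
    qed
  qed
qed

section \<open>From axis-parallel increments to the Besov condition\<close>

lemma AE_lborel_null_cover:
  assumes "AE z in lborel. P z"
  obtains N where "N \<in> sets borel" "emeasure lborel N = 0" "\<And>z. z \<notin> N \<Longrightarrow> P z"
proof (rule AE_E[OF assms])
  fix N assume N: "{z \<in> space lborel. \<not> P z} \<subseteq> N" "emeasure lborel N = 0" "N \<in> sets lborel"
  show thesis by (rule that[of N]) (use N in auto)
qed

lemma AE_lborel_translate:
  fixes c :: "'a::euclidean_space"
  assumes "AE z in lborel. P z" shows "AE z in lborel. P (z + c)"
proof -
  obtain N where N [measurable]: "N \<in> sets borel" and N0: "emeasure lborel N = 0" "\<And>z. z \<notin> N \<Longrightarrow> P z"
    by (rule AE_lborel_null_cover[OF assms]) (rule that)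
  have "(\<integral>\<^sup>+z. indicator N (z + c) \<partial>lborel) = 0" using nn_integral_lborel_translate[of "indicator N" c] N0 by simp
  then have "AE z in lborel. indicator N (z + c) = (0::ennreal)" by (subst (asm) nn_integral_0_iff_AE) auto
  then show ?thesis by eventually_elim (use N0 in \<open>auto simp: indicator_def split: if_splits\<close>)
qed

text \<open>The space is nested as R x (R x 'c), while sections are taken in the first two
  coordinates jointly, so Tonelli is applied once per grouping. The type 'c serves both v and the
  pair (v, w).\<close>

lemma AE_lborel_sections:
  assumes "AE p in (lborel :: (real \<times> real \<times> 'c::euclidean_space) measure). P p"
  shows "AE z in lborel. AE r in lborel. P (fst z, snd z, r)"
proof -
  obtain N where N [measurable]: "N \<in> sets borel" and N0: "emeasure lborel N = 0" "\<And>z. z \<notin> N \<Longrightarrow> P z"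
    by (rule AE_lborel_null_cover[OF assms]) (rule that)
  let ?i = "indicator N :: (real \<times> real \<times> 'c) \<Rightarrow> ennreal"
  have [measurable]: "(\<lambda>q. ?i (fst (fst q), snd (fst q), snd q)) \<in> borel_measurable borel" by measurable
  have s1: "(\<lambda>q. ?i (t, q)) \<in> borel_measurable borel" for t by measurable
  define h where "h z = (\<integral>\<^sup>+r. ?i (fst z, snd z, r) \<partial>lborel)" for z
  have [measurable]: "h \<in> borel_measurable borel" unfolding h_def by (rule lborel.borel_measurable_nn_integral) (simp add: split_def)
  have "(\<integral>\<^sup>+z. h z \<partial>lborel) = (\<integral>\<^sup>+t. \<integral>\<^sup>+x. h (t,x) \<partial>lborel \<partial>lborel)"
    using lborel.nn_integral_fst[of h lborel] by (simp add: lborel_prod)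
  also have "\<dots> = (\<integral>\<^sup>+t. \<integral>\<^sup>+q. ?i (t,q) \<partial>lborel \<partial>lborel)"
    unfolding h_def using lborel.nn_integral_fst[of "\<lambda>q. ?i (t,q)" lborel for t] s1 by (simp add: lborel_prod)
  also have "\<dots> = (\<integral>\<^sup>+p. ?i p \<partial>lborel)" using lborel.nn_integral_fst[of ?i lborel] by (simp add: lborel_prod)
  also have "\<dots> = 0" using N0 by simp
  finally have "AE z in lborel. h z = 0" by (subst (asm) nn_integral_0_iff_AE) auto
  then show ?thesis
  proof eventually_elim
    case (elim z)
    have "(\<lambda>r. ?i (fst z, snd z, r)) \<in> borel_measurable borel" by measurable
    with elim have "AE r in lborel. ?i (fst z, snd z, r) = 0" unfolding h_def by (subst (asm) nn_integral_0_iff_AE) auto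
    then show ?case by eventually_elim (use N0 in \<open>auto simp: indicator_def split: if_splits\<close>)
  qed
qed

lemma AE_lborel_pair:
  assumes "AE v in (lborel :: real measure). P v"
  shows "AE p in lborel. P (fst p) \<and> P (snd p)"
proof -
  obtain N where N [measurable]: "N \<in> sets borel" and N0: "emeasure lborel N = 0" "\<And>z. z \<notin> N \<Longrightarrow> P z"
    by (rule AE_lborel_null_cover[OF assms]) (rule that)
  have aN: "AE v in lborel. v \<notin> N" using N0 by (intro AE_not_in) (simp add: null_sets_def)
  have m: "{p \<in> space (lborel \<Otimes>\<^sub>M lborel). fst p \<notin> N \<and> snd p \<notin> N} \<in> sets ((lborel :: real measure) \<Otimes>\<^sub>M (lborel :: real measure))"
    by measurable
  have "AE p in (lborel :: real measure) \<Otimes>\<^sub>M (lborel :: real measure). fst p \<notin> N \<and> snd p \<notin> N"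
    by (rule lborel_pair.AE_pair_measure[OF m]) (use aN in \<open>auto elim!: eventually_mono\<close>)
  then have "AE p in lborel. fst p \<notin> N \<and> snd p \<notin> N" unfolding lborel_prod .
  then show ?thesis by eventually_elim (use N0 in auto)
qed

lemma nn_integral_translate_le:
  fixes G :: "'a::euclidean_space \<Rightarrow> ennreal"
  assumes [measurable]: "G \<in> borel_measurable borel" "K' \<in> sets borel" and "\<And>z. z \<in> K \<Longrightarrow> z + c \<in> K'"
  shows "(\<integral>\<^sup>+z. G (z + c) * indicator K z \<partial>lborel) \<le> (\<integral>\<^sup>+z. G z * indicator K' z \<partial>lborel)"
proof -
  have "(\<integral>\<^sup>+z. G (z + c) * indicator K z \<partial>lborel) \<le> (\<integral>\<^sup>+z. G (z + c) * indicator K' (z + c) \<partial>lborel)"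
    using assms(3) by (intro nn_integral_mono mult_left_mono) (auto simp: indicator_def)
  also have "\<dots> = (\<integral>\<^sup>+z. G z * indicator K' z \<partial>lborel)" by (rule nn_integral_lborel_translate) measurable
  finally show ?thesis .
qed

lemma abs_powr_2: "\<bar>x::real\<bar> powr 2 = x\<^sup>2"
  by (simp add: powr_numeral)

text \<open>An arbitrary shift \<open>(s, y)\<close> is split into a time shift followed by a space shift; a shift by a negative
  amount is a positive one read from the translated point.\<close>

lemma besov_locI:
  fixes g g' :: "real \<times> real \<Rightarrow> real"
  assumes g'm [measurable]: "g' \<in> borel_measurable borel" and G: "\<And>z. \<bar>g' z\<bar> \<le> G"
    and ae: "AE z in lborel. 0 < fst z \<longrightarrow> g z = g' z" and \<sigma>: "0 < \<sigma>"
    and est: "\<And>s1 s2 y1 y2. 0 < s1 \<Longrightarrow> s1 \<le> s2 \<Longrightarrow> y1 \<le> y2 \<Longrightarrow> \<exists>C\<ge>0. \<forall>\<eta> h. 0 \<le> \<eta> \<longrightarrow> \<eta> \<le> 1 \<longrightarrow> h \<in> {(\<eta>,0), (0,\<eta>)} \<longrightarrow>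
       incr_mass h g' (cbox (s1,y1) (s2,y2)) \<le> ennreal (C * \<eta> powr (\<sigma> * 2))"
  shows "besov_loc \<sigma> 2 ({0<..} \<times> UNIV) g"
proof -
  let ?\<Omega> = "{0::real<..} \<times> (UNIV :: real set)"
  have meas: "g \<in> borel_measurable (lebesgue_on ?\<Omega>)"
  proof -
    \<comment> \<open>g agrees with a Borel function only almost everywhere, so its measurability
      comes from completeness of Lebesgue measure, after extension by zero to the whole
      plane.\<close>
    define g0 where "g0 z = (if z \<in> ?\<Omega> then g z else 0)" for z
    define g1 where "g1 z = indicator ?\<Omega> z * g' z" for z
    have "?\<Omega> \<in> sets borel" by (intro borel_open open_Times) auto
    then have "g1 \<in> borel_measurable borel" unfolding g1_def by measurable
    then have "g1 \<in> borel_measurable lebesgue" by (intro measurable_completion) simp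
    moreover have "AE z in lebesgue. g1 z = g0 z" using AE_completion[OF ae] by eventually_elim (auto simp: g0_def g1_def)
    ultimately have "g0 \<in> borel_measurable lebesgue" by (rule borel_measurable_AE)
    then have "g0 \<in> borel_measurable (lebesgue_on ?\<Omega>)" by (rule measurable_restrict_space1)
    then show ?thesis by (subst measurable_cong[of _ _ g0]) (auto simp: g0_def space_restrict_space)
  qed
  have pos: "0 < fst z" if "z \<in> K" "K \<subseteq> ?\<Omega>" for z K using that by auto
  have L2: "(\<integral>\<^sup>+ z \<in> K. ennreal (\<bar>g z\<bar> powr 2) \<partial>lebesgue) < \<infinity>" if K: "compact K" "K \<subseteq> ?\<Omega>" for K
  proof -
    have "(\<integral>\<^sup>+ z \<in> K. ennreal (\<bar>g z\<bar> powr 2) \<partial>lebesgue) = (\<integral>\<^sup>+ z \<in> K. ennreal (\<bar>g z\<bar> powr 2) \<partial>lborel)"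
      by (rule nn_integral_completion)
    also have "\<dots> \<le> (\<integral>\<^sup>+ z. ennreal (G\<^sup>2) * indicator K z \<partial>lborel)"
    proof (rule nn_integral_mono_AE)
      show "AE z in lborel. ennreal (\<bar>g z\<bar> powr 2) * indicator K z \<le> ennreal (G\<^sup>2) * indicator K z" using ae
      proof eventually_elim
        case (elim z)
        have "(g' z)\<^sup>2 \<le> G\<^sup>2" using power_mono[OF G[of z] abs_ge_zero, of 2] by simp
        then show ?case using elim pos[OF _ K(2)] by (auto simp: indicator_def abs_powr_2 intro!: ennreal_leI)
      qed
    qed
    also have "\<dots> = ennreal (G\<^sup>2) * emeasure lborel K" using K by (intro nn_integral_cmult_indicator) (simp add: borel_compact)
    also have "\<dots> < \<infinity>" using emeasure_compact_finite[OF K(1)] by (simp add: ennreal_mult_less_top)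
    finally show ?thesis .
  qed
  have incrs: "\<exists>C h0. C > 0 \<and> h0 > 0 \<and> (\<forall>h. norm h \<le> h0 \<longrightarrow>
             (\<integral>\<^sup>+ z \<in> K. ennreal (\<bar>g (z + h) - g z\<bar> powr 2) \<partial>lebesgue) \<le> ennreal (C * norm h powr (\<sigma> * 2)))"
    if K: "compact K" "K \<subseteq> ?\<Omega>" for K
  proof (cases "K = {}")
    case True then show ?thesis by (intro exI[of _ 1]) simp
  next
    case False
    have "continuous_on K fst" by (intro continuous_intros)
    then obtain z0 where z0: "z0 \<in> K" "\<And>z. z \<in> K \<Longrightarrow> fst z0 \<le> fst z"
      using continuous_attains_inf[OF K(1) False, of fst] by blast
    define s1 where "s1 = fst z0 / 2"
    have s1: "0 < s1" using z0 pos[OF _ K(2)] by (simp add: s1_def)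
    obtain T where T: "T > 0" "\<And>z. z \<in> K \<Longrightarrow> norm z \<le> T"
      using compact_imp_bounded[OF K(1)] by (meson bounded_pos)
    have inK: "2 * s1 \<le> fst z" "fst z \<le> T" "\<bar>snd z\<bar> \<le> T" if "z \<in> K" for z
      using z0(2)[OF that] T(2)[OF that] norm_fst_le[of "fst z" "snd z"] norm_snd_le[of "snd z" "fst z"] by (auto simp: s1_def)
    have s1T: "s1 \<le> T + 1" using inK[OF z0(1)] s1 by linarith
    let ?B = "cbox (s1, -(T+1)) (T+1, T+1)"
    obtain C where C: "C \<ge> 0" "\<And>\<eta> h. 0 \<le> \<eta> \<Longrightarrow> \<eta> \<le> 1 \<Longrightarrow> h \<in> {(\<eta>,0), (0,\<eta>)} \<Longrightarrow>
       incr_mass h g' ?B \<le> ennreal (C * \<eta> powr (\<sigma> * 2))"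
      using est[OF s1 s1T, of "-(T+1)" "T+1"] T(1) by auto
    \<comment> \<open>On K the time is at least 2 s1, so shifts of length at most s1 keep it above
      s1 > 0. Length at most 1 fits the axis-parallel estimates and the margin of
      \<open>?B\<close>.\<close>
    define h0 where "h0 = min s1 1"
    have "h0 > 0" using s1 by (simp add: h0_def)
    moreover have "(\<integral>\<^sup>+ z \<in> K. ennreal (\<bar>g (z + h) - g z\<bar> powr 2) \<partial>lebesgue) \<le> ennreal ((4 * C + 1) * norm h powr (\<sigma> * 2))"
      if h: "norm h \<le> h0" for h
    proof -
      obtain s y where sy: "h = (s, y)" by (cases h)
      have n: "\<bar>s\<bar> \<le> norm h" "\<bar>y\<bar> \<le> norm h" using norm_fst_le[of s y] norm_snd_le[of y s] by (simp_all add: sy)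
      have le: "\<bar>s\<bar> \<le> s1" "\<bar>s\<bar> \<le> 1" "\<bar>y\<bar> \<le> 1" using n h by (auto simp: h0_def)
      \<comment> \<open>Translations to the points from which each part of the shift has nonnegative
        length: for s < 0 the time increment is read from z + (s, 0), and likewise for y < 0 after
        the time shift.\<close>
      define c1 where "c1 = (min s 0, 0::real)"
      define c2 where "c2 = (s, min y 0)"
      have cB: "z + c1 \<in> ?B" "z + c2 \<in> ?B" if "z \<in> K" for z
        using inK[OF that] le s1 by (cases z; auto simp: c1_def c2_def cbox_Pair_eq min_def abs_le_iff)+
      define G1 where "G1 z = ennreal ((incr (\<bar>s\<bar>, 0) g' z)\<^sup>2)" for z
      define G2 where "G2 z = ennreal ((incr (0, \<bar>y\<bar>) g' z)\<^sup>2)" for z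
      have [measurable]: "G1 \<in> borel_measurable borel" "G2 \<in> borel_measurable borel" unfolding G1_def G2_def incr_def by measurable
      have split: "(g' (z + h) - g' z)\<^sup>2 \<le> 2 * (incr (\<bar>s\<bar>, 0) g' (z + c1))\<^sup>2 + 2 * (incr (0, \<bar>y\<bar>) g' (z + c2))\<^sup>2" for z
      proof -
        define a where "a = g' (z + (s, 0)) - g' z"
        define b where "b = g' (z + h) - g' (z + (s, 0))"
        have "incr (\<bar>s\<bar>, 0) g' (z + c1) = a \<or> incr (\<bar>s\<bar>, 0) g' (z + c1) = - a"
          by (cases z; cases "0 \<le> s") (auto simp: incr_def a_def c1_def zero_prod_def min_def)
        moreover have "incr (0, \<bar>y\<bar>) g' (z + c2) = b \<or> incr (0, \<bar>y\<bar>) g' (z + c2) = - b"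
          by (cases z; cases "0 \<le> y") (auto simp: incr_def b_def c2_def sy min_def)
        moreover have "(g' (z + h) - g' z)\<^sup>2 \<le> 2 * a\<^sup>2 + 2 * b\<^sup>2"
        proof -
          have "2 * a\<^sup>2 + 2 * b\<^sup>2 - (g' (z + h) - g' z)\<^sup>2 = (a - b)\<^sup>2" by (simp add: a_def b_def power2_eq_square algebra_simps)
          then show ?thesis using zero_le_power2[of "a - b"] by linarith
        qed
        ultimately show ?thesis by auto
      qed
      have "(\<integral>\<^sup>+ z \<in> K. ennreal (\<bar>g (z + h) - g z\<bar> powr 2) \<partial>lebesgue) = (\<integral>\<^sup>+ z \<in> K. ennreal (\<bar>g (z + h) - g z\<bar> powr 2) \<partial>lborel)"
        by (rule nn_integral_completion)
      also have "\<dots> \<le> (\<integral>\<^sup>+ z. 2 * (G1 (z + c1) * indicator K z) + 2 * (G2 (z + c2) * indicator K z) \<partial>lborel)"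
      proof (rule nn_integral_mono_AE)
        show "AE z in lborel. ennreal (\<bar>g (z + h) - g z\<bar> powr 2) * indicator K z \<le> 2 * (G1 (z + c1) * indicator K z) + 2 * (G2 (z + c2) * indicator K z)"
          using ae AE_lborel_translate[OF ae, of h]
        proof eventually_elim
          case (elim z)
          show ?case
          proof (cases "z \<in> K")
            case True
            have "0 < fst z" "0 < fst (z + h)" using inK[OF True] s1 le by (auto simp: sy)
            then have "g z = g' z" "g (z + h) = g' (z + h)" using elim by auto
            then have "ennreal (\<bar>g (z + h) - g z\<bar> powr 2) \<le> ennreal (2 * (incr (\<bar>s\<bar>, 0) g' (z + c1))\<^sup>2 + 2 * (incr (0, \<bar>y\<bar>) g' (z + c2))\<^sup>2)"
              unfolding abs_powr_2 using split[of z] by (simp only: ennreal_leI)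
            also have "\<dots> = 2 * G1 (z + c1) + 2 * G2 (z + c2)" by (simp add: G1_def G2_def ennreal_plus ennreal_mult)
            finally show ?thesis using True by simp
          qed simp
        qed
      qed
      also have "\<dots> = 2 * (\<integral>\<^sup>+ z. G1 (z + c1) * indicator K z \<partial>lborel) + 2 * (\<integral>\<^sup>+ z. G2 (z + c2) * indicator K z \<partial>lborel)"
      proof -
        have [measurable]: "K \<in> sets borel" using K by (simp add: borel_compact)
        show ?thesis by (simp add: nn_integral_add nn_integral_cmult)
      qed
      also have "\<dots> \<le> 2 * ennreal (C * norm h powr (\<sigma> * 2)) + 2 * ennreal (C * norm h powr (\<sigma> * 2))"
      proof (intro add_mono mult_left_mono)
        have mono: "ennreal (C * r powr (\<sigma> * 2)) \<le> ennreal (C * norm h powr (\<sigma> * 2))" if "0 \<le> r" "r \<le> norm h" for r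
          using that C(1) \<sigma> by (intro ennreal_leI mult_left_mono powr_mono2) auto
        have "(\<integral>\<^sup>+ z. G1 (z + c1) * indicator K z \<partial>lborel) \<le> (\<integral>\<^sup>+ z. G1 z * indicator ?B z \<partial>lborel)"
          by (rule nn_integral_translate_le[OF _ _ cB(1)]) auto
        also have "\<dots> \<le> ennreal (C * \<bar>s\<bar> powr (\<sigma> * 2))" unfolding G1_def by (rule C(2)) (use le in auto)
        also have "\<dots> \<le> ennreal (C * norm h powr (\<sigma> * 2))" by (rule mono) (use n in auto)
        finally show "(\<integral>\<^sup>+ z. G1 (z + c1) * indicator K z \<partial>lborel) \<le> ennreal (C * norm h powr (\<sigma> * 2))" .
        have "(\<integral>\<^sup>+ z. G2 (z + c2) * indicator K z \<partial>lborel) \<le> (\<integral>\<^sup>+ z. G2 z * indicator ?B z \<partial>lborel)"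
          by (rule nn_integral_translate_le[OF _ _ cB(2)]) auto
        also have "\<dots> \<le> ennreal (C * \<bar>y\<bar> powr (\<sigma> * 2))" unfolding G2_def by (rule C(2)) (use le in auto)
        also have "\<dots> \<le> ennreal (C * norm h powr (\<sigma> * 2))" by (rule mono) (use n in auto)
        finally show "(\<integral>\<^sup>+ z. G2 (z + c2) * indicator K z \<partial>lborel) \<le> ennreal (C * norm h powr (\<sigma> * 2))" .
      qed auto
      also have "\<dots> = ennreal (4 * C * norm h powr (\<sigma> * 2))"
      proof -
        have "2 * ennreal x + 2 * ennreal x = ennreal (4 * x)" if "0 \<le> x" for x
        proof -
          have "2 * ennreal x = ennreal (2 * x)" using that by (simp add: ennreal_mult)
          then show ?thesis using that by (simp flip: ennreal_plus)
        qed
        from this[of "C * norm h powr (\<sigma> * 2)"] show ?thesis using C(1) by (simp add: mult.assoc)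
      qed
      \<comment> \<open>The two halves together give 4 C; the summand 1 makes the constant strictly
        positive, as the Besov condition asks.\<close>
      also have "\<dots> \<le> ennreal ((4 * C + 1) * norm h powr (\<sigma> * 2))" by (intro ennreal_leI mult_right_mono) auto
      finally show ?thesis .
    qed
    ultimately show ?thesis using C(1) by (intro exI[of _ "4 * C + 1"] exI[of _ h0]) auto
  qed
  show ?thesis unfolding besov_loc_def using meas L2 incrs by blast
qed

section \<open>Passage to a bounded Borel representative\<close>

lemma AE_lebesgue_on_iff:
  fixes S :: "'a::euclidean_space set"
  assumes "S \<in> sets borel"
  shows "(AE x in lebesgue_on S. P x) \<longleftrightarrow> (AE x in lborel. x \<in> S \<longrightarrow> P x)"
proof -
  have "S \<inter> space lebesgue \<in> sets lebesgue" using assms by simp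
  then show ?thesis by (simp add: AE_restrict_space_iff AE_completion_iff)
qed

lemma borel_Dom3: "Dom3 \<in> sets borel"
  unfolding Dom3_def by (intro borel_open open_Times) auto

text \<open>A Borel function equal to f almost everywhere is clamped and set to zero outside the
  domain. The bound then holds everywhere, so all velocity sections and moments are bounded with no
  exceptional set.\<close>

lemma bounded_borel_representative:
  fixes f :: "real \<times> real \<times> real \<Rightarrow> real"
  assumes f: "f \<in> borel_measurable (lebesgue_on Dom3)" and bdd: "AE p in lebesgue_on Dom3. \<bar>f p\<bar> \<le> C"
  obtains F where "F \<in> borel_measurable borel" "\<And>p. \<bar>F p\<bar> \<le> max 0 C" "\<And>p. p \<notin> Dom3 \<Longrightarrow> F p = 0"
    "AE p in lborel. p \<in> Dom3 \<longrightarrow> f p = F p"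
proof -
  note [measurable] = borel_Dom3
  have "(\<lambda>p. if p \<in> Dom3 then f p else 0) \<in> borel_measurable lebesgue"
    using f borel_Dom3 by (intro borel_measurable_if_I) auto
  then obtain f1 where f1 [measurable]: "f1 \<in> borel_measurable lborel" and ae: "AE p in lborel. (if p \<in> Dom3 then f p else 0) = f1 p"
    using completion_ex_borel_measurable_real by blast
  define F where "F p = indicator Dom3 p * max (- max 0 C) (min (max 0 C) (f1 p))" for p
  have "F \<in> borel_measurable borel" unfolding F_def using f1 by measurable
  moreover have "\<bar>F p\<bar> \<le> max 0 C" for p by (auto simp: F_def indicator_def)
  moreover have "F p = 0" if "p \<notin> Dom3" for p using that by (simp add: F_def)
  moreover have "AE p in lborel. p \<in> Dom3 \<longrightarrow> f p = F p"
    using ae bdd[unfolded AE_lebesgue_on_iff[OF borel_Dom3]] by eventually_elim (auto simp: F_def)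
  ultimately show thesis using that by blast
qed

lemma integral_lebesgue_on_representative:
  fixes f F h :: "real \<times> real \<times> real \<Rightarrow> real"
  assumes f: "f \<in> borel_measurable (lebesgue_on Dom3)"
    and F [measurable]: "F \<in> borel_measurable borel" and F0: "\<And>p. p \<notin> Dom3 \<Longrightarrow> F p = 0"
    and ae: "AE p in lborel. p \<in> Dom3 \<longrightarrow> f p = F p"
    and h [measurable]: "h \<in> borel_measurable borel"
  shows "(\<integral>p. f p * h p \<partial>lebesgue_on Dom3) = (\<integral>p. F p * h p \<partial>lborel)"
proof -
  have "(\<integral>p. f p * h p \<partial>lebesgue_on Dom3) = (\<integral>p. F p * h p \<partial>lebesgue_on Dom3)"
  proof (rule integral_cong_AE)
    have "h \<in> borel_measurable (lebesgue_on Dom3)" "F \<in> borel_measurable (lebesgue_on Dom3)"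
      by (intro measurable_restrict_space1 measurable_completion; simp)+
    then show "(\<lambda>p. f p * h p) \<in> borel_measurable (lebesgue_on Dom3)" "(\<lambda>p. F p * h p) \<in> borel_measurable (lebesgue_on Dom3)"
      using f by (auto intro!: borel_measurable_times)
    show "AE p in lebesgue_on Dom3. f p * h p = F p * h p" unfolding AE_lebesgue_on_iff[OF borel_Dom3] using ae by eventually_elim auto
  qed
  also have "\<dots> = (\<integral>p. indicator Dom3 p *\<^sub>R (F p * h p) \<partial>lebesgue)"
    using borel_Dom3 by (intro integral_restrict_space) simp
  also have "\<dots> = (\<integral>p. F p * h p \<partial>lebesgue)"
    using F0 by (intro Bochner_Integration.integral_cong) (auto simp: indicator_def)
  also have "\<dots> = (\<integral>p. F p * h p \<partial>lborel)" by (rule integral_completion) simp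
  finally show ?thesis .
qed

lemma smooth3_continuous_pdiff3:
  assumes "smooth3 \<phi>" "i \<in> {0,1,2}" shows "continuous_on UNIV (pdiff3 i \<phi>)"
  using assms unfolding smooth3_def by (elim allE[of _ "[i]"]) auto

text \<open>Three exceptional sets are combined: that of the sign condition, and those where f and F
  differ at the base point or at the shifted point. The condition s \<ge> 0 keeps the shifted point
  in positive times, where f and F are comparable.\<close>

lemma shift_sign_representative:
  fixes f F :: "real \<times> real \<times> real \<Rightarrow> real"
  assumes s: "0 \<le> s"
    and sh: "AE q in lebesgue_on ({0<..} \<times> (UNIV :: (real \<times> real \<times> real) set)).
           (case q of (t, x, v, w) \<Rightarrow> (f (t + s, x + y, v) - f (t, x, v)) * (f (t + s, x + y, w) - f (t, x, w)) \<ge> 0)"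
    and ae: "AE p in lborel. p \<in> Dom3 \<longrightarrow> f p = F p"
  shows "AE z in lborel. 0 < fst z \<longrightarrow> same_sign F (s,y) z"
proof -
  have "{0::real<..} \<times> (UNIV :: (real \<times> real \<times> real) set) \<in> sets borel" by (intro borel_open open_Times) auto
  from sh[unfolded AE_lebesgue_on_iff[OF this]]
  have "AE z in lborel. AE p in lborel. 0 < fst z \<longrightarrow>
     0 \<le> (f (fst z + s, snd z + y, fst p) - f (fst z, snd z, fst p)) * (f (fst z + s, snd z + y, snd p) - f (fst z, snd z, snd p))"
    by (drule_tac AE_lborel_sections) (simp add: split_def)
  moreover have "AE z in lborel. AE v in lborel. 0 < fst z \<longrightarrow> f (fst z, snd z, v) = F (fst z, snd z, v)"
    using AE_lborel_sections[OF ae] by (simp add: Dom3_def)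
  moreover have "AE z in lborel. AE v in lborel. 0 < fst z + s \<longrightarrow> f (fst z + s, snd z + y, v) = F (fst z + s, snd z + y, v)"
    using AE_lborel_sections[OF AE_lborel_translate[OF ae, of "(s, y, 0)"]] by (simp add: Dom3_def)
  ultimately show ?thesis
  proof eventually_elim
    case (elim z)
    show ?case
    proof
      assume z: "0 < fst z"
      have z': "0 < fst z + s" using z s by simp
      show "same_sign F (s,y) z" using elim(1) AE_lborel_pair[OF elim(2)] AE_lborel_pair[OF elim(3)] by eventually_elim (use z z' in auto)
    qed
  qed
qed

text \<open>For almost every (t, x) the sections of f and F agree almost everywhere in v, which also
  makes the section of f Lebesgue measurable.\<close>

lemma mom_representative:
  fixes f F :: "real \<times> real \<times> real \<Rightarrow> real"
  assumes F [measurable]: "F \<in> borel_measurable borel" and w [measurable]: "w \<in> borel_measurable borel"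
    and ae: "AE p in lborel. p \<in> Dom3 \<longrightarrow> f p = F p"
  shows "AE z in lborel. 0 < fst z \<longrightarrow> (case z of (t, x) \<Rightarrow> \<integral>v. f (t, x, v) * w v \<partial>lebesgue) = mom F w z"
  using AE_lborel_sections[OF ae]
proof eventually_elim
  case (elim z)
  show ?case
  proof
    assume z: "0 < fst z"
    have m: "(\<lambda>v. F (fst z, snd z, v) * w v) \<in> borel_measurable borel"
      by (intro borel_measurable_times section_measurable[OF F] w)
    have m': "(\<lambda>v. F (fst z, snd z, v) * w v) \<in> borel_measurable lebesgue" by (intro measurable_completion) (use m in simp)
    have e: "AE v in lebesgue. F (fst z, snd z, v) * w v = f (fst z, snd z, v) * w v"
      using AE_completion[OF elim] by eventually_elim (use z in \<open>auto simp: Dom3_def\<close>)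
    have "(\<integral>v. f (fst z, snd z, v) * w v \<partial>lebesgue) = (\<integral>v. F (fst z, snd z, v) * w v \<partial>lebesgue)"
      using e by (intro integral_cong_AE m' borel_measurable_AE[OF m' e]) (auto elim: eventually_mono)
    also have "\<dots> = mom F w z" unfolding mom_def using m by (intro integral_completion) simp
    finally show "(case z of (t, x) \<Rightarrow> \<integral>v. f (t, x, v) * w v \<partial>lebesgue) = mom F w z" by (simp add: split_def)
  qed
qed

theorem theorem2:
  fixes a :: "real \<Rightarrow> real" and \<beta> :: real and \<gamma> :: nat
    and mp mn :: "(real \<times> real \<times> real) measure"
    and f :: "real \<times> real \<times> real \<Rightarrow> real"
    and \<psi> :: "real \<Rightarrow> real"
  assumes a_diff: "\<forall>v. a differentiable (at v)"
    and a_C1: "continuous_on UNIV (deriv a)"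
    and beta: "\<beta> \<ge> 1"
    and nondeg: "\<forall>M>0. \<exists>\<alpha>>0. \<forall>v w. -M \<le> w \<and> w < v \<and> v \<le> M \<longrightarrow>
                    deriv a v - deriv a w \<ge> \<alpha> * (v - w) powr \<beta>"
    and mp: "radon_on_Dom3 mp" and mn: "radon_on_Dom3 mn"
    and f_meas: "f \<in> borel_measurable (lebesgue_on Dom3)"
    and f_bdd: "\<exists>C. AE p in lebesgue_on Dom3. \<bar>f p\<bar> \<le> C"
    and kinetic: "\<forall>\<phi>. test_fun3 Dom3 \<phi> \<longrightarrow>
        - (\<integral>p. f p * (pdiff3 0 \<phi> p + deriv a (snd (snd p)) * pdiff3 1 \<phi> p) \<partial>lebesgue_on Dom3)
        = (-1) ^ \<gamma> * ((\<integral>p. iter_pdiff3 (replicate \<gamma> 2) \<phi> p \<partial>mp)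
                        - (\<integral>p. iter_pdiff3 (replicate \<gamma> 2) \<phi> p \<partial>mn))"
    and shift: "\<forall>y s. s \<ge> 0 \<longrightarrow>
        (AE q in lebesgue_on ({0<..} \<times> (UNIV :: (real \<times> real \<times> real) set)).
           (case q of (t, x, v, w) \<Rightarrow>
             (f (t + s, x + y, v) - f (t, x, v)) * (f (t + s, x + y, w) - f (t, x, w)) \<ge> 0))"
    and psi: "test_fun1 \<psi>"
  shows "besov_loc (1 / (4 + 2 * \<beta>)) 2 ({0<..} \<times> UNIV)
           (\<lambda>(t, x). \<integral>v. f (t, x, v) * \<psi> v \<partial>lebesgue)"
proof -
  define \<sigma> where "\<sigma> = 1 / (4 + 2 * \<beta>)"
  \<comment> \<open>The Besov condition with p = 2 measures the squared increment, so the rate 1 /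
    (2 + \<beta>) found for it is twice the regularity exponent.\<close>
  have \<sigma>: "0 < \<sigma>" "\<sigma> * 2 = 1 / (2 + \<beta>)" using beta by (auto simp: \<sigma>_def field_simps)
  obtain C where C: "AE p in lebesgue_on Dom3. \<bar>f p\<bar> \<le> C" using f_bdd by blast
  obtain F where F: "F \<in> borel_measurable borel" "\<And>p. \<bar>F p\<bar> \<le> max 0 C" "\<And>p. p \<notin> Dom3 \<Longrightarrow> F p = 0"
    and ae: "AE p in lborel. p \<in> Dom3 \<longrightarrow> f p = F p"
    by (rule bounded_borel_representative[OF f_meas C]) (rule that)
  obtain S where S: "smooth1 \<psi>" "0 < S" "\<And>v. S < \<bar>v\<bar> \<Longrightarrow> \<psi> v = 0"
    by (rule test_fun1_smooth1[OF psi]) (rule that)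
  obtain B where B: "kernel S B \<psi>" using kernelI[OF smooth1_continuous[OF S(1)] S(3)] by blast
  have kin: "kinetic_eq (deriv a) \<gamma> mp mn F" unfolding kinetic_eq_def
  proof (intro allI impI)
    fix \<phi> assume t: "test_fun3 Dom3 \<phi>"
    then have sm: "smooth3 \<phi>" by (simp add: test_fun3_def)
    have "continuous_on UNIV (\<lambda>p::real \<times> real \<times> real. deriv a (snd (snd p)))"
      by (intro continuous_on_compose2[OF a_C1] continuous_intros) auto
    then have "(\<lambda>p. pdiff3 0 \<phi> p + deriv a (snd (snd p)) * pdiff3 1 \<phi> p) \<in> borel_measurable borel"
      by (intro borel_measurable_continuous_onI continuous_intros smooth3_continuous_pdiff3[OF sm]) auto
    from integral_lebesgue_on_representative[OF f_meas F(1,3) ae this] kinetic[rule_format, OF t]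
    show "- (\<integral>p. F p * (pdiff3 0 \<phi> p + deriv a (snd (snd p)) * pdiff3 1 \<phi> p) \<partial>lborel)
        = (-1) ^ \<gamma> * ((\<integral>p. iter_pdiff3 (replicate \<gamma> 2) \<phi> p \<partial>mp) - (\<integral>p. iter_pdiff3 (replicate \<gamma> 2) \<phi> p \<partial>mn))"
      by simp
  qed
  have sgn: "AE z in lborel. 0 < fst z \<longrightarrow> same_sign F h z"
    if "0 \<le> \<eta>" "h \<in> {(\<eta>,0), (0,\<eta>)}" for \<eta> h
  proof -
    obtain s y where h: "h = (s, y)" by (cases h)
    have "0 \<le> s" using that h by auto
    then show ?thesis unfolding h using shift by (intro shift_sign_representative[OF _ _ ae]) auto
  qed
  have "besov_loc \<sigma> 2 ({0<..} \<times> UNIV) (\<lambda>(t, x). \<integral>v. f (t, x, v) * \<psi> v \<partial>lebesgue)"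
  proof (rule besov_locI[where g'="mom F \<psi>"])
    show "mom F \<psi> \<in> borel_measurable borel" by (rule mom_measurable[OF F(1) kernel_measurable[OF B]])
    show "\<bar>mom F \<psi> z\<bar> \<le> max 0 C * B * (2 * S)" for z using S by (intro mom_bounded[OF F(1,2) B]) simp
    show "AE z in lborel. 0 < fst z \<longrightarrow> (case z of (t, x) \<Rightarrow> \<integral>v. f (t, x, v) * \<psi> v \<partial>lebesgue) = mom F \<psi> z"
      by (rule mom_representative[OF F(1) kernel_measurable[OF B] ae])
    fix s1 s2 y1 y2 :: real assume s: "0 < s1" "s1 \<le> s2" "y1 \<le> y2"
    show "\<exists>C\<ge>0. \<forall>\<eta> h. 0 \<le> \<eta> \<longrightarrow> \<eta> \<le> 1 \<longrightarrow> h \<in> {(\<eta>,0), (0,\<eta>)} \<longrightarrow>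
       incr_mass h (mom F \<psi>) (cbox (s1,y1) (s2,y2)) \<le> ennreal (C * \<eta> powr (\<sigma> * 2))"
    \<comment> \<open>The majorant and the mollifiers are made from \<psi> and need a point where it
      is nonzero; otherwise the moment vanishes identically.\<close>
    proof (cases "\<exists>x0. \<psi> x0 \<noteq> 0")
      case True
      then obtain x0 where x0: "\<psi> x0 \<noteq> 0" by blast
      show ?thesis unfolding \<sigma>(2)
        by (rule increment_estimate[OF F(1,2) kin a_C1 mp mn beta nondeg S(1) x0 S(2) S(3) sgn s]) (assumption | blast)+
    next
      case False
      then have "mom F \<psi> = (\<lambda>z. 0)" by (simp add: mom_def[abs_def])
      then show ?thesis by (intro exI[of _ 0]) (simp add: incr_def)
    qed
  qed (rule \<sigma>(1))
  then show ?thesis by (simp add: \<sigma>_def)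
qed

end
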